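(* Let $x\in B_n$ be a rigid braid such that $USS(x)$ is minimal and has exactly two orbits under cycling. Then the centralizer of $x$ in $B_n$ is $Z(x)=\langle PC(x),\Delta^2\rangle$.
   Context: $B_n$ is the braid group with Artin generators $\sigma_1,\dots,\sigma_{n-1}$; $B_n^+$ is the submonoid of products of positive powers of the $\sigma_i$; $\Delta=(\sigma_1\cdots\sigma_{n-1})(\sigma_1\cdots\sigma_{n-2})\cdots(\sigma_1\sigma_2)\sigma_1$. Write $a\preccurlyeq b$ ("$a$ is a prefix of $b$") if $a^{-1}b\in B_n^+$; this is a lattice order with meet $\wedge$. The simple elements are the $s$ with $1\preccurlyeq s\preccurlyeq\Delta$. Put $\tau(x)=\Delta^{-1}x\Delta$, $x^\alpha=\alpha^{-1}x\alpha$, and $\partial(s)=s^{-1}\Delta$ for $s$ simple. A product $st$ of simple elements is left-weighted if $\partial(s)\wedge t=1$. Every $x\in B_n$ has a unique left normal form $x=\Delta^p x_1\cdots x_l$ with $p\in\mathbb Z$, $l\ge0$, each $x_i$ simple and different from $1,\Delta$, and each $x_ix_{i+1}$ left-weighted. Put $\ell(x)=l$ (canonical length). If $l>0$ let $\iota(x)=\tau^{-p}(x_1)$ and $\varphi(x)=x_l$; also $\iota(\Delta^p)=1$, $\varphi(\Delta^p)=\Delta$. One has $\iota(x^{-1})=\partial(\varphi(x))$. A braid $x$ with $\ell(x)>0$ is rigid if $\varphi(x)\iota(x)$ is left-weighted, equivalently $\iota(x)\wedge\iota(x^{-1})=1$. Cycling is $\mathbf c(x)=\iota(x)^{-1}x\,\iota(x)$.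 $\ell_s(x)$ is the minimal canonical length among conjugates of $x$; $SSS(x)$ is the set of conjugates of $x$ of canonical length $\ell_s(x)$; the ultra summit set is $USS(x)=\{y\in SSS(x):\mathbf c^m(y)=y\text{ for some }m>0\}$, a finite disjoint union of closed orbits under cycling. A rigid braid $x$ belongs to $USS(x)$. For $y\in USS(x)$, a simple element $s\ne1$ is a minimal simple element for $y$ (with respect to $USS(x)$) if $y^s\in USS(x)$ and $y^t\notin USS(x)$ for every $t$ with $1\ne t\preccurlyeq s$, $t\neq s$. The directed graph $\Gamma_x$ has vertex set $USS(x)$ and an arrow labelled $s$ from $y$ to $y^s$ for each minimal simple element $s$ for $y$. An arrow $s$ starting at $y$ is black if $s\preccurlyeq\iota(y)$ and grey if $s\preccurlyeq\iota(y^{-1})$ (a priori it may be both). $USS(x)$ is called minimal if $\ell_s(x)>1$ and, for every $y\in USS(x)$, there is only one black arrow starting at $y$, and it is labelled $\iota(y)$, and only one grey arrow starting at $y$, and it is labelled $\iota(y^{-1})=\partial(\varphi(y))$. The preferred cycling conjugator of $x$ is $PC(x)=\iota(x)\,\iota(\mathbf c(x))\cdots\iota(\mathbf c^{t-1}(x))$, where $t$ is the smallest positive integer such that $\mathbf c^t(x)=\mathbf c^i(x)$ for some $0\le i<t$ (so for $x\in USS(x)$, $t$ is the length of the cycling orbit of $x$). *)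

theory Defs
  imports "HOL-Algebra.Generated_Groups" "HOL-Algebra.Lattice" "HOL-Combinatorics.Orbits"
begin

section \<open>The braid group, by its Artin presentation\<close>

text \<open>
  A letter \<open>(i, True)\<close> stands for the generator \<open>\<sigma>\<^sub>i\<close>, a letter \<open>(i, False)\<close> for its inverse.
  The group on \<open>n\<close> strands has the generators \<open>\<sigma>\<^sub>1, \<dots>, \<sigma>\<^sub>n\<^sub>-\<^sub>1\<close>.
\<close>

type_synonym braid_word = "(nat \<times> bool) list"
type_synonym braid = "braid_word set"

definition braid_words :: "nat \<Rightarrow> braid_word set" where
  "braid_words n = lists ({1..<n} \<times> UNIV)"

text \<open>
  The congruence on words generated by free cancellation and the two families of Artin relations.
\<close>

inductive braid_cong :: "nat \<Rightarrow> braid_word \<Rightarrow> braid_word \<Rightarrow> bool" for n where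
  cancel: "i \<in> {1..<n} \<Longrightarrow> braid_cong n [(i, b), (i, \<not> b)] []"
| far: "i \<in> {1..<n} \<Longrightarrow> j \<in> {1..<n} \<Longrightarrow> i + 2 \<le> j \<Longrightarrow>
    braid_cong n [(i, True), (j, True)] [(j, True), (i, True)]"
| near: "i \<in> {1..<n} \<Longrightarrow> Suc i \<in> {1..<n} \<Longrightarrow>
    braid_cong n [(i, True), (Suc i, True), (i, True)]
                 [(Suc i, True), (i, True), (Suc i, True)]"
| refl: "w \<in> braid_words n \<Longrightarrow> braid_cong n w w"
| sym: "braid_cong n v w \<Longrightarrow> braid_cong n w v"
| trans: "braid_cong n u v \<Longrightarrow> braid_cong n v w \<Longrightarrow> braid_cong n u w"
| append: "braid_cong n u u' \<Longrightarrow> braid_cong n v v' \<Longrightarrow> braid_cong n (u @ v) (u' @ v')"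

definition braid_rel :: "nat \<Rightarrow> (braid_word \<times> braid_word) set" where
  "braid_rel n = {(v, w). braid_cong n v w}"

definition braid_group :: "nat \<Rightarrow> braid monoid" where
  "braid_group n =
     \<lparr>carrier = braid_words n // braid_rel n,
      monoid.mult = (\<lambda>a b. \<Union>u\<in>a. \<Union>v\<in>b. braid_rel n `` {u @ v}),
      one = braid_rel n `` {[]}\<rparr>"

lemma braid_cong_words: "braid_cong n v w \<Longrightarrow> v \<in> braid_words n \<and> w \<in> braid_words n"
  by (induction rule: braid_cong.induct) (auto simp: braid_words_def)

lemma equiv_braid_rel: "equiv (braid_words n) (braid_rel n)"
  by (rule equivI)
     (auto simp: braid_rel_def refl_on_def sym_def trans_def
           dest: braid_cong_words intro: braid_cong.intros)

lemma braid_mult_congruent2: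
  "congruent2 (braid_rel n) (braid_rel n) (\<lambda>u v. braid_rel n `` {u @ v})"
proof (rule congruent2I')
  fix u u' v v' assume "(u, u') \<in> braid_rel n" "(v, v') \<in> braid_rel n"
  then have "(u @ v, u' @ v') \<in> braid_rel n"
    by (auto simp: braid_rel_def intro: braid_cong.append)
  then show "braid_rel n `` {u @ v} = braid_rel n `` {u' @ v'}"
    by (rule equiv_class_eq[OF equiv_braid_rel])
qed

lemma braid_mult_class:
  assumes "u \<in> braid_words n" "v \<in> braid_words n"
  shows "(braid_rel n `` {u}) \<otimes>\<^bsub>braid_group n\<^esub> (braid_rel n `` {v}) = braid_rel n `` {u @ v}"
  using UN_equiv_class2[OF equiv_braid_rel equiv_braid_rel braid_mult_congruent2 assms]
  by (simp add: braid_group_def)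

lemma braid_inverse_word:
  assumes "w \<in> braid_words n"
  shows "rev (map (\<lambda>(i, b). (i, \<not> b)) w) \<in> braid_words n"
    and "braid_cong n (rev (map (\<lambda>(i, b). (i, \<not> b)) w) @ w) []"
proof -
  show *: "rev (map (\<lambda>(i, b). (i, \<not> b)) w) \<in> braid_words n"
    using assms by (fastforce simp: braid_words_def in_lists_conv_set)
  show "braid_cong n (rev (map (\<lambda>(i, b). (i, \<not> b)) w) @ w) []"
    using assms
  proof (induction w)
    case Nil
    then show ?case by (auto intro: braid_cong.refl)
  next
    case (Cons x w)
    obtain i b where x: "x = (i, b)" by (cases x)
    let ?r = "rev (map (\<lambda>(i, b). (i, \<not> b)) w)"
    have i: "i \<in> {1..<n}" and w: "w \<in> braid_words n"
      using Cons.prems x by (auto simp: braid_words_def)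
    have r: "?r \<in> braid_words n" using w by (fastforce simp: braid_words_def in_lists_conv_set)
    have "braid_cong n [(i, \<not> b), (i, b)] []"
      using braid_cong.cancel[OF i, of "\<not> b"] by simp
    then have "braid_cong n (?r @ ([(i, \<not> b), (i, b)] @ w)) (?r @ ([] @ w))"
      using r w by (intro braid_cong.append braid_cong.refl)
    then show ?case using Cons.IH[OF w] x by (auto intro: braid_cong.trans)
  qed
qed

lemma braid_group_is_group: "group (braid_group n)"
proof (rule groupI)
  let ?G = "braid_group n" and ?c = "\<lambda>w. braid_rel n `` {w}"
  have carr: "carrier ?G = braid_words n // braid_rel n"
    and one: "\<one>\<^bsub>?G\<^esub> = ?c []" by (simp_all add: braid_group_def)
  have nil: "[] \<in> braid_words n" by (simp add: braid_words_def)
  have app: "u @ v \<in> braid_words n" if "u \<in> braid_words n" "v \<in> braid_words n" for u v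
    using that by (simp add: braid_words_def)
  show "\<one>\<^bsub>?G\<^esub> \<in> carrier ?G" using nil by (simp add: carr one quotientI)
  fix x assume x: "x \<in> carrier ?G"
  then obtain u where u: "u \<in> braid_words n" "x = ?c u" unfolding carr by (rule quotientE)
  show "\<one>\<^bsub>?G\<^esub> \<otimes>\<^bsub>?G\<^esub> x = x" using u nil by (simp add: one braid_mult_class)
  show "\<exists>y\<in>carrier ?G. y \<otimes>\<^bsub>?G\<^esub> x = \<one>\<^bsub>?G\<^esub>"
  proof (rule bexI)
    let ?r = "rev (map (\<lambda>(i, b). (i, \<not> b)) u)"
    have "?c (?r @ u) = ?c []"
      using braid_inverse_word(2)[OF u(1)]
      by (intro equiv_class_eq[OF equiv_braid_rel]) (simp add: braid_rel_def)
    then show "?c ?r \<otimes>\<^bsub>?G\<^esub> x = \<one>\<^bsub>?G\<^esub>"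
      using u braid_inverse_word(1)[OF u(1)] by (simp only: one braid_mult_class)
    show "?c ?r \<in> carrier ?G"
      using braid_inverse_word(1)[OF u(1)] by (simp only: carr quotientI)
  qed
  fix y assume "y \<in> carrier ?G"
  then obtain v where v: "v \<in> braid_words n" "y = ?c v" unfolding carr by (rule quotientE)
  show "x \<otimes>\<^bsub>?G\<^esub> y \<in> carrier ?G"
    using u v app by (simp add: carr braid_mult_class quotientI)
  fix z assume "z \<in> carrier ?G"
  then obtain w where w: "w \<in> braid_words n" "z = ?c w" unfolding carr by (rule quotientE)
  show "x \<otimes>\<^bsub>?G\<^esub> y \<otimes>\<^bsub>?G\<^esub> z = x \<otimes>\<^bsub>?G\<^esub> (y \<otimes>\<^bsub>?G\<^esub> z)"
    using u v w app by (simp add: braid_mult_class)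
qed

section \<open>Garside structure\<close>

definition braid_gen :: "nat \<Rightarrow> nat \<Rightarrow> braid" where
  "braid_gen n i = braid_rel n `` {[(i, True)]}"

definition braid_prod :: "nat \<Rightarrow> braid list \<Rightarrow> braid" where
  "braid_prod n xs = foldr (\<lambda>a b. a \<otimes>\<^bsub>braid_group n\<^esub> b) xs \<one>\<^bsub>braid_group n\<^esub>"

definition braid_pos :: "nat \<Rightarrow> braid set" where
  "braid_pos n = {braid_prod n (map (braid_gen n) is) | is. set is \<subseteq> {1..<n}}"

text \<open>\<open>(\<sigma>\<^sub>1 \<cdots> \<sigma>\<^sub>n\<^sub>-\<^sub>1) (\<sigma>\<^sub>1 \<cdots> \<sigma>\<^sub>n\<^sub>-\<^sub>2) \<cdots> (\<sigma>\<^sub>1 \<sigma>\<^sub>2) \<sigma>\<^sub>1\<close>\<close>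

definition braid_Delta :: "nat \<Rightarrow> braid" where
  "braid_Delta n =
     braid_prod n (map (braid_gen n) (concat (map (\<lambda>k. [1..<Suc k]) (rev [1..<n]))))"

definition prefix_order :: "nat \<Rightarrow> braid gorder" where
  "prefix_order n =
     \<lparr>carrier = carrier (braid_group n),
      eq = (=),
      le = (\<lambda>a b. inv\<^bsub>braid_group n\<^esub> a \<otimes>\<^bsub>braid_group n\<^esub> b \<in> braid_pos n)\<rparr>"

definition simple_braids :: "nat \<Rightarrow> braid set" where
  "simple_braids n =
     {s \<in> carrier (braid_group n).
        \<one>\<^bsub>braid_group n\<^esub> \<sqsubseteq>\<^bsub>prefix_order n\<^esub> s \<and> s \<sqsubseteq>\<^bsub>prefix_order n\<^esub> braid_Delta n}"

definition braid_conj :: "nat \<Rightarrow> braid \<Rightarrow> braid \<Rightarrow> braid" where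
  "braid_conj n x a = inv\<^bsub>braid_group n\<^esub> a \<otimes>\<^bsub>braid_group n\<^esub> x \<otimes>\<^bsub>braid_group n\<^esub> a"

definition braid_compl :: "nat \<Rightarrow> braid \<Rightarrow> braid" where
  "braid_compl n s = inv\<^bsub>braid_group n\<^esub> s \<otimes>\<^bsub>braid_group n\<^esub> braid_Delta n"

definition left_weighted :: "nat \<Rightarrow> braid \<Rightarrow> braid \<Rightarrow> bool" where
  "left_weighted n s t \<longleftrightarrow>
     s \<in> simple_braids n \<and> t \<in> simple_braids n \<and>
     braid_compl n s \<sqinter>\<^bsub>prefix_order n\<^esub> t = \<one>\<^bsub>braid_group n\<^esub>"

section \<open>Left normal forms\<close>

definition left_normal_form :: "nat \<Rightarrow> braid \<Rightarrow> int \<Rightarrow> braid list \<Rightarrow> bool" where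
  "left_normal_form n x p xs \<longleftrightarrow>
     x = (braid_Delta n [^]\<^bsub>braid_group n\<^esub> p) \<otimes>\<^bsub>braid_group n\<^esub> braid_prod n xs \<and>
     set xs \<subseteq> simple_braids n - {\<one>\<^bsub>braid_group n\<^esub>, braid_Delta n} \<and>
     successively (left_weighted n) xs"

definition lnf_exponent :: "nat \<Rightarrow> braid \<Rightarrow> int" where
  "lnf_exponent n x = (THE p. \<exists>xs. left_normal_form n x p xs)"

definition lnf_factors :: "nat \<Rightarrow> braid \<Rightarrow> braid list" where
  "lnf_factors n x = (THE xs. \<exists>p. left_normal_form n x p xs)"

definition canonical_length :: "nat \<Rightarrow> braid \<Rightarrow> nat" where
  "canonical_length n x = length (lnf_factors n x)"

text \<open>
  With \<open>\<tau>(x) = \<Delta>\<^sup>-\<^sup>1 x \<Delta>\<close>, the iterate \<open>\<tau>\<^sup>k\<close> for an integer \<open>k\<close> is conjugation by \<open>\<Delta>\<^sup>k\<close>.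
\<close>

definition braid_tau_power :: "nat \<Rightarrow> int \<Rightarrow> braid \<Rightarrow> braid" where
  "braid_tau_power n k x = braid_conj n x (braid_Delta n [^]\<^bsub>braid_group n\<^esub> k)"

definition initial_factor :: "nat \<Rightarrow> braid \<Rightarrow> braid" where
  "initial_factor n x =
     (if canonical_length n x = 0 then \<one>\<^bsub>braid_group n\<^esub>
      else braid_tau_power n (- lnf_exponent n x) (hd (lnf_factors n x)))"

definition final_factor :: "nat \<Rightarrow> braid \<Rightarrow> braid" where
  "final_factor n x =
     (if canonical_length n x = 0 then braid_Delta n else last (lnf_factors n x))"

definition rigid :: "nat \<Rightarrow> braid \<Rightarrow> bool" where
  "rigid n x \<longleftrightarrow>
     canonical_length n x > 0 \<and> left_weighted n (final_factor n x) (initial_factor n x)"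

section \<open>Ultra summit sets\<close>

definition cycling :: "nat \<Rightarrow> braid \<Rightarrow> braid" where
  "cycling n x = braid_conj n x (initial_factor n x)"

definition conj_class :: "nat \<Rightarrow> braid \<Rightarrow> braid set" where
  "conj_class n x = braid_conj n x ` carrier (braid_group n)"

definition summit_length :: "nat \<Rightarrow> braid \<Rightarrow> nat" where
  "summit_length n x = (LEAST l. \<exists>y\<in>conj_class n x. canonical_length n y = l)"

definition super_summit_set :: "nat \<Rightarrow> braid \<Rightarrow> braid set" where
  "super_summit_set n x = {y \<in> conj_class n x. canonical_length n y = summit_length n x}"

definition ultra_summit_set :: "nat \<Rightarrow> braid \<Rightarrow> braid set" where
  "ultra_summit_set n x = {y \<in> super_summit_set n x. \<exists>m>0. (cycling n ^^ m) y = y}"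

text \<open>
  The library's \<open>orbit f y\<close> consists of the \<open>f\<^sup>k(y)\<close> with \<open>k > 0\<close>; elements of the ultra summit
  set are periodic under cycling, so here it contains \<open>y\<close> itself.
\<close>

definition cycling_orbits :: "nat \<Rightarrow> braid \<Rightarrow> braid set set" where
  "cycling_orbits n x = orbit (cycling n) ` ultra_summit_set n x"

text \<open>
  In the minimality condition \<open>t\<close> ranges over simple elements. Without \<open>1 \<sqsubseteq> t\<close> it would be void:
  \<open>\<Delta>\<^sup>-\<^sup>2\<close> is a prefix of every simple \<open>s\<close> and is central.
\<close>

definition minimal_simple :: "nat \<Rightarrow> braid \<Rightarrow> braid \<Rightarrow> braid \<Rightarrow> bool" where
  "minimal_simple n x y s \<longleftrightarrow>
     s \<in> simple_braids n \<and> s \<noteq> \<one>\<^bsub>braid_group n\<^esub> \<and>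
     braid_conj n y s \<in> ultra_summit_set n x \<and>
     (\<forall>t\<in>simple_braids n.
        t \<noteq> \<one>\<^bsub>braid_group n\<^esub> \<and> t \<sqsubseteq>\<^bsub>prefix_order n\<^esub> s \<and> t \<noteq> s \<longrightarrow>
        braid_conj n y t \<notin> ultra_summit_set n x)"

text \<open>
  The arrows of the graph \<open>\<Gamma>\<^sub>x\<close>, as triples (source, label, target); arrows with the same source and
  target but different labels are different arrows.
\<close>

definition uss_arrows :: "nat \<Rightarrow> braid \<Rightarrow> (braid \<times> braid \<times> braid) set" where
  "uss_arrows n x =
     {(y, s, braid_conj n y s) | y s. y \<in> ultra_summit_set n x \<and> minimal_simple n x y s}"

definition black_arrows :: "nat \<Rightarrow> braid \<Rightarrow> braid \<Rightarrow> (braid \<times> braid \<times> braid) set" where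
  "black_arrows n x y =
     {(y', s, z) \<in> uss_arrows n x. y' = y \<and> s \<sqsubseteq>\<^bsub>prefix_order n\<^esub> initial_factor n y}"

definition grey_arrows :: "nat \<Rightarrow> braid \<Rightarrow> braid \<Rightarrow> (braid \<times> braid \<times> braid) set" where
  "grey_arrows n x y =
     {(y', s, z) \<in> uss_arrows n x. y' = y \<and>
        s \<sqsubseteq>\<^bsub>prefix_order n\<^esub> initial_factor n (inv\<^bsub>braid_group n\<^esub> y)}"

definition minimal_uss :: "nat \<Rightarrow> braid \<Rightarrow> bool" where
  "minimal_uss n x \<longleftrightarrow>
     summit_length n x > 1 \<and>
     (\<forall>y\<in>ultra_summit_set n x.
        (\<exists>z. black_arrows n x y = {(y, initial_factor n y, z)}) \<and>
        (\<exists>z. grey_arrows n x y = {(y, initial_factor n (inv\<^bsub>braid_group n\<^esub> y), z)}))"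

section \<open>Preferred cycling conjugator and centralizer\<close>

definition cycling_period :: "nat \<Rightarrow> braid \<Rightarrow> nat" where
  "cycling_period n x = (LEAST t. 0 < t \<and> (\<exists>i<t. (cycling n ^^ t) x = (cycling n ^^ i) x))"

definition preferred_cycling_conjugator :: "nat \<Rightarrow> braid \<Rightarrow> braid" where
  "preferred_cycling_conjugator n x =
     braid_prod n (map (\<lambda>k. initial_factor n ((cycling n ^^ k) x)) [0..<cycling_period n x])"

definition braid_centralizer :: "nat \<Rightarrow> braid \<Rightarrow> braid set" where
  "braid_centralizer n x =
     {g \<in> carrier (braid_group n). g \<otimes>\<^bsub>braid_group n\<^esub> x = x \<otimes>\<^bsub>braid_group n\<^esub> g}"

end

theory Submission
  imports Defs
begin

text \<open>
  Let \<open>x\<close> be as in the theorem, write \<open>\<iota>\<close> for the initial factor and \<open>c\<close> for cycling, and let \<open>g\<close> commute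
  with \<open>x\<close>. Since \<open>\<Delta>\<^sup>2\<close> is central, \<open>g\<close> may be taken positive. Call \<open>g\<close> a conjugator from \<open>y\<close> if \<open>y\<close> and
  \<open>y\<^sup>g\<close> lie in the ultra summit set. The proof strips simple prefixes off a positive conjugator
  \<open>g \<noteq> 1\<close>: one of \<open>\<iota>(y)\<close> and \<open>\<iota>(y\<^sup>-\<^sup>1)\<close> is always a prefix of \<open>g\<close> (\<open>black_or_grey\<close>), and what is left is a
  shorter conjugator. Stripping \<open>\<iota>(y)\<close> replaces \<open>y\<close> by \<open>c(y)\<close>. If \<open>y = c(z)\<close>, then
  \<open>\<iota>(y\<^sup>-\<^sup>1) = \<iota>(z)\<^sup>-\<^sup>1 \<Delta>\<close>, so stripping \<open>\<iota>(y\<^sup>-\<^sup>1)\<close> undoes a cycling and conjugates by \<open>\<Delta>\<close>. With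
  \<open>W\<^sub>a(y)\<close> for the product of the initial factors of \<open>y, c(y), \<dots>, c\<^sup>a\<^sup>-\<^sup>1(y)\<close>, the result is an equation
  \<open>g W\<^sub>b(y\<^sup>g) = W\<^sub>a(y) \<Delta>\<^sup>k\<close> (\<open>conj_by_decomposition\<close>).

  For \<open>y = y\<^sup>g = x\<close> this gives \<open>c\<^sup>b(x) = c\<^sup>a(\<Delta>\<^sup>-\<^sup>k x \<Delta>\<^sup>k)\<close>. If \<open>k\<close> were odd, \<open>\<Delta>\<^sup>-\<^sup>1 x \<Delta>\<close> would lie in the
  cycling orbit of \<open>x\<close>; but every element of the ultra summit set is reached from \<open>x\<close> by a positive
  conjugator, so by the same decomposition there would be a single orbit
  (\<open>twist_not_in_orbit\<close>). So \<open>k\<close> is even, \<open>a - b\<close> is a multiple of the length of the orbit, and \<open>g\<close> is a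
  power of \<open>PC(x)\<close> times an even power of \<open>\<Delta>\<close> (\<open>centralizer_form\<close>).

  Three facts make the stripping work.
  \<^item> The conjugators from \<open>y\<close> are closed under meets (\<open>USS_meet\<close>). Cycling carries a conjugator to its
    transport, transport preserves meets, and an element that conjugates \<open>y\<close> into the super summit
    set is a conjugator exactly if iterated transport returns to it.
  \<^item> Every \<open>y\<close> in a minimal ultra summit set is rigid (\<open>USS_rigid\<close>): the meet of \<open>\<iota>(y)\<close> and \<open>\<iota>(y\<^sup>-\<^sup>1)\<close> is a
    conjugator, so by minimality it is \<open>1\<close> or equal to both, and in the second case cycling would
    shorten \<open>y\<close>.
  \<^item> If a simple \<open>t\<close> has no common prefix with \<open>\<iota>(y\<^sup>-\<^sup>1)\<close>, then multiplying \<open>y\<close> by \<open>t\<close> on the right does not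
    change the initial factor (\<open>initial_extend\<close>).

  All of this takes place in a group with a lattice order by prefixes. That the prefix order of the
  braid group is a lattice needs knowledge of which positive words are equal. Garside's lemma
  (\<open>common_lcm\<close>) gives it for the monoid with the positive relations, letting that monoid act on
  formal fractions shows that the inverses create no further equations between positive words
  (\<open>positive_words_embed\<close>), and least common multiples of generators then yield all meets
  (\<open>glb_exists_from_atoms\<close>).
\<close>

section \<open>The positive braid monoid\<close>

text \<open>
  The indices of the generators are unbounded. The positive relations preserve the set of letters of
  a word, so the positive braids on \<open>n\<close> strands are the classes with letters in \<open>{1..<n}\<close>, and the
  bound on the indices can wait.
\<close>
inductive braid_step :: "nat list \<Rightarrow> nat list \<Rightarrow> bool" where
  far: "i + 2 \<le> j \<or> j + 2 \<le> i \<Longrightarrow> braid_step (u @ [i, j] @ v) (u @ [j, i] @ v)"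
| near: "i = Suc j \<or> j = Suc i \<Longrightarrow> braid_step (u @ [i, j, i] @ v) (u @ [j, i, j] @ v)"

lemma braid_step_sym: "braid_step u v \<Longrightarrow> braid_step v u"
  by (induction rule: braid_step.induct) (metis braid_step.far, metis braid_step.near)

lemma braid_step_append: "braid_step u v \<Longrightarrow> braid_step (a @ u @ b) (a @ v @ b)"
proof (induction rule: braid_step.induct)
  case (far i j u v)
  then show ?case using braid_step.far[of i j "a @ u" "v @ b"] by simp
next
  case (near i j u v)
  then show ?case using braid_step.near[of i j "a @ u" "v @ b"] by simp
qed

definition braid_eq :: "nat list \<Rightarrow> nat list \<Rightarrow> bool" where
  "braid_eq = braid_step\<^sup>*\<^sup>*"

lemma braid_eq_refl [simp]: "braid_eq u u"
  by (simp add: braid_eq_def)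

lemma braid_eq_trans: "braid_eq u v \<Longrightarrow> braid_eq v w \<Longrightarrow> braid_eq u w"
  by (simp add: braid_eq_def)

lemma braid_eq_sym: "braid_eq u v \<Longrightarrow> braid_eq v u"
  unfolding braid_eq_def
  by (induction rule: rtranclp_induct) (auto intro: converse_rtranclp_into_rtranclp dest: braid_step_sym)

lemma braid_eq_context: "braid_eq u v \<Longrightarrow> braid_eq (a @ u @ b) (a @ v @ b)"
  unfolding braid_eq_def
  by (induction rule: rtranclp_induct) (auto intro: rtranclp.rtrancl_into_rtrancl dest: braid_step_append)

lemma braid_eq_append: "braid_eq u u' \<Longrightarrow> braid_eq v v' \<Longrightarrow> braid_eq (u @ v) (u' @ v')"
  using braid_eq_context[of u u' "[]" v] braid_eq_context[of v v' u' "[]"] by (auto intro: braid_eq_trans)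

lemma braid_step_invariants: "braid_step u v \<Longrightarrow> length u = length v \<and> set u = set v"
  by (induction rule: braid_step.induct) auto

lemma braid_eq_invariants: "braid_eq u v \<Longrightarrow> length u = length v \<and> set u = set v"
  unfolding braid_eq_def
  by (induction rule: rtranclp_induct) (simp_all add: braid_step_invariants)

quotient_type pbraid = "nat list" / braid_eq
  by (intro equivpI reflpI sympI transpI) (auto intro: braid_eq_sym braid_eq_trans)

instantiation pbraid :: monoid_mult
begin
lift_definition one_pbraid :: pbraid is "[]" .
lift_definition times_pbraid :: "pbraid \<Rightarrow> pbraid \<Rightarrow> pbraid" is "(@)"
  by (rule braid_eq_append)
instance by standard (transfer; simp)+
end

lift_definition gen :: "nat \<Rightarrow> pbraid" is "\<lambda>i. [i]" .
lift_definition len :: "pbraid \<Rightarrow> nat" is length by (simp add: braid_eq_invariants)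
lift_definition letters :: "pbraid \<Rightarrow> nat set" is set by (simp add: braid_eq_invariants)

lemma len_simps [simp]: "len 1 = 0" "len (gen i) = 1" "len (a * b) = len a + len b"
  by (transfer; simp)+

lemma letters_simps [simp]: "letters 1 = {}" "letters (gen i) = {i}" "letters (a * b) = letters a \<union> letters b"
  by (transfer; auto)+

definition word :: "nat list \<Rightarrow> pbraid" where
  "word w = prod_list (map gen w)"

lemma word_simps [simp]: "word [] = 1" "word (i # w) = gen i * word w" "word (u @ v) = word u * word v"
  by (simp_all add: word_def)

lemma abs_word: "abs_pbraid w = word w"
proof (induction w)
  case (Cons i w)
  have "abs_pbraid (i # w) = gen i * abs_pbraid w"
    by (simp add: gen.abs_eq times_pbraid.abs_eq)
  then show ?case using Cons by simp
qed (simp add: one_pbraid.abs_eq)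

lemma word_eq_iff: "word u = word v \<longleftrightarrow> braid_eq u v"
  by (simp add: pbraid.abs_eq_iff flip: abs_word)

lemma word_surj: obtains w where "a = word w"
  using pbraid.abs_induct[of "\<lambda>a. \<exists>w. a = word w" a] by (auto simp: abs_word)

lemma len_word [simp]: "len (word w) = length w"
  by (induction w) auto

lemma letters_word [simp]: "letters (word w) = set w"
  by (induction w) auto

definition adj :: "nat \<Rightarrow> nat \<Rightarrow> bool" where
  "adj i j \<longleftrightarrow> i = Suc j \<or> j = Suc i"

lemma adj_commute: "adj i j \<longleftrightarrow> adj j i"
  by (auto simp: adj_def)

lemma not_adj_refl [simp]: "\<not> adj i i"
  by (simp add: adj_def)

lemma gen_far: "i + 2 \<le> j \<or> j + 2 \<le> i \<Longrightarrow> gen i * gen j = gen j * gen i"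
  using word_eq_iff[of "[i, j]" "[j, i]"] braid_step.far[of i j "[]" "[]"] by (auto simp: braid_eq_def)

lemma gen_near: "adj i j \<Longrightarrow> gen i * (gen j * gen i) = gen j * (gen i * gen j)"
  using word_eq_iff[of "[i, j, i]" "[j, i, j]"] braid_step.near[of i j "[]" "[]"] by (auto simp: braid_eq_def adj_def)

text \<open>
  The product \<open>gen i * complement i j\<close> is the least common right multiple of the two generators:
  \<open>\<sigma>\<^sub>i \<sigma>\<^sub>j \<sigma>\<^sub>i\<close> for neighbours, \<open>\<sigma>\<^sub>i \<sigma>\<^sub>j\<close> for distant ones.
\<close>
definition complement :: "nat \<Rightarrow> nat \<Rightarrow> pbraid" where
  "complement i j = (if i = j then 1 else if adj i j then gen j * gen i else gen j)"

lemma gen_commute: "i \<noteq> j \<Longrightarrow> \<not> adj i j \<Longrightarrow> gen i * gen j = gen j * gen i"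
  by (rule gen_far) (unfold adj_def, linarith)

lemma gen_complement: "gen i * complement i j = gen j * complement j i"
  by (auto simp: complement_def gen_near gen_commute adj_commute[of i j])

section \<open>Garside's lemma\<close>

text \<open>
  A step that changes the first letter rewrites the least common multiple of the old and the new
  first letter, so a single step already satisfies Garside's lemma.
\<close>
lemma braid_step_Cons:
  assumes "braid_step (i # a) w"
  obtains (tail) a' where "w = i # a'" "braid_step a a'"
  | (head) k c where "w = k # (if adj i k then [i, k] else [i]) @ c" "a = (if adj i k then [k, i] else [k]) @ c" "i \<noteq> k"
  using assms
proof (cases rule: braid_step.cases)
  case (far i' j' u v)
  show ?thesis
  proof (cases u)
    case Nil
    then show ?thesis using far head[of j' v] by (auto simp: adj_def)
  next
    case (Cons x u')
    then show ?thesis using far tail[of "u' @ [j', i'] @ v"] braid_step.far[of i' j' u' v] by auto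
  qed
next
  case (near i' j' u v)
  show ?thesis
  proof (cases u)
    case Nil
    then show ?thesis using near head[of j' v] by (auto simp: adj_def)
  next
    case (Cons x u')
    then show ?thesis using near tail[of "u' @ [j', i', j'] @ v"] braid_step.near[of i' j' u' v] by auto
  qed
qed

text \<open>
  This is said of the tails of an equation \<open>gen i * a = gen j * b\<close>: the two sides are the two ways to
  read one multiple of the least common multiple of the generators.
\<close>
definition common_lcm :: "nat \<Rightarrow> nat \<Rightarrow> pbraid \<Rightarrow> pbraid \<Rightarrow> bool" where
  "common_lcm i j a b \<longleftrightarrow> (\<exists>c. a = complement i j * c \<and> b = complement j i * c)"

lemma common_lcm_sym: "common_lcm i j a b \<Longrightarrow> common_lcm j i b a"
  by (auto simp: common_lcm_def)

lemma common_lcm_refl [simp]: "common_lcm i i a b \<longleftrightarrow> a = b"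
  by (auto simp: common_lcm_def complement_def)

lemma common_lcm_far: "i \<noteq> j \<Longrightarrow> \<not> adj i j \<Longrightarrow> common_lcm i j a b \<longleftrightarrow> (\<exists>c. a = gen j * c \<and> b = gen i * c)"
  by (auto simp: common_lcm_def complement_def adj_commute[of j i])

lemma common_lcm_adj: "adj i j \<Longrightarrow> common_lcm i j a b \<longleftrightarrow> (\<exists>c. a = gen j * (gen i * c) \<and> b = gen i * (gen j * c))"
  by (auto simp: common_lcm_def complement_def mult.assoc adj_commute[of j i])

lemma gen_commute_left: "i \<noteq> j \<Longrightarrow> \<not> adj i j \<Longrightarrow> gen i * (gen j * c) = gen j * (gen i * c)"
  using arg_cong[OF gen_commute, of i j "\<lambda>x. x * c"] by (simp add: mult.assoc)

lemma gen_near_left: "adj i j \<Longrightarrow> gen i * (gen j * (gen i * c)) = gen j * (gen i * (gen j * c))"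
  using arg_cong[OF gen_near, of i j "\<lambda>x. x * c"] by (simp add: mult.assoc)

text \<open>
  The cube condition for three distinct generators. Three generators are never pairwise adjacent, and
  the last assumption selects one pattern from each mirror pair; five patterns remain. The
  hypothesis \<open>IH\<close> is Garside's lemma for shorter tails.
\<close>
lemma common_lcm_trans_aux:
  assumes IH: "\<And>i j a b. len a < m \<Longrightarrow> gen i * a = gen j * b \<Longrightarrow> common_lcm i j a b"
    and m: "len d = m"
    and ik: "common_lcm i k a d" and kj: "common_lcm k j d b"
    and dist: "i \<noteq> k" "k \<noteq> j" "i \<noteq> j" and wlog: "adj k j \<Longrightarrow> adj k i"
  shows "common_lcm i j a b"
proof -
  have [simp]: "adj k i \<longleftrightarrow> adj i k" "adj j k \<longleftrightarrow> adj k j" "adj j i \<longleftrightarrow> adj i j"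
    by (simp_all add: adj_commute)
  consider (mid) "adj i k" "adj k j" "\<not> adj i j" | (end1) "adj i k" "\<not> adj k j" "\<not> adj i j"
    | (end2) "adj i k" "\<not> adj k j" "adj i j" | (far) "\<not> adj i k" "\<not> adj k j" "adj i j" | (allfar) "\<not> adj i k" "\<not> adj k j" "\<not> adj i j"
  proof -
    have "\<not> (adj i k \<and> adj k j \<and> adj i j)" by (simp add: adj_def) presburger
    then show thesis using that wlog by (simp, blast)
  qed
  then show ?thesis
  proof cases
    case mid
    from mid ik obtain c1 where a: "a = gen k * (gen i * c1)" and d1: "d = gen i * (gen k * c1)"
      by (auto simp: common_lcm_adj)
    from mid kj obtain c2 where d2: "d = gen j * (gen k * c2)" and b: "b = gen k * (gen j * c2)"
      by (auto simp: common_lcm_adj)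
    have "common_lcm i j (gen k * c1) (gen k * c2)"
      using IH[of "gen k * c1" i j "gen k * c2"] d1 d2 m by auto
    then obtain c3 where c3: "gen k * c1 = gen j * c3" "gen k * c2 = gen i * c3"
      using mid dist by (auto simp: common_lcm_far)
    have l: "len d = 2 + len c1" "len d = 2 + len c2"
      using arg_cong[OF d1, of len] arg_cong[OF d2, of len] by simp_all
    have "common_lcm k j c1 c3" "common_lcm k i c2 c3"
      using IH[of c1 k j c3] IH[of c2 k i c3] c3 l m by auto
    then obtain c4 c5 where c4: "c1 = gen j * (gen k * c4)" "c3 = gen k * (gen j * c4)"
      and c5: "c2 = gen i * (gen k * c5)" "c3 = gen k * (gen i * c5)"
      using mid by (auto simp: common_lcm_adj)
    have "gen j * c4 = gen i * c5"
      using IH[of "gen j * c4" k k "gen i * c5"] c4 c5 l m by auto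
    then have "common_lcm j i c4 c5"
      using IH[of c4 j i c5] c4 l m by auto
    then obtain c6 where c6: "c4 = gen i * c6" "c5 = gen j * c6"
      using mid dist by (auto simp: common_lcm_far)
    have "a = gen j * (gen k * (gen j * (gen i * (gen k * c6))))"
    proof -
      have "a = gen k * (gen i * (gen j * (gen k * (gen i * c6))))" using a c4 c6 by simp
      also have "\<dots> = gen k * (gen j * (gen i * (gen k * (gen i * c6))))"
        using gen_commute_left[of i j] dist mid by simp
      also have "\<dots> = gen k * (gen j * (gen k * (gen i * (gen k * c6))))"
        using gen_near_left[of i k] mid by simp
      also have "\<dots> = gen j * (gen k * (gen j * (gen i * (gen k * c6))))"
        using gen_near_left[of k j] mid by simp
      finally show ?thesis .
    qed
    moreover have "b = gen i * (gen k * (gen j * (gen i * (gen k * c6))))"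
    proof -
      have "b = gen k * (gen j * (gen i * (gen k * (gen j * c6))))" using b c5 c6 by simp
      also have "\<dots> = gen k * (gen i * (gen j * (gen k * (gen j * c6))))"
        using gen_commute_left[of i j] dist mid by simp
      also have "\<dots> = gen k * (gen i * (gen k * (gen j * (gen k * c6))))"
        using gen_near_left[of j k] mid by auto
      also have "\<dots> = gen i * (gen k * (gen i * (gen j * (gen k * c6))))"
        using gen_near_left[of k i] mid by auto
      also have "\<dots> = gen i * (gen k * (gen j * (gen i * (gen k * c6))))"
        using gen_commute_left[of i j] dist mid by simp
      finally show ?thesis .
    qed
    ultimately show ?thesis using mid dist by (auto simp: common_lcm_far)
  next
    case end1
    from end1 ik obtain c1 where a: "a = gen k * (gen i * c1)" and d1: "d = gen i * (gen k * c1)"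
      by (auto simp: common_lcm_adj)
    from end1 dist kj obtain c2 where d2: "d = gen j * c2" and b: "b = gen k * c2"
      by (auto simp: common_lcm_far)
    have "common_lcm i j (gen k * c1) c2"
      using IH[of "gen k * c1" i j c2] d1 d2 m by auto
    then obtain c3 where c3: "gen k * c1 = gen j * c3" "c2 = gen i * c3"
      using end1 dist by (auto simp: common_lcm_far)
    have "len d = 2 + len c1" using arg_cong[OF d1, of len] by simp
    then have "common_lcm k j c1 c3" using IH[of c1 k j c3] c3 m by auto
    then obtain c4 where c4: "c1 = gen j * c4" "c3 = gen k * c4"
      using end1 dist by (auto simp: common_lcm_far)
    have "a = gen j * (gen k * (gen i * c4))"
      using a c4 gen_commute_left[of i j] gen_commute_left[of k j] dist end1 by simp
    moreover have "b = gen i * (gen k * (gen i * c4))"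
      using b c3 c4 gen_near_left[of k i] end1 by auto
    ultimately show ?thesis using end1 dist by (auto simp: common_lcm_far)
  next
    case end2
    from end2 ik obtain c1 where a: "a = gen k * (gen i * c1)" and d1: "d = gen i * (gen k * c1)"
      by (auto simp: common_lcm_adj)
    from end2 dist kj obtain c2 where d2: "d = gen j * c2" and b: "b = gen k * c2"
      by (auto simp: common_lcm_far)
    have "common_lcm i j (gen k * c1) c2"
      using IH[of "gen k * c1" i j c2] d1 d2 m by auto
    then obtain c3 where c3: "gen k * c1 = gen j * (gen i * c3)" "c2 = gen i * (gen j * c3)"
      using end2 by (auto simp: common_lcm_adj)
    have l: "len d = 2 + len c1" "len d = 3 + len c3"
      using arg_cong[OF d1, of len] arg_cong[OF c3(1), of len] by simp_all
    have "common_lcm k j c1 (gen i * c3)" using IH[of c1 k j "gen i * c3"] c3 l m by auto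
    then obtain c4 where c4: "c1 = gen j * c4" "gen i * c3 = gen k * c4"
      using end2 dist by (auto simp: common_lcm_far)
    have "common_lcm i k c3 c4" using IH[of c3 i k c4] c4 l m by auto
    then obtain c5 where c5: "c3 = gen k * (gen i * c5)" "c4 = gen i * (gen k * c5)"
      using end2 by (auto simp: common_lcm_adj)
    have "a = gen j * (gen i * (gen k * (gen i * (gen j * c5))))"
    proof -
      have "a = gen k * (gen i * (gen j * (gen i * (gen k * c5))))" using a c4 c5 by simp
      also have "\<dots> = gen k * (gen j * (gen i * (gen j * (gen k * c5))))"
        using gen_near_left[of i j] end2 by simp
      also have "\<dots> = gen j * (gen k * (gen i * (gen k * (gen j * c5))))"
        using gen_commute_left[of k j] dist end2 by simp
      also have "\<dots> = gen j * (gen i * (gen k * (gen i * (gen j * c5))))"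
        using gen_near_left[of k i] end2 by auto
      finally show ?thesis .
    qed
    moreover have "b = gen i * (gen j * (gen k * (gen i * (gen j * c5))))"
    proof -
      have "b = gen k * (gen i * (gen j * (gen k * (gen i * c5))))" using b c3 c5 by simp
      also have "\<dots> = gen k * (gen i * (gen k * (gen j * (gen i * c5))))"
        using gen_commute_left[of k j] dist end2 by simp
      also have "\<dots> = gen i * (gen k * (gen i * (gen j * (gen i * c5))))"
        using gen_near_left[of k i] end2 by auto
      also have "\<dots> = gen i * (gen k * (gen j * (gen i * (gen j * c5))))"
        using gen_near_left[of i j] end2 by auto
      also have "\<dots> = gen i * (gen j * (gen k * (gen i * (gen j * c5))))"
        using gen_commute_left[of k j] dist end2 by simp
      finally show ?thesis .
    qed
    ultimately show ?thesis using end2 by (auto simp: common_lcm_adj)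
  next
    case far
    from far dist ik obtain c1 where a: "a = gen k * c1" and d1: "d = gen i * c1"
      by (auto simp: common_lcm_far)
    from far dist kj obtain c2 where d2: "d = gen j * c2" and b: "b = gen k * c2"
      by (auto simp: common_lcm_far)
    have "common_lcm i j c1 c2" using IH[of c1 i j c2] d1 d2 m by auto
    then obtain c3 where c3: "c1 = gen j * (gen i * c3)" "c2 = gen i * (gen j * c3)"
      using far by (auto simp: common_lcm_adj)
    have "a = gen j * (gen i * (gen k * c3))" "b = gen i * (gen j * (gen k * c3))"
      using a b c3 gen_commute_left[of k j] gen_commute_left[of k i] dist far by auto
    then show ?thesis using far by (auto simp: common_lcm_adj)
  next
    case allfar
    from allfar dist ik obtain c1 where a: "a = gen k * c1" and d1: "d = gen i * c1"
      by (auto simp: common_lcm_far)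
    from allfar dist kj obtain c2 where d2: "d = gen j * c2" and b: "b = gen k * c2"
      by (auto simp: common_lcm_far)
    have "common_lcm i j c1 c2" using IH[of c1 i j c2] d1 d2 m by auto
    then obtain c3 where c3: "c1 = gen j * c3" "c2 = gen i * c3"
      using allfar dist by (auto simp: common_lcm_far)
    have "a = gen j * (gen k * c3)" "b = gen i * (gen k * c3)"
      using a b c3 gen_commute_left[of k j] gen_commute_left[of k i] dist allfar by auto
    then show ?thesis using allfar dist by (auto simp: common_lcm_far)
  qed
qed

lemma len_common_lcm: "common_lcm i j a b \<Longrightarrow> len a = len b"
  by (auto simp: common_lcm_def complement_def adj_commute[of j i])

text \<open>
  Garside's lemma passes from two equations with a common side, which starts with \<open>\<sigma>\<^sub>k\<close>, to the
  equation between the outer sides. When the outer letters agree, the common complement has to be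
  cancelled, which is Garside's lemma for equal letters.
\<close>
lemma common_lcm_trans:
  assumes IH: "\<And>i j a b. len a < m \<Longrightarrow> gen i * a = gen j * b \<Longrightarrow> common_lcm i j a b"
    and m: "len d = m"
    and ik: "common_lcm i k a d" and kj: "common_lcm k j d b"
  shows "common_lcm i j a b"
proof -
  consider "i = k" | "k = j" | (loop) "i = j" "i \<noteq> k" | (dist) "i \<noteq> k" "k \<noteq> j" "i \<noteq> j" by blast
  then show ?thesis
  proof cases
    case loop
    have cancel: "a = b" if "gen p * a = gen p * b" "len a < m" for p a b
      using IH[OF that(2,1)] by simp
    obtain c1 c2 where c: "a = complement i k * c1" "d = complement k i * c1" "d = complement k i * c2" "b = complement i k * c2"
      using ik kj loop by (auto simp: common_lcm_def)
    have "c1 = c2"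
    proof (cases "adj k i")
      case True
      then have d: "d = gen i * (gen k * c1)" "d = gen i * (gen k * c2)"
        using c loop by (auto simp: complement_def mult.assoc)
      then have "gen k * c1 = gen k * c2"
        using cancel[of i "gen k * c1" "gen k * c2"] m by auto
      moreover have "len d = 2 + len c1" using arg_cong[OF d(1), of len] by simp
      ultimately show ?thesis using cancel[of k c1 c2] m by simp
    next
      case False
      then have d: "d = gen i * c1" "d = gen i * c2"
        using c loop by (auto simp: complement_def mult.assoc)
      then show ?thesis using cancel[of i c1 c2] m by auto
    qed
    then show ?thesis using loop c by simp
  next
    case dist
    show ?thesis
    proof (cases "adj k j \<longrightarrow> adj k i")
      case True
      then show ?thesis using common_lcm_trans_aux[OF IH m ik kj] dist by blast
    next
      case False
      have "common_lcm j i b a"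
        by (rule common_lcm_trans_aux[OF IH m kj[THEN common_lcm_sym] ik[THEN common_lcm_sym]])
          (use dist False adj_commute in auto)
      then show ?thesis by (rule common_lcm_sym)
    qed
  qed (use ik kj in auto)
qed

lemma common_lcm_chain:
  assumes IH: "\<And>i j a b. len a < length u \<Longrightarrow> gen i * a = gen j * b \<Longrightarrow> common_lcm i j a b"
    and "(braid_step ^^ t) (i # u) (j # v)"
  shows "common_lcm i j (word u) (word v)"
  using assms
proof (induction t arbitrary: i u)
  case 0
  then show ?case by simp
next
  case (Suc t)
  from Suc.prems(2) obtain w where w: "braid_step (i # u) w" "(braid_step ^^ t) w (j # v)"
    by (meson relpowp_Suc_D2)
  from w(1) obtain k d where kd: "w = k # d" "common_lcm i k (word u) (word d)" 
  proof (cases rule: braid_step_Cons)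
    case (tail a')
    then show ?thesis
      using that[of i a'] by (auto simp: word_eq_iff braid_eq_def)
  next
    case (head k c)
    have "common_lcm i k (word u) (word ((if adj i k then [i, k] else [i]) @ c))"
      unfolding common_lcm_def complement_def using head
      by (intro exI[of _ "word c"]) (auto simp: mult.assoc adj_commute[of k i])
    with head show ?thesis using that by blast
  qed
  have l: "length d = length u" using len_common_lcm[OF kd(2)] by simp
  have "common_lcm k j (word d) (word v)"
    using Suc.IH[of d k] Suc.prems(1) w(2) kd(1) l by auto
  then show ?case
    using common_lcm_trans[OF Suc.prems(1) _ kd(2)] l by auto
qed

text \<open>
  Left cancellation is the case \<open>i = j\<close>, and the induction on the length of the tails proves both
  together. A chain of rewriting steps keeps the length, so along a whole chain the hypothesis is
  available for everything shorter.
\<close>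
theorem common_lcm: "gen i * a = gen j * b \<Longrightarrow> common_lcm i j a b"
proof (induction "len a" arbitrary: i j a b rule: less_induct)
  case less
  obtain u v where uv: "a = word u" "b = word v" by (metis word_surj)
  with less.prems have "braid_eq (i # u) (j # v)" by (simp flip: word_eq_iff)
  then obtain t where "(braid_step ^^ t) (i # u) (j # v)"
    unfolding braid_eq_def by (meson rtranclp_imp_relpowp)
  then show ?case
    using common_lcm_chain[of u t i j v] less.hyps uv by auto
qed

lemma gen_cancel: "gen i * a = gen i * b \<Longrightarrow> a = b"
  using common_lcm[of i a i b] by simp

lemma pbraid_cancel: "c * a = c * b \<Longrightarrow> a = (b :: pbraid)"
proof -
  obtain w where "c = word w" by (rule word_surj)
  moreover have "word w * a = word w * b \<Longrightarrow> a = b"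
    by (induction w) (auto simp: mult.assoc dest: gen_cancel)
  ultimately show "c * a = c * b \<Longrightarrow> a = b" by simp
qed

section \<open>The half twist\<close>

lemma gen_commute_word:
  "\<forall>j\<in>set w. j + 2 \<le> i \<Longrightarrow> gen i * word w = word w * gen i"
proof (induction w)
  case (Cons j w)
  then have "gen i * (gen j * word w) = gen j * (gen i * word w)"
    using arg_cong[OF gen_far[of i j], of "\<lambda>x. x * word w"] by (simp add: mult.assoc)
  with Cons show ?case by (simp add: mult.assoc)
qed simp

lemma gen_commute_letters:
  assumes "\<And>j. j \<in> letters a \<Longrightarrow> j + 2 \<le> i"
  shows "gen i * a = a * gen i"
proof -
  obtain w where "a = word w" by (rule word_surj)
  with assms show ?thesis using gen_commute_word[of w i] by simp
qed

definition row :: "nat \<Rightarrow> pbraid" where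
  "row k = word [1..<Suc k]"

definition col :: "nat \<Rightarrow> pbraid" where
  "col k = word (rev [1..<Suc k])"

primrec delta :: "nat \<Rightarrow> pbraid" where
  "delta 0 = 1"
| "delta (Suc n) = row n * delta n"

lemma row_simps: "row 0 = 1" "row (Suc n) = row n * gen (Suc n)"
  by (simp_all add: row_def)

lemma col_simps: "col 0 = 1" "col (Suc n) = gen (Suc n) * col n"
  by (simp_all add: col_def)

lemma letters_row: "letters (row n) = {1..n}"
  by (auto simp: row_def simp del: upt_Suc)

lemma letters_col: "letters (col n) = {1..n}"
  by (auto simp: col_def simp del: upt_Suc)

lemma letters_delta: "letters (delta n) \<subseteq> {1..<n}"
  by (induction n) (auto simp: letters_row)

lemma delta_word: "delta n = word (concat (map (\<lambda>k. [1..<Suc k]) (rev [1..<n])))"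
proof (induction n)
  case (Suc n)
  then show ?case by (cases "n = 0") (simp_all add: row_def mult.assoc)
qed simp

lemma row_gen: "1 \<le> i \<Longrightarrow> i < n \<Longrightarrow> row n * gen i = gen (Suc i) * row n"
proof (induction n)
  case (Suc n)
  show ?case
  proof (cases "i = n")
    case False
    then have "gen (Suc n) * gen i = gen i * gen (Suc n)" using Suc.prems by (intro gen_far) auto
    then have "row (Suc n) * gen i = (row n * gen i) * gen (Suc n)" by (simp add: row_simps mult.assoc)
    also have "\<dots> = gen (Suc i) * row (Suc n)"
      using Suc False by (simp add: row_simps mult.assoc)
    finally show ?thesis .
  next
    case True
    then obtain m where m: "n = Suc m" using Suc.prems by (cases n) auto
    have "row (Suc n) * gen i = row m * (gen n * (gen (Suc n) * gen n))"
      using True m by (simp add: row_simps mult.assoc)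
    also have "\<dots> = (row m * gen (Suc n)) * (gen n * gen (Suc n))"
      using gen_near[of n "Suc n"] by (simp add: mult.assoc adj_def)
    also have "row m * gen (Suc n) = gen (Suc n) * row m"
      using gen_commute_letters[of "row m" "Suc n"] m by (simp add: letters_row)
    finally show ?thesis using True m by (simp add: row_simps mult.assoc)
  qed
qed simp

lemma gen_col: "1 \<le> i \<Longrightarrow> i < n \<Longrightarrow> gen i * col n = col n * gen (Suc i)"
proof (induction n)
  case (Suc n)
  show ?case
  proof (cases "i = n")
    case False
    then have "gen i * gen (Suc n) = gen (Suc n) * gen i" using Suc.prems by (intro gen_far) auto
    then have "gen i * col (Suc n) = gen (Suc n) * (gen i * col n)"
      by (simp add: col_simps flip: mult.assoc)
    also have "\<dots> = col (Suc n) * gen (Suc i)"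
      using Suc False by (simp add: col_simps mult.assoc)
    finally show ?thesis .
  next
    case True
    then obtain m where m: "n = Suc m" using Suc.prems by (cases n) auto
    have "gen i * col (Suc n) = (gen n * (gen (Suc n) * gen n)) * col m"
      using True m by (simp add: col_simps mult.assoc)
    also have "\<dots> = gen (Suc n) * (gen n * (gen (Suc n) * col m))"
      using gen_near[of n "Suc n"] by (simp add: mult.assoc adj_def)
    also have "gen (Suc n) * col m = col m * gen (Suc n)"
      using gen_commute_letters[of "col m" "Suc n"] m by (simp add: letters_col)
    finally show ?thesis using True m by (simp add: col_simps mult.assoc)
  qed
qed simp

text \<open>
  With this second factorization every generator can be moved across \<open>delta (Suc n)\<close>: the factor
  \<open>row n\<close> at the front lets all generators but the first pass, the factor \<open>col n\<close> at the end all but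
  the last.
\<close>
lemma delta_Suc: "delta (Suc n) = delta n * col n"
proof (induction n)
  case (Suc n)
  have c: "gen (Suc n) * delta n = delta n * gen (Suc n)"
    using letters_delta[of n] by (intro gen_commute_letters) fastforce
  have "delta (Suc (Suc n)) = row n * (gen (Suc n) * delta n) * col n"
    using Suc by (simp add: row_simps mult.assoc)
  also have "\<dots> = delta (Suc n) * col (Suc n)"
    by (simp add: c col_simps mult.assoc)
  finally show ?case .
qed (simp add: row_simps col_simps)

lemma gen_delta: "1 \<le> i \<Longrightarrow> i < n \<Longrightarrow> gen i * delta n = delta n * gen (n - i)"
proof (induction n arbitrary: i)
  case (Suc n)
  consider "i < n" | "i = n" "n = 1" | (last) "i = n" "n > 1" using Suc.prems by linarith
  then show ?case
  proof cases
    case 1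
    have "gen i * delta (Suc n) = (gen i * delta n) * col n" by (simp only: delta_Suc mult.assoc)
    also have "\<dots> = delta n * (gen (n - i) * col n)" using Suc 1 by (simp add: mult.assoc)
    also have "\<dots> = delta n * (col n * gen (Suc (n - i)))" using Suc.prems 1 gen_col[of "n - i" n] by simp
    also have "\<dots> = delta (Suc n) * gen (Suc n - i)"
      using 1 by (simp add: delta_Suc Suc_diff_le mult.assoc del: delta.simps)
    finally show ?thesis .
  next
    case 2
    then show ?thesis by (simp add: row_simps)
  next
    case last
    have "gen i * delta (Suc n) = (row n * gen (n - 1)) * delta n"
      using last row_gen[of "n - 1" n] by (simp add: mult.assoc)
    also have "\<dots> = row n * (delta n * gen (n - (n - 1)))"
      using Suc.IH[of "n - 1"] last by (simp add: mult.assoc)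
    finally show ?thesis using last by (simp add: mult.assoc)
  qed
qed simp

lemma delta_flip:
  assumes "letters a \<subseteq> {1..<n}"
  obtains b where "a * delta n = delta n * b"
proof -
  obtain w where w: "a = word w" by (rule word_surj)
  have "set w \<subseteq> {1..<n} \<Longrightarrow> \<exists>b. word w * delta n = delta n * b"
  proof (induction w)
    case (Cons i w)
    then obtain b where "word w * delta n = delta n * b" by auto
    moreover have "gen i * delta n = delta n * gen (n - i)" using Cons.prems gen_delta by auto
    ultimately have "word (i # w) * delta n = delta n * (gen (n - i) * b)"
      by (simp add: mult.assoc) (simp flip: mult.assoc)
    then show ?case by blast
  qed (auto intro: exI[of _ 1])
  with w assms show thesis using that by auto
qed

text \<open>
  The last generator is obtained from the first: the square of \<open>delta (Suc n)\<close> starts with the first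
  generator followed by \<open>delta (Suc n)\<close>, hence with \<open>delta (Suc n)\<close> followed by the last generator, and
  \<open>delta (Suc n)\<close> cancels.
\<close>
lemma gen_dvd_delta: "1 \<le> i \<Longrightarrow> i < n \<Longrightarrow> \<exists>r. delta n = gen i * r"
proof (induction n arbitrary: i)
  case (Suc n)
  show ?case
  proof (cases "i < n")
    case True
    with Suc show ?thesis by (metis delta_Suc mult.assoc)
  next
    case False
    then have i: "i = n" using Suc.prems by simp
    show ?thesis
    proof (cases "n = 1")
      case True
      then show ?thesis using i by (auto simp: row_simps intro: exI[of _ 1])
    next
      case n: False
      then obtain r where "delta n = gen 1 * r" using Suc.IH[of 1] Suc.prems i by auto
      then have r: "delta (Suc n) = gen 1 * (r * col n)" by (simp add: delta_Suc mult.assoc del: delta.simps)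
      have "letters (r * col n) \<subseteq> {1..<Suc n}"
        using letters_delta[of "Suc n"] unfolding r by simp
      then obtain b where b: "r * col n * delta (Suc n) = delta (Suc n) * b" by (rule delta_flip)
      have "delta (Suc n) * delta (Suc n) = gen 1 * (r * col n * delta (Suc n))"
        by (subst r) (simp only: mult.assoc)
      also have "\<dots> = gen 1 * delta (Suc n) * b" unfolding b by (simp only: mult.assoc)
      also have "\<dots> = delta (Suc n) * (gen n * b)"
        using gen_delta[of 1 "Suc n"] n i Suc.prems by (simp add: mult.assoc del: delta.simps)
      finally show ?thesis using i pbraid_cancel by blast
    qed
  qed
qed simp

section \<open>The positive monoid embeds in the braid group\<close>

text \<open>
  The index is reversed so that \<open>cofactor n i * gen i = delta n\<close>: the fraction
  \<open>\<Delta>\<^sup>-\<^sup>1 cofactor n i\<close> stands for the inverse of \<open>\<sigma>\<^sub>i\<close>.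
\<close>
definition cofactor :: "nat \<Rightarrow> nat \<Rightarrow> pbraid" where
  "cofactor n i = (SOME r. delta n = gen (n - i) * r)"

context fixes n :: nat begin

abbreviation (input) "valid i \<equiv> i \<in> {1..<n}"

lemma valid_flip: "valid i \<Longrightarrow> valid (n - i)" by auto

lemma gen_cofactor: "valid i \<Longrightarrow> gen (n - i) * cofactor n i = delta n"
  using someI_ex[OF gen_dvd_delta[of "n - i" n]] by (auto simp: cofactor_def)

lemma cofactor_gen: "valid i \<Longrightarrow> cofactor n i * gen i = delta n"
proof -
  assume i: "valid i"
  have "gen (n - i) * (cofactor n i * gen i) = delta n * gen i"
    using gen_cofactor[OF i] by (simp flip: mult.assoc)
  also have "\<dots> = gen (n - i) * delta n" using gen_delta[of "n - i" n] i by auto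
  finally show ?thesis by (rule pbraid_cancel)
qed

lemma delta_cofactor: "valid i \<Longrightarrow> delta n * cofactor n i = cofactor n (n - i) * delta n"
proof -
  assume i: "valid i"
  have "gen i * (delta n * cofactor n i) = delta n * (gen (n - i) * cofactor n i)"
    using gen_delta[of i n] i by (simp flip: mult.assoc)
  also have "\<dots> = gen i * cofactor n (n - i) * delta n"
    using gen_cofactor[OF i] gen_cofactor[OF valid_flip[OF i]] i by simp
  finally show ?thesis by (simp only: mult.assoc pbraid_cancel)
qed

text \<open>
  Moving \<open>\<sigma>\<^sub>i\<close> across \<open>\<Delta>\<^sup>k\<close> turns it into the generator with index \<open>flip k i\<close>.
\<close>
definition flip :: "nat \<Rightarrow> nat \<Rightarrow> nat" where
  "flip k i = (if even k then i else n - i)"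

lemma valid_flip_pow: "valid i \<Longrightarrow> valid (flip k i)"
  by (auto simp: flip_def)

lemma flip_Suc: "valid i \<Longrightarrow> flip (Suc k) i = n - flip k i"
  by (auto simp: flip_def)

lemma delta_pow_gen: "valid i \<Longrightarrow> delta n ^ j * gen (flip k i) = gen (flip (j + k) i) * delta n ^ j"
proof (induction j)
  case (Suc j)
  have "delta n ^ Suc j * gen (flip k i) = delta n * gen (flip (j + k) i) * delta n ^ j"
    using Suc by (simp add: mult.assoc)
  also have "delta n * gen (flip (j + k) i) = gen (flip (Suc j + k) i) * delta n"
    using gen_delta[of "n - flip (j + k) i" n] valid_flip_pow[OF Suc.prems, of "j + k"]
    by (auto simp: flip_Suc[OF Suc.prems])
  finally show ?case by (simp add: mult.assoc)
qed simp

lemma delta_pow_cofactor: "valid i \<Longrightarrow> delta n ^ j * cofactor n (flip k i) = cofactor n (flip (j + k) i) * delta n ^ j"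
proof (induction j)
  case (Suc j)
  have "delta n ^ Suc j * cofactor n (flip k i) = delta n * cofactor n (flip (j + k) i) * delta n ^ j"
    using Suc by (simp add: mult.assoc)
  also have "delta n * cofactor n (flip (j + k) i) = cofactor n (flip (Suc j + k) i) * delta n"
    using delta_cofactor valid_flip_pow[OF Suc.prems, of "j + k"]
    by (auto simp: flip_Suc[OF Suc.prems])
  finally show ?case by (simp add: mult.assoc)
qed simp

text \<open>
  A pair \<open>(k, m)\<close> stands for the fraction \<open>\<Delta>\<^sup>-\<^sup>k m\<close>, and a letter acts by multiplication on the left. To
  get a fraction again, the letter is moved to the right of \<open>\<Delta>\<^sup>-\<^sup>k\<close>.
\<close>
fun act_letter :: "nat \<times> bool \<Rightarrow> nat \<times> pbraid \<Rightarrow> nat \<times> pbraid" where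
  "act_letter (i, True) (k, m) = (k, gen (flip k i) * m)"
| "act_letter (i, False) (k, m) = (Suc k, cofactor n (flip k i) * m)"

definition act :: "braid_word \<Rightarrow> nat \<times> pbraid \<Rightarrow> nat \<times> pbraid" where
  "act w = foldr act_letter w"

lemma act_simps [simp]:
  "act [] p = p" "act (x # w) p = act_letter x (act w p)" "act (u @ v) p = act u (act v p)"
  by (simp_all add: act_def)

text \<open>
  Equality of \<open>\<Delta>\<^sup>-\<^sup>k m\<close> and \<open>\<Delta>\<^sup>-\<^sup>l m'\<close>, cleared of denominators. It is transitive because the monoid is
  left cancellative.
\<close>
definition same_fraction :: "nat \<times> pbraid \<Rightarrow> nat \<times> pbraid \<Rightarrow> bool" where
  "same_fraction p q \<longleftrightarrow> delta n ^ fst q * snd p = delta n ^ fst p * snd q"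

lemma same_fraction_refl [simp]: "same_fraction p p"
  by (simp add: same_fraction_def)

lemma same_fraction_sym: "same_fraction p q \<Longrightarrow> same_fraction q p"
  by (simp add: same_fraction_def)

lemma same_fraction_trans:
  assumes "same_fraction p q" "same_fraction q r"
  shows "same_fraction p r"
proof -
  have c: "delta n ^ a * (delta n ^ b * x) = delta n ^ b * (delta n ^ a * x)" for a b x
    by (simp add: add.commute flip: mult.assoc power_add)
  have "delta n ^ fst q * (delta n ^ fst r * snd p) = delta n ^ fst r * (delta n ^ fst p * snd q)"
    using assms(1) by (simp add: c[of "fst q" "fst r"] same_fraction_def)
  also have "\<dots> = delta n ^ fst q * (delta n ^ fst p * snd r)"
    using assms(2) by (simp add: c[of _ "fst p"] same_fraction_def)
  finally show ?thesis unfolding same_fraction_def by (rule pbraid_cancel)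
qed

lemma act_letter_cong:
  assumes "valid i" "same_fraction p q"
  shows "same_fraction (act_letter (i, b) p) (act_letter (i, b) q)"
proof -
  obtain k m k' m' where pq: "p = (k, m)" "q = (k', m')" by (cases p, cases q)
  have e: "delta n ^ k' * m = delta n ^ k * m'" using assms(2) pq by (simp add: same_fraction_def)
  show ?thesis
  proof (cases b)
    case True
    have "delta n ^ k' * (gen (flip k i) * m) = gen (flip (k' + k) i) * (delta n ^ k' * m)"
      using delta_pow_gen[OF assms(1), of k' k] by (simp flip: mult.assoc)
    also have "\<dots> = delta n ^ k * (gen (flip k' i) * m')"
      using delta_pow_gen[OF assms(1), of k k'] e by (simp add: add.commute) (simp flip: mult.assoc)
    finally show ?thesis using True pq by (simp add: same_fraction_def)
  next
    case False
    have "delta n ^ k' * (cofactor n (flip k i) * m) = cofactor n (flip (k' + k) i) * (delta n ^ k' * m)"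
      using delta_pow_cofactor[OF assms(1), of k' k] by (simp flip: mult.assoc)
    also have "\<dots> = delta n ^ k * (cofactor n (flip k' i) * m')"
      using delta_pow_cofactor[OF assms(1), of k k'] e by (simp add: add.commute) (simp flip: mult.assoc)
    finally show ?thesis using False pq by (simp add: same_fraction_def mult.assoc)
  qed
qed

lemma act_cong_refl: "w \<in> braid_words n \<Longrightarrow> same_fraction p q \<Longrightarrow> same_fraction (act w p) (act w q)"
  by (induction w) (auto simp: braid_words_def intro: act_letter_cong)

lemma act_cancel: "valid i \<Longrightarrow> same_fraction (act [(i, b), (i, \<not> b)] p) p"
proof -
  assume i: "valid i"
  obtain k m where p: "p = (k, m)" by (cases p)
  have j: "valid (flip k i)" using i by (rule valid_flip_pow)
  show ?thesis
    using gen_cofactor[OF j] cofactor_gen[OF j] p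
    by (cases b) (simp_all add: same_fraction_def flip_Suc[OF i] power_commutes flip: mult.assoc)
qed

lemma act_far: "valid i \<Longrightarrow> valid j \<Longrightarrow> i + 2 \<le> j \<Longrightarrow> act [(i, True), (j, True)] p = act [(j, True), (i, True)] p"
proof -
  assume ij: "valid i" "valid j" "i + 2 \<le> j"
  then have "gen (flip (fst p) i) * gen (flip (fst p) j) = gen (flip (fst p) j) * gen (flip (fst p) i)"
    by (intro gen_far) (auto simp: flip_def)
  then show ?thesis by (cases p) (simp flip: mult.assoc)
qed

lemma act_near: "valid i \<Longrightarrow> valid (Suc i) \<Longrightarrow>
    act [(i, True), (Suc i, True), (i, True)] p = act [(Suc i, True), (i, True), (Suc i, True)] p"
proof -
  assume "valid i" "valid (Suc i)"
  then have "adj (flip (fst p) i) (flip (fst p) (Suc i))" by (auto simp: flip_def adj_def)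
  then show ?thesis
    using gen_near_left[of "flip (fst p) i" "flip (fst p) (Suc i)" "snd p"] by (cases p) simp
qed

lemma act_cong: "braid_cong n u v \<Longrightarrow> same_fraction p q \<Longrightarrow> same_fraction (act u p) (act v q)"
proof (induction arbitrary: p q rule: braid_cong.induct)
  case (cancel i b)
  then show ?case using act_cancel same_fraction_trans by (metis act_simps(1))
next
  case (far i j)
  then have "same_fraction (act [(i, True), (j, True)] p) (act [(i, True), (j, True)] q)"
    by (intro act_cong_refl) (auto simp: braid_words_def)
  then show ?case using act_far[OF far.hyps] by simp
next
  case (near i)
  then have "same_fraction (act [(i, True), (Suc i, True), (i, True)] p) (act [(i, True), (Suc i, True), (i, True)] q)"
    by (intro act_cong_refl) (auto simp: braid_words_def)
  then show ?case using act_near[OF near.hyps] by simp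
next
  case (refl w)
  then show ?case by (rule act_cong_refl)
next
  case (sym v w)
  then show ?case by (blast intro: same_fraction_sym)
next
  case (trans u v w)
  then show ?case by (meson same_fraction_trans same_fraction_refl)
next
  case (append u u' v v')
  then show ?case by simp
qed

definition pos_word :: "nat list \<Rightarrow> braid_word" where
  "pos_word w = map (\<lambda>i. (i, True)) w"

lemma pos_word_simps [simp]:
  "pos_word [] = []" "pos_word (i # w) = (i, True) # pos_word w" "pos_word (u @ v) = pos_word u @ pos_word v"
  by (simp_all add: pos_word_def)

lemma pos_word_in_braid_words [simp]: "pos_word w \<in> braid_words n \<longleftrightarrow> set w \<subseteq> {1..<n}"
  by (auto simp: pos_word_def braid_words_def)

lemma act_pos_word: "act (pos_word w) (0, 1) = (0, word w)"
  by (induction w) (simp_all add: flip_def)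

text \<open>
  Congruent words act in the same way on fractions, and a positive word takes the fraction \<open>1\<close> to its
  own class in the monoid.
\<close>
theorem positive_words_embed: "braid_cong n (pos_word u) (pos_word v) \<Longrightarrow> word u = word v"
  using act_cong[of "pos_word u" "pos_word v" "(0, 1)" "(0, 1)"]
  by (simp add: act_pos_word same_fraction_def)

lemma braid_step_braid_cong: "braid_step u v \<Longrightarrow> set u \<subseteq> {1..<n} \<Longrightarrow> braid_cong n (pos_word u) (pos_word v)"
proof (induction rule: braid_step.induct)
  case (far i j u v)
  have "braid_cong n [(i, True), (j, True)] [(j, True), (i, True)]"
    using far braid_cong.far[of i n j] braid_cong.sym[OF braid_cong.far[of j n i]] by auto
  then have "braid_cong n (pos_word u @ [(i, True), (j, True)] @ pos_word v) (pos_word u @ [(j, True), (i, True)] @ pos_word v)"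
    using far.prems by (intro braid_cong.append braid_cong.refl) auto
  then show ?case by simp
next
  case (near i j u v)
  have "braid_cong n [(i, True), (j, True), (i, True)] [(j, True), (i, True), (j, True)]"
    using near braid_cong.near[of i n] braid_cong.sym[OF braid_cong.near[of j n]] by auto
  then have "braid_cong n (pos_word u @ [(i, True), (j, True), (i, True)] @ pos_word v)
      (pos_word u @ [(j, True), (i, True), (j, True)] @ pos_word v)"
    using near.prems by (intro braid_cong.append braid_cong.refl) auto
  then show ?case by simp
qed

lemma word_eq_braid_cong:
  assumes "word u = word v" "set u \<subseteq> {1..<n}"
  shows "braid_cong n (pos_word u) (pos_word v)"
proof -
  have "braid_step\<^sup>*\<^sup>* u v" using assms(1) by (simp add: word_eq_iff braid_eq_def)
  then show ?thesis
  proof (induction rule: rtranclp_induct)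
    case base
    then show ?case using assms(2) by (auto intro: braid_cong.refl)
  next
    case (step v w)
    then show ?case
      using braid_step_braid_cong[of v w] braid_cong_words[of n "pos_word u" "pos_word v"] by (auto intro: braid_cong.trans)
  qed
qed

end

section \<open>Groups with a Garside element\<close>

text \<open>
  A group \<open>G\<close> with a submonoid \<open>P\<close> of positive elements and a Garside element \<open>D\<close>. The additive length,
  for braids the exponent sum, makes divisibility in \<open>P\<close> well-founded and antisymmetric.
\<close>
locale quasi_garside = group G for G (structure) +
  fixes P :: "'a set" and D :: 'a and len :: "'a \<Rightarrow> int"
  assumes P_carrier: "a \<in> P \<Longrightarrow> a \<in> carrier G"
    and P_one: "\<one> \<in> P"
    and P_mult: "a \<in> P \<Longrightarrow> b \<in> P \<Longrightarrow> a \<otimes> b \<in> P"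
    and len_mult: "a \<in> carrier G \<Longrightarrow> b \<in> carrier G \<Longrightarrow> len (a \<otimes> b) = len a + len b"
    and len_pos: "a \<in> P \<Longrightarrow> a \<noteq> \<one> \<Longrightarrow> 0 < len a"
    and finite_P: "finite {a \<in> P. len a \<le> m}"
    and D_P: "D \<in> P" and D_nontrivial: "D \<noteq> \<one>"
    and D_conj: "a \<in> P \<Longrightarrow> inv D \<otimes> a \<otimes> D \<in> P"
    and D_square_central: "a \<in> carrier G \<Longrightarrow> D \<otimes> D \<otimes> a = a \<otimes> (D \<otimes> D)"
    and D_bound: "a \<in> carrier G \<Longrightarrow> \<exists>k::nat. D [^] k \<otimes> a \<in> P"
begin

definition pre :: "'a \<Rightarrow> 'a \<Rightarrow> bool" (infix "\<preceq>" 50) where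
  "a \<preceq> b \<longleftrightarrow> inv a \<otimes> b \<in> P"

definition Dpow :: "int \<Rightarrow> 'a" where
  "Dpow k = D [^] k"

lemma cancel_left [simp]:
  "a \<in> carrier G \<Longrightarrow> b \<in> carrier G \<Longrightarrow> inv a \<otimes> (a \<otimes> b) = b"
  "a \<in> carrier G \<Longrightarrow> b \<in> carrier G \<Longrightarrow> a \<otimes> (inv a \<otimes> b) = b"
  by (simp_all flip: m_assoc)

lemma D_carrier [simp]: "D \<in> carrier G"
  by (simp add: D_P P_carrier)

lemma Dpow_carrier [simp]: "Dpow k \<in> carrier G"
  by (simp add: Dpow_def)

lemma Dpow_add: "Dpow i \<otimes> Dpow j = Dpow (i + j)"
  by (simp add: Dpow_def int_pow_mult)

lemma Dpow_add_left: "a \<in> carrier G \<Longrightarrow> Dpow i \<otimes> (Dpow j \<otimes> a) = Dpow (i + j) \<otimes> a"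
  by (simp add: Dpow_add flip: m_assoc)

lemma Dpow_0 [simp]: "Dpow 0 = \<one>"
  by (simp add: Dpow_def)

lemma Dpow_1: "Dpow 1 = D"
  by (simp add: Dpow_def)

lemma inv_Dpow: "inv (Dpow k) = Dpow (- k)"
  by (simp add: Dpow_def int_pow_neg)

lemmas Dpow_simps = Dpow_add Dpow_add_left inv_Dpow m_assoc inv_mult_group

lemma len_one [simp]: "len \<one> = 0"
  using len_mult[of \<one> \<one>] by simp

lemma len_inv: "a \<in> carrier G \<Longrightarrow> len (inv a) = - len a"
  using len_mult[of a "inv a"] by simp

lemma len_nonneg: "a \<in> P \<Longrightarrow> 0 \<le> len a"
  using len_pos by fastforce

lemma len_D_pos: "0 < len D"
  by (simp add: D_P D_nontrivial len_pos)

lemma len_Dpow: "len (Dpow k) = k * len D"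
proof -
  have nat: "len (Dpow (int n)) = int n * len D" for n
  proof (induction n)
    case (Suc n)
    have "Dpow (int (Suc n)) = Dpow (int n) \<otimes> Dpow 1" by (simp add: Dpow_add add.commute)
    then have "Dpow (int (Suc n)) = Dpow (int n) \<otimes> D" by (simp only: Dpow_1)
    with Suc show ?case by (simp add: len_mult algebra_simps)
  qed simp
  show ?thesis
  proof (cases "0 \<le> k")
    case True
    then show ?thesis using nat[of "nat k"] by simp
  next
    case False
    have "len (Dpow k) = len (inv (Dpow (int (nat (- k)))))" using False by (simp add: inv_Dpow)
    also have "\<dots> = k * len D" using False nat[of "nat (- k)"] by (simp add: len_inv)
    finally show ?thesis .
  qed
qed

lemma pre_refl [simp]: "a \<in> carrier G \<Longrightarrow> a \<preceq> a"
  by (simp add: pre_def P_one)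

lemma pre_trans [trans]:
  "a \<preceq> b \<Longrightarrow> b \<preceq> c \<Longrightarrow> a \<in> carrier G \<Longrightarrow> b \<in> carrier G \<Longrightarrow> c \<in> carrier G \<Longrightarrow> a \<preceq> c"
  using P_mult[of "inv a \<otimes> b" "inv b \<otimes> c"] by (simp add: pre_def m_assoc)

lemma pre_len:
  assumes "a \<preceq> b" "a \<in> carrier G" "b \<in> carrier G"
  shows "len a \<le> len b" "len a = len b \<Longrightarrow> a = b"
proof -
  have l: "len (inv a \<otimes> b) = len b - len a" using assms by (simp add: len_mult len_inv)
  show "len a \<le> len b" using len_nonneg[of "inv a \<otimes> b"] assms l by (simp add: pre_def)
  show "a = b" if "len a = len b"
  proof -
    have "inv a \<otimes> b = \<one>" using len_pos[of "inv a \<otimes> b"] l that assms by (auto simp: pre_def)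
    then show ?thesis using assms by (metis inv_solve_left' one_closed r_one)
  qed
qed

lemma pre_antisym: "a \<preceq> b \<Longrightarrow> b \<preceq> a \<Longrightarrow> a \<in> carrier G \<Longrightarrow> b \<in> carrier G \<Longrightarrow> a = b"
  using pre_len by (meson order_antisym)

lemma P_iff_pre: "a \<in> carrier G \<Longrightarrow> a \<in> P \<longleftrightarrow> \<one> \<preceq> a"
  by (simp add: pre_def)

lemma pre_left_iff [simp]:
  "c \<in> carrier G \<Longrightarrow> a \<in> carrier G \<Longrightarrow> b \<in> carrier G \<Longrightarrow> c \<otimes> a \<preceq> c \<otimes> b \<longleftrightarrow> a \<preceq> b"
  by (simp add: pre_def m_assoc inv_mult_group)

lemma pre_mult_right: "a \<in> carrier G \<Longrightarrow> b \<in> P \<Longrightarrow> a \<preceq> a \<otimes> b"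
  by (simp add: pre_def P_carrier)

lemma D_conj_back: "a \<in> P \<Longrightarrow> D \<otimes> a \<otimes> inv D \<in> P"
proof -
  assume a: "a \<in> P"
  have c: "a \<in> carrier G" using a by (rule P_carrier)
  have "D \<otimes> a \<otimes> inv D = inv D \<otimes> (D \<otimes> D \<otimes> a) \<otimes> inv D" using c by (simp add: m_assoc)
  also have "\<dots> = inv D \<otimes> a \<otimes> D" unfolding D_square_central[OF c] using c by (simp add: m_assoc)
  finally show ?thesis using D_conj[OF a] by simp
qed

lemma Dpow_conj: "a \<in> P \<Longrightarrow> Dpow k \<otimes> a \<otimes> Dpow (- k) \<in> P"
proof -
  assume a: "a \<in> P"
  have c: "a \<in> carrier G" using a by (rule P_carrier)
  have fw: "Dpow (int n) \<otimes> a \<otimes> Dpow (- int n) \<in> P" for n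
  proof (induction n)
    case (Suc n)
    have "Dpow (int (Suc n)) \<otimes> a \<otimes> Dpow (- int (Suc n)) = Dpow 1 \<otimes> (Dpow (int n) \<otimes> a \<otimes> Dpow (- int n)) \<otimes> inv (Dpow 1)"
    proof -
      have "Dpow (- int (Suc n)) = Dpow (- int n) \<otimes> inv (Dpow 1)"
        unfolding inv_Dpow Dpow_add by (rule arg_cong[of _ _ Dpow]) simp
      moreover have "Dpow (int (Suc n)) = Dpow 1 \<otimes> Dpow (int n)" by (simp add: Dpow_simps)
      ultimately show ?thesis using c by (simp only: m_assoc m_closed inv_closed Dpow_carrier)
    qed
    then show ?case using D_conj_back[OF Suc] by (simp add: Dpow_1)
  qed (use a c in simp)
  have bw: "Dpow (- int n) \<otimes> a \<otimes> Dpow (int n) \<in> P" for n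
  proof (induction n)
    case (Suc n)
    have "Dpow (- int (Suc n)) \<otimes> a \<otimes> Dpow (int (Suc n)) = inv (Dpow 1) \<otimes> (Dpow (- int n) \<otimes> a \<otimes> Dpow (int n)) \<otimes> Dpow 1"
    proof -
      have "Dpow (- int (Suc n)) = inv (Dpow 1) \<otimes> Dpow (- int n)" by (simp add: Dpow_simps)
      moreover have "Dpow (int (Suc n)) = Dpow (int n) \<otimes> Dpow 1" by (simp add: Dpow_simps add.commute)
      ultimately show ?thesis using c by (simp only: m_assoc m_closed inv_closed Dpow_carrier)
    qed
    then show ?case using D_conj[OF Suc] by (simp add: Dpow_1)
  qed (use a c in simp)
  show ?thesis using fw[of "nat k"] bw[of "nat (- k)"] by (cases "0 \<le> k") simp_all
qed

text \<open>
  The prefix order is invariant under left multiplications by definition. It is invariant under right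
  multiplication by powers of \<open>D\<close> because these normalize \<open>P\<close>. Both are therefore automorphisms of the
  order and commute with meets, on which all later computations rest.
\<close>
lemma pre_Dpow_iff [simp]:
  assumes "a \<in> carrier G" "b \<in> carrier G"
  shows "a \<otimes> Dpow k \<preceq> b \<otimes> Dpow k \<longleftrightarrow> a \<preceq> b"
proof
  assume "a \<preceq> b"
  then show "a \<otimes> Dpow k \<preceq> b \<otimes> Dpow k"
    using Dpow_conj[of "inv a \<otimes> b" "- k"] assms by (simp add: pre_def Dpow_simps)
next
  assume "a \<otimes> Dpow k \<preceq> b \<otimes> Dpow k"
  then show "a \<preceq> b"
    using Dpow_conj[of "inv (a \<otimes> Dpow k) \<otimes> (b \<otimes> Dpow k)" k] assms by (simp add: pre_def Dpow_simps)
qed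

lemma pre_Dpow_move:
  assumes "a \<in> carrier G" "b \<in> carrier G"
  shows "a \<otimes> Dpow k \<preceq> b \<longleftrightarrow> a \<preceq> b \<otimes> Dpow (- k)"
  using pre_Dpow_iff[of a "b \<otimes> Dpow (- k)" k] assms by (simp add: Dpow_simps)

lemma Dpow_mono: "i \<le> j \<Longrightarrow> Dpow i \<preceq> Dpow j"
proof -
  assume "i \<le> j"
  have "Dpow (int n) \<in> P" for n
  proof (induction n)
    case (Suc n)
    have "Dpow (int (Suc n)) = Dpow (int n) \<otimes> Dpow 1" by (simp add: Dpow_add add.commute)
    then have "Dpow (int (Suc n)) = Dpow (int n) \<otimes> D" by (simp only: Dpow_1)
    with Suc show ?case by (simp add: P_mult D_P)
  qed (simp add: P_one)
  from this[of "nat (j - i)"] \<open>i \<le> j\<close> show ?thesis by (simp add: pre_def Dpow_simps)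
qed

lemma Dpow_pre_iff [simp]: "Dpow i \<preceq> Dpow j \<longleftrightarrow> i \<le> j"
proof
  assume "Dpow i \<preceq> Dpow j"
  then have "i * len D \<le> j * len D" using pre_len(1)[of "Dpow i" "Dpow j"] by (simp add: len_Dpow)
  then show "i \<le> j" using len_D_pos by simp
qed (rule Dpow_mono)

lemma Dpow_lower_bound: "a \<in> carrier G \<Longrightarrow> \<exists>k. Dpow k \<preceq> a"
proof -
  assume a: "a \<in> carrier G"
  obtain k :: nat where "D [^] k \<otimes> a \<in> P" using D_bound[OF a] by blast
  then have "Dpow (- int k) \<preceq> a" using a by (simp add: pre_def inv_Dpow) (simp add: Dpow_def int_pow_int)
  then show ?thesis ..
qed

lemma pre_inv:
  assumes "a \<in> carrier G"
  shows "Dpow (- k) \<preceq> inv a \<longleftrightarrow> a \<preceq> Dpow k"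
  using pre_Dpow_iff[of "Dpow (- k)" "inv a" k] assms pre_left_iff[of a \<one> "inv a \<otimes> Dpow k"]
  by (simp add: Dpow_simps)

lemma Dpow_upper_bound: "a \<in> carrier G \<Longrightarrow> \<exists>k. a \<preceq> Dpow k"
  using Dpow_lower_bound[of "inv a"] pre_inv[of a] by (metis inv_closed minus_minus)

lemma finite_interval: "finite {a \<in> carrier G. Dpow i \<preceq> a \<and> a \<preceq> Dpow j}"
proof -
  have "{a \<in> carrier G. Dpow i \<preceq> a \<and> a \<preceq> Dpow j} \<subseteq> (\<lambda>b. Dpow i \<otimes> b) ` {b \<in> P. len b \<le> (j - i) * len D}"
  proof
    fix a assume "a \<in> {a \<in> carrier G. Dpow i \<preceq> a \<and> a \<preceq> Dpow j}"
    then have a: "a \<in> carrier G" "Dpow i \<preceq> a" "a \<preceq> Dpow j" by auto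
    have "len (inv (Dpow i) \<otimes> a) \<le> (j - i) * len D"
      using pre_len(1)[OF a(3)] a by (simp add: len_mult len_inv len_Dpow algebra_simps)
    moreover have "a = Dpow i \<otimes> (inv (Dpow i) \<otimes> a)" using a by simp
    ultimately show "a \<in> (\<lambda>b. Dpow i \<otimes> b) ` {b \<in> P. len b \<le> (j - i) * len D}"
      using a(2) by (auto simp: pre_def)
  qed
  then show ?thesis using finite_P finite_surj by blast
qed

section \<open>Meets from least common multiples of atoms\<close>

definition is_lub :: "'a \<Rightarrow> 'a \<Rightarrow> 'a \<Rightarrow> bool" where
  "is_lub a b u \<longleftrightarrow> u \<in> carrier G \<and> a \<preceq> u \<and> b \<preceq> u \<and> (\<forall>d\<in>carrier G. a \<preceq> d \<and> b \<preceq> d \<longrightarrow> u \<preceq> d)"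

lemma is_lub_left:
  assumes "is_lub a b u" "a \<in> carrier G" "b \<in> carrier G" "z \<in> carrier G"
  shows "is_lub (z \<otimes> a) (z \<otimes> b) (z \<otimes> u)"
proof -
  have "z \<otimes> a \<preceq> d \<longleftrightarrow> a \<preceq> inv z \<otimes> d" if "a \<in> carrier G" "d \<in> carrier G" for a d
    using that assms(4) pre_left_iff[of z a "inv z \<otimes> d"] by simp
  then show ?thesis using assms by (auto simp: is_lub_def)
qed

context
  fixes A :: "'a set"
  assumes atom_P: "s \<in> A \<Longrightarrow> s \<in> P" and atom_ne: "s \<in> A \<Longrightarrow> s \<noteq> \<one>"
    and atom_below: "a \<in> P \<Longrightarrow> a \<noteq> \<one> \<Longrightarrow> \<exists>s\<in>A. s \<preceq> a"
    and atom_lub: "s \<in> A \<Longrightarrow> t \<in> A \<Longrightarrow> \<exists>m. is_lub s t m"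
begin

lemma atom_step:
  assumes "z \<in> carrier G" "a \<in> carrier G" "z \<preceq> a" "z \<noteq> a"
  shows "\<exists>s\<in>A. z \<otimes> s \<preceq> a"
proof -
  have "inv z \<otimes> a \<noteq> \<one>" using assms inv_solve_left'[of "\<one>" z a] by auto
  then obtain s where s: "s \<in> A" "s \<preceq> inv z \<otimes> a" using atom_below assms(3) by (auto simp: pre_def)
  then have "z \<otimes> s \<preceq> z \<otimes> (inv z \<otimes> a)" using assms atom_P P_carrier by (subst pre_left_iff) auto
  then show ?thesis using s assms by auto
qed

text \<open>
  Induction on the gap between a common lower bound \<open>z\<close> and a common upper bound \<open>c\<close> of \<open>a\<close> and \<open>b\<close>.
  Atoms \<open>s\<close> and \<open>t\<close> lead from \<open>z\<close> towards \<open>a\<close> and \<open>b\<close>. Let \<open>m\<close> be the join of \<open>z s\<close> and \<open>z t\<close>. The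
  lower bound \<open>z s\<close> gives the join \<open>u\<close> of \<open>a\<close> and \<open>m\<close>, the lower bound \<open>z t\<close> gives the join \<open>v\<close> of \<open>b\<close>
  and \<open>m\<close>, and the lower bound \<open>m\<close> gives the join of \<open>u\<close> and \<open>v\<close>.
\<close>
lemma bounded_lub_exists:
  "z \<in> carrier G \<Longrightarrow> a \<in> carrier G \<Longrightarrow> b \<in> carrier G \<Longrightarrow> c \<in> carrier G \<Longrightarrow>
    z \<preceq> a \<Longrightarrow> z \<preceq> b \<Longrightarrow> a \<preceq> c \<Longrightarrow> b \<preceq> c \<Longrightarrow> \<exists>u. is_lub a b u"
proof (induction "nat (len c - len z)" arbitrary: z a b rule: less_induct)
  case less
  note car = less.prems(1-4) and le = less.prems(5-8)
  show ?case
  proof (cases "a = z \<or> b = z")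
    case True
    then have "is_lub a b b \<or> is_lub a b a" using car le by (auto simp: is_lub_def)
    then show ?thesis by blast
  next
    case False
    obtain s t where s: "s \<in> A" "z \<otimes> s \<preceq> a" and t: "t \<in> A" "z \<otimes> t \<preceq> b"
      using atom_step[of z a] atom_step[of z b] car le False by auto
    have st: "s \<in> carrier G" "t \<in> carrier G" "0 < len s" "0 < len t"
      using s t atom_P atom_ne P_carrier len_pos by auto
    obtain m0 where "is_lub s t m0" using atom_lub s t by blast
    then have lub: "is_lub (z \<otimes> s) (z \<otimes> t) (z \<otimes> m0)" using st car by (intro is_lub_left)
    define m where "m = z \<otimes> m0"
    have m: "m \<in> carrier G" "z \<otimes> s \<preceq> m" "z \<otimes> t \<preceq> m"
      and m_least: "\<And>d. d \<in> carrier G \<Longrightarrow> z \<otimes> s \<preceq> d \<Longrightarrow> z \<otimes> t \<preceq> d \<Longrightarrow> m \<preceq> d"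
      using lub by (auto simp: m_def is_lub_def)
    have sc: "z \<otimes> s \<preceq> c" and tc: "z \<otimes> t \<preceq> c"
      using pre_trans[OF s(2) le(3)] pre_trans[OF t(2) le(4)] car st by auto
    then have mc: "m \<preceq> c" using m_least car by simp
    have shorter: "nat (len c - len w) < nat (len c - len z)" if "len z < len w" "w \<preceq> c" "w \<in> carrier G" for w
      using that pre_len(1)[of w c] car by simp
    have ls: "len z < len (z \<otimes> s)" "len z < len (z \<otimes> t)" "len z < len m"
      using car st pre_len(1)[OF m(2)] m by (simp_all add: len_mult)
    obtain u where u: "is_lub a m u"
      using less.hyps[OF shorter[OF ls(1) sc], of a m] car st m s le mc by auto
    obtain v where v: "is_lub b m v"
      using less.hyps[OF shorter[OF ls(2) tc], of b m] car st m t le mc by auto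
    have uv: "u \<in> carrier G" "v \<in> carrier G" "m \<preceq> u" "m \<preceq> v" "u \<preceq> c" "v \<preceq> c"
      using u v car le mc by (auto simp: is_lub_def)
    obtain w where w: "is_lub u v w"
      using less.hyps[OF shorter[OF ls(3) mc m(1)] m(1) uv(1,2) car(4) uv(3-6)] by blast
    have "is_lub a b w"
      unfolding is_lub_def
    proof (intro conjI ballI impI)
      show "w \<in> carrier G" using w by (simp add: is_lub_def)
      then show "a \<preceq> w" "b \<preceq> w"
        using u v w car uv pre_trans[of a u w] pre_trans[of b v w] by (auto simp: is_lub_def)
      fix d assume d: "d \<in> carrier G" "a \<preceq> d \<and> b \<preceq> d"
      have "m \<preceq> d"
        using m_least[OF d(1)] pre_trans[OF s(2), of d] pre_trans[OF t(2), of d] d car st by auto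
      then show "w \<preceq> d" using u v w d by (auto simp: is_lub_def)
    qed
    then show ?thesis by blast
  qed
qed

text \<open>
  Among the common prefixes of \<open>a\<close> and \<open>b\<close> above a fixed power of \<open>D\<close> take a longest one. Its join with
  any other common prefix is not longer, hence equal to it.
\<close>
theorem glb_exists_from_atoms:
  assumes a: "a \<in> carrier G" and b: "b \<in> carrier G"
  shows "\<exists>c\<in>carrier G. c \<preceq> a \<and> c \<preceq> b \<and> (\<forall>d\<in>carrier G. d \<preceq> a \<and> d \<preceq> b \<longrightarrow> d \<preceq> c)"
proof -
  have common: "\<exists>k. Dpow k \<preceq> x \<and> Dpow k \<preceq> y" if xy: "x \<in> carrier G" "y \<in> carrier G" for x y
  proof -
    obtain i where i: "Dpow i \<preceq> x" using Dpow_lower_bound[OF xy(1)] by blast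
    obtain j where j: "Dpow j \<preceq> y" using Dpow_lower_bound[OF xy(2)] by blast
    have "Dpow (min i j) \<preceq> x" using pre_trans[OF Dpow_mono i, of "min i j"] xy by simp
    moreover have "Dpow (min i j) \<preceq> y" using pre_trans[OF Dpow_mono j, of "min i j"] xy by simp
    ultimately show ?thesis by blast
  qed
  obtain k where k: "Dpow k \<preceq> a" "Dpow k \<preceq> b" using common[OF a b] by blast
  define L where "L = {d \<in> carrier G. Dpow k \<preceq> d \<and> d \<preceq> a \<and> d \<preceq> b}"
  have "len ` L \<subseteq> {len (Dpow k)..len a}"
    using a pre_len(1) by (auto simp: L_def)
  then have fin: "finite (len ` L)" by (rule finite_subset) simp
  have "Dpow k \<in> L" using k by (simp add: L_def)
  then have "Max (len ` L) \<in> len ` L" using fin by (intro Max_in) auto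
  then obtain c where c: "c \<in> L" "len c = Max (len ` L)" by auto
  have "d \<preceq> c" if d: "d \<in> carrier G" "d \<preceq> a" "d \<preceq> b" for d
  proof -
    have cc: "c \<in> carrier G" "Dpow k \<preceq> c" "c \<preceq> a" "c \<preceq> b" using c by (auto simp: L_def)
    obtain i where "Dpow i \<preceq> c" "Dpow i \<preceq> d" using common[OF cc(1) d(1)] by blast
    then obtain u where u: "is_lub c d u"
      using bounded_lub_exists[of "Dpow i" c d a] cc d a by auto
    then have uc: "u \<in> carrier G" "c \<preceq> u" "d \<preceq> u" "u \<preceq> a" "u \<preceq> b"
      using cc d a b by (auto simp: is_lub_def)
    then have "u \<in> L" using pre_trans[OF cc(2) uc(2)] cc by (simp add: L_def)
    then have "len u \<le> len c" using fin c by simp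
    then have "c = u" using pre_len[OF uc(2)] cc uc by simp
    then show ?thesis using uc by simp
  qed
  then show ?thesis using c by (auto simp: L_def)
qed

end

end

section \<open>The lattice of prefixes\<close>

locale garside_group = quasi_garside +
  assumes glb_exists: "a \<in> carrier G \<Longrightarrow> b \<in> carrier G \<Longrightarrow>
      \<exists>c\<in>carrier G. c \<preceq> a \<and> c \<preceq> b \<and> (\<forall>d\<in>carrier G. d \<preceq> a \<and> d \<preceq> b \<longrightarrow> d \<preceq> c)"
begin

definition prefix_gorder :: "'a gorder" where
  "prefix_gorder = \<lparr>carrier = carrier G, eq = (=), le = (\<lambda>a b. inv a \<otimes> b \<in> P)\<rparr>"

definition glb :: "'a \<Rightarrow> 'a \<Rightarrow> 'a" where
  "glb a b = a \<sqinter>\<^bsub>prefix_gorder\<^esub> b"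

lemma prefix_gorder_le: "a \<sqsubseteq>\<^bsub>prefix_gorder\<^esub> b \<longleftrightarrow> a \<preceq> b"
  by (simp add: prefix_gorder_def pre_def)

lemma prefix_lower_semilattice: "lower_semilattice prefix_gorder"
proof unfold_locales
  fix x y assume xy: "x \<in> carrier prefix_gorder" "y \<in> carrier prefix_gorder"
  then obtain c where c: "c \<in> carrier G" "c \<preceq> x" "c \<preceq> y"
    "\<And>d. d \<in> carrier G \<Longrightarrow> d \<preceq> x \<Longrightarrow> d \<preceq> y \<Longrightarrow> d \<preceq> c"
    using glb_exists[of x y] by (auto simp: prefix_gorder_def)
  then have "greatest prefix_gorder c (Lower prefix_gorder {x, y})"
    using xy unfolding greatest_def Lower_def prefix_gorder_le
    by (auto simp: prefix_gorder_def)
  then show "\<exists>s. greatest prefix_gorder s (Lower prefix_gorder {x, y})" ..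
qed (unfold prefix_gorder_le, auto simp: prefix_gorder_def intro: pre_trans pre_antisym)

lemma
  assumes "a \<in> carrier G" "b \<in> carrier G"
  shows glb_carrier [simp]: "glb a b \<in> carrier G"
    and pre_glb_iff: "c \<in> carrier G \<Longrightarrow> c \<preceq> glb a b \<longleftrightarrow> c \<preceq> a \<and> c \<preceq> b"
proof -
  interpret prefix: lower_semilattice prefix_gorder by (rule prefix_lower_semilattice)
  have car: "carrier prefix_gorder = carrier G" by (simp add: prefix_gorder_def)
  show cl: "glb a b \<in> carrier G"
    using assms prefix.meet_closed[of a b] by (simp add: glb_def car)
  have "glb a b \<preceq> a" "glb a b \<preceq> b"
    using assms prefix.meet_left[of a b] prefix.meet_right[of a b]
    by (simp_all add: glb_def prefix_gorder_le car)
  then show "c \<in> carrier G \<Longrightarrow> c \<preceq> glb a b \<longleftrightarrow> c \<preceq> a \<and> c \<preceq> b"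
    using assms cl prefix.meet_le[of c a b]
    by (auto simp: glb_def prefix_gorder_le car intro: pre_trans)
qed

lemma glb_pre [simp]:
  assumes "a \<in> carrier G" "b \<in> carrier G"
  shows "glb a b \<preceq> a" "glb a b \<preceq> b"
  using pre_glb_iff[of a b "glb a b"] assms by auto

lemma glb_eqI:
  assumes "a \<in> carrier G" "b \<in> carrier G" "c \<in> carrier G"
    and "c \<preceq> a" "c \<preceq> b" "\<And>d. d \<in> carrier G \<Longrightarrow> d \<preceq> a \<Longrightarrow> d \<preceq> b \<Longrightarrow> d \<preceq> c"
  shows "glb a b = c"
  using assms by (intro pre_antisym) (auto simp: pre_glb_iff)

lemma glb_commute: "a \<in> carrier G \<Longrightarrow> b \<in> carrier G \<Longrightarrow> glb a b = glb b a"
  by (intro glb_eqI) (auto simp: pre_glb_iff)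

lemma glb_assoc: "a \<in> carrier G \<Longrightarrow> b \<in> carrier G \<Longrightarrow> c \<in> carrier G \<Longrightarrow> glb (glb a b) c = glb a (glb b c)"
  by (intro glb_eqI) (auto simp: pre_glb_iff intro: pre_trans[OF glb_pre(1)] pre_trans[OF glb_pre(2)])

lemma glb_absorb: "a \<in> carrier G \<Longrightarrow> b \<in> carrier G \<Longrightarrow> a \<preceq> b \<Longrightarrow> glb a b = a"
  by (intro glb_eqI) auto

lemma glb_mono:
  "a \<preceq> a' \<Longrightarrow> b \<preceq> b' \<Longrightarrow> a \<in> carrier G \<Longrightarrow> b \<in> carrier G \<Longrightarrow> a' \<in> carrier G \<Longrightarrow> b' \<in> carrier G \<Longrightarrow> glb a b \<preceq> glb a' b'"
  by (auto simp: pre_glb_iff intro: pre_trans[OF glb_pre(1)] pre_trans[OF glb_pre(2)])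

lemma glb_left:
  assumes "a \<in> carrier G" "b \<in> carrier G" "c \<in> carrier G"
  shows "glb (c \<otimes> a) (c \<otimes> b) = c \<otimes> glb a b"
proof (rule glb_eqI)
  fix d assume d: "d \<in> carrier G" "d \<preceq> c \<otimes> a" "d \<preceq> c \<otimes> b"
  then show "d \<preceq> c \<otimes> glb a b"
    using pre_left_iff[of c "inv c \<otimes> d"] assms by (simp add: pre_glb_iff)
qed (use assms in auto)

lemma glb_Dpow:
  assumes "a \<in> carrier G" "b \<in> carrier G"
  shows "glb (a \<otimes> Dpow k) (b \<otimes> Dpow k) = glb a b \<otimes> Dpow k"
proof (rule glb_eqI)
  fix d assume d: "d \<in> carrier G" "d \<preceq> a \<otimes> Dpow k" "d \<preceq> b \<otimes> Dpow k"
  then show "d \<preceq> glb a b \<otimes> Dpow k"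
    using pre_Dpow_iff[of "d \<otimes> Dpow (- k)" _ k] assms by (simp add: pre_glb_iff Dpow_simps)
qed (use assms in auto)

lemma glb_P: "a \<in> P \<Longrightarrow> b \<in> P \<Longrightarrow> glb a b \<in> P"
  by (metis P_iff_pre P_carrier pre_glb_iff one_closed glb_carrier)

end

section \<open>Infimum, supremum and initial factor\<close>

context garside_group begin

lemma infimum_exists: "a \<in> carrier G \<Longrightarrow> \<exists>p. \<forall>q. Dpow q \<preceq> a \<longleftrightarrow> q \<le> p"
proof -
  assume a: "a \<in> carrier G"
  obtain i j where ij: "Dpow i \<preceq> a" "a \<preceq> Dpow j" using Dpow_lower_bound Dpow_upper_bound a by blast
  define p where "p = Max {q \<in> {i..j}. Dpow q \<preceq> a}"
  have le: "q \<le> j" if "Dpow q \<preceq> a" for q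
    using pre_trans[OF that ij(2)] a by simp
  have SSS: "finite {q \<in> {i..j}. Dpow q \<preceq> a}" "i \<in> {q \<in> {i..j}. Dpow q \<preceq> a}"
    using ij le[of i] by (auto intro: finite_subset[of _ "{i..j}"])
  have p: "Dpow p \<preceq> a" "i \<le> p" using Max_in[OF SSS(1)] SSS(2) by (auto simp: p_def)
  have "Dpow q \<preceq> a \<longleftrightarrow> q \<le> p" for q
  proof
    assume q: "Dpow q \<preceq> a"
    show "q \<le> p"
    proof (cases "i \<le> q")
      case True
      then show ?thesis unfolding p_def using SSS(1) q le by (intro Max_ge) auto
    next
      case False
      then show ?thesis using p(2) by simp
    qed
  next
    assume "q \<le> p"
    then show "Dpow q \<preceq> a" using pre_trans[OF _ p(1), of "Dpow q"] a by simp
  qed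
  then show ?thesis by blast
qed

definition infimum :: "'a \<Rightarrow> int" where
  "infimum a = (SOME p. \<forall>q. Dpow q \<preceq> a \<longleftrightarrow> q \<le> p)"

definition supremum :: "'a \<Rightarrow> int" where
  "supremum a = - infimum (inv a)"

text \<open>
  This is \<open>\<iota>(a) = D\<^sup>p a\<^sub>1 D\<^sup>-\<^sup>p\<close> for an element with normal form \<open>a = D\<^sup>p a\<^sub>1 \<dots> a\<^sub>l\<close> of positive length, and
  \<open>1\<close> for a power of \<open>D\<close>.
\<close>
definition initial :: "'a \<Rightarrow> 'a" where
  "initial a = glb (Dpow 1) (a \<otimes> Dpow (- infimum a))"

lemma Dpow_pre_infimum: "a \<in> carrier G \<Longrightarrow> Dpow q \<preceq> a \<longleftrightarrow> q \<le> infimum a"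
  unfolding infimum_def by (rule someI_ex[OF infimum_exists, THEN spec])

lemma pre_Dpow_supremum: "a \<in> carrier G \<Longrightarrow> a \<preceq> Dpow q \<longleftrightarrow> supremum a \<le> q"
  using Dpow_pre_infimum[of "inv a" "- q"] pre_inv[of a q] by (auto simp: supremum_def)

lemma supremum_inv: "a \<in> carrier G \<Longrightarrow> supremum (inv a) = - infimum a"
  by (simp add: supremum_def)

lemma infimum_inv: "infimum (inv a) = - supremum a"
  by (simp add: supremum_def)

lemma one_pre_iff: "a \<in> carrier G \<Longrightarrow> \<one> \<preceq> a \<otimes> Dpow (- q) \<longleftrightarrow> Dpow q \<preceq> a"
  using pre_Dpow_move[of \<one> a q] by simp

lemma Dpow1_pre_iff: "a \<in> carrier G \<Longrightarrow> Dpow 1 \<preceq> a \<otimes> Dpow (- q) \<longleftrightarrow> Dpow (q + 1) \<preceq> a"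
  using pre_Dpow_move[of "Dpow 1" a q] by (simp add: Dpow_add add.commute)

lemma infimum_eqI:
  assumes "a \<in> carrier G" "\<one> \<preceq> a \<otimes> Dpow (- p)" "\<not> Dpow 1 \<preceq> a \<otimes> Dpow (- p)"
  shows "infimum a = p"
  using assms unfolding one_pre_iff[OF assms(1)] Dpow1_pre_iff[OF assms(1)] by (simp add: Dpow_pre_infimum)

lemma initial_carrier [simp]: "a \<in> carrier G \<Longrightarrow> initial a \<in> carrier G"
  by (simp add: initial_def)

lemma initial_P: "a \<in> carrier G \<Longrightarrow> initial a \<in> P"
  by (simp add: P_iff_pre initial_def pre_glb_iff one_pre_iff Dpow_pre_infimum)
     (metis Dpow_0 Dpow_pre_iff zero_le_one)

lemma one_pre_initial: "a \<in> carrier G \<Longrightarrow> \<one> \<preceq> initial a"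
  using initial_P P_iff_pre by simp

lemma initial_pre_D: "a \<in> carrier G \<Longrightarrow> initial a \<preceq> Dpow 1"
  by (simp add: initial_def)

lemma initial_pre: "a \<in> carrier G \<Longrightarrow> initial a \<preceq> a \<otimes> Dpow (- infimum a)"
  by (simp add: initial_def)

lemma initial_inv: "initial (inv a) = glb (Dpow 1) (inv a \<otimes> Dpow (supremum a))"
  by (simp add: initial_def infimum_inv)

lemma initial_ne_D: "a \<in> carrier G \<Longrightarrow> initial a \<noteq> Dpow 1"
  using initial_pre[of a] Dpow1_pre_iff[of a "infimum a"] Dpow_pre_infimum[of a] by auto

text \<open>
  A simple prefix of \<open>u v\<close> only sees the maximal simple prefix of \<open>v\<close>, because \<open>D\<close> is itself a prefix
  of \<open>u D\<close>.
\<close>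
lemma glb_D_mult:
  assumes u: "u \<in> P" and v: "v \<in> carrier G"
  shows "glb (Dpow 1) (u \<otimes> v) = glb (Dpow 1) (u \<otimes> glb (Dpow 1) v)"
proof -
  have c: "u \<in> carrier G" using u by (rule P_carrier)
  have "\<one> \<otimes> Dpow 1 \<preceq> u \<otimes> Dpow 1" using u c by (subst pre_Dpow_iff) (auto simp: P_iff_pre)
  then have "Dpow 1 \<preceq> u \<otimes> Dpow 1" by simp
  then have "glb (Dpow 1) (u \<otimes> v) = glb (glb (Dpow 1) (u \<otimes> Dpow 1)) (u \<otimes> v)"
    using c by (simp add: glb_absorb)
  also have "\<dots> = glb (Dpow 1) (u \<otimes> glb (Dpow 1) v)"
    using c v by (simp add: glb_assoc glb_left)
  finally show ?thesis .
qed

text \<open>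
  An \<open>a\<close> below \<open>D\<^sup>k\<^sup>+\<^sup>1\<close> is also below \<open>a D\<^sup>k\<close>, so if it has no common prefix with \<open>D\<close> it is below
  \<open>D\<^sup>k\<close>; descend to \<open>k = 0\<close>.
\<close>
lemma glb_D_nontrivial:
  assumes a: "a \<in> P" and g: "glb (Dpow 1) a = \<one>"
  shows "a = \<one>"
proof -
  have c: "a \<in> carrier G" using a by (rule P_carrier)
  have bound: "a \<preceq> Dpow (int k) \<Longrightarrow> a \<preceq> \<one>" for k
  proof (induction k)
    case (Suc k)
    have "a \<otimes> Dpow 0 \<preceq> a \<otimes> Dpow (int k)"
      using c by (subst pre_left_iff) (simp_all only: Dpow_pre_iff Dpow_carrier of_nat_0_le_iff)
    moreover have "a \<preceq> Dpow 1 \<otimes> Dpow (int k)" using Suc.prems by (simp add: Dpow_add)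
    ultimately have "a \<preceq> glb (Dpow 1 \<otimes> Dpow (int k)) (a \<otimes> Dpow (int k))"
      using c by (simp add: pre_glb_iff)
    then have "a \<preceq> Dpow (int k)" using c g by (simp add: glb_Dpow)
    then show ?case by (rule Suc.IH)
  qed simp
  obtain j where "a \<preceq> Dpow j" using Dpow_upper_bound c by blast
  then have "a \<preceq> Dpow (int (nat j))" using c pre_trans[of a "Dpow j" "Dpow (int (nat j))"] by simp
  then have "a \<preceq> \<one>" by (rule bound)
  then show ?thesis using a c by (intro pre_antisym) (auto simp: P_iff_pre)
qed

section \<open>Left normal forms\<close>

definition simple :: "'a \<Rightarrow> bool" where
  "simple s \<longleftrightarrow> s \<in> carrier G \<and> \<one> \<preceq> s \<and> s \<preceq> Dpow 1"

definition weighted :: "'a \<Rightarrow> 'a \<Rightarrow> bool" where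
  "weighted s t \<longleftrightarrow> simple s \<and> simple t \<and> glb (inv s \<otimes> Dpow 1) t = \<one>"

definition product :: "'a list \<Rightarrow> 'a" where
  "product xs = foldr (\<otimes>) xs \<one>"

definition normal_form :: "'a \<Rightarrow> int \<Rightarrow> 'a list \<Rightarrow> bool" where
  "normal_form x p xs \<longleftrightarrow> x = Dpow p \<otimes> product xs \<and> set xs \<subseteq> {s. simple s} - {\<one>, Dpow 1} \<and> successively weighted xs"

lemma simpleD: "simple s \<Longrightarrow> s \<in> carrier G" "simple s \<Longrightarrow> s \<in> P" "simple s \<Longrightarrow> s \<preceq> Dpow 1"
  by (auto simp: simple_def P_iff_pre)

lemma complement_P: "simple s \<Longrightarrow> inv s \<otimes> Dpow 1 \<in> P"
  by (simp add: simple_def pre_def)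

lemma complement_pre_D: "simple s \<Longrightarrow> inv s \<otimes> Dpow 1 \<preceq> Dpow 1"
  using pre_Dpow_iff[of "inv s" \<one> 1] pre_left_iff[of s "inv s" \<one>] by (simp add: simple_def)

lemma product_simps [simp]: "product [] = \<one>" "product (x # xs) = x \<otimes> product xs"
  by (simp_all add: product_def)

lemma product_P: "set xs \<subseteq> P \<Longrightarrow> product xs \<in> P"
  by (induction xs) (auto simp: P_one P_mult)

lemma product_carrier: "set xs \<subseteq> carrier G \<Longrightarrow> product xs \<in> carrier G"
  by (induction xs) auto

lemma product_append: "set xs \<subseteq> carrier G \<Longrightarrow> set ys \<subseteq> carrier G \<Longrightarrow> product (xs @ ys) = product xs \<otimes> product ys"
  by (induction xs) (auto simp: product_carrier m_assoc)

lemma normal_form_head: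
  "set (y # ys) \<subseteq> {s. simple s} \<Longrightarrow> successively weighted (y # ys) \<Longrightarrow> glb (Dpow 1) (product (y # ys)) = y"
proof (induction ys arbitrary: y)
  case Nil
  then show ?case by (simp add: glb_absorb glb_commute[of "Dpow 1"] simpleD)
next
  case (Cons z zs)
  have y: "simple y" and z: "simple z" using Cons.prems by auto
  have v: "product (z # zs) \<in> carrier G" using Cons.prems by (intro product_carrier) (auto simp: simpleD)
  have "glb (Dpow 1) (y \<otimes> product (z # zs)) = glb (y \<otimes> (inv y \<otimes> Dpow 1)) (y \<otimes> z)"
    using glb_D_mult[of y "product (z # zs)"] v Cons simpleD[OF y] by simp
  also have "\<dots> = y"
    using Cons.prems simpleD[OF y] simpleD[OF z] by (simp add: glb_left weighted_def del: cancel_left)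
  finally show ?case by simp
qed

text \<open>
  The counterpart of \<open>normal_form_head\<close> for the inverse, whose normal form begins with the complement of
  the last factor.
\<close>
lemma normal_form_last:
  "ys \<noteq> [] \<Longrightarrow> set ys \<subseteq> {s. simple s} \<Longrightarrow> successively weighted ys \<Longrightarrow>
    glb (Dpow 1) (inv (product ys) \<otimes> Dpow (int (length ys))) = inv (last ys) \<otimes> Dpow 1"
proof (induction ys rule: rev_induct)
  case (snoc y ys)
  have y: "simple y" using snoc.prems by auto
  note yc = simpleD[OF y]
  show ?case
  proof (cases "ys = []")
    case True
    then show ?thesis
      using yc complement_pre_D[OF y] by (simp add: glb_absorb glb_commute[of "Dpow 1"])
  next
    case False
    define z w where "z = last ys" and "w = inv (product ys) \<otimes> Dpow (int (length ys))"
    have z: "simple z" using snoc.prems(2) last_in_set[OF False] unfolding z_def by auto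
    note zc = simpleD[OF z]
    have uc: "set ys \<subseteq> carrier G" using snoc.prems by (auto simp: simpleD)
    have u: "product ys \<in> carrier G" using uc by (rule product_carrier)
    have w: "w \<in> carrier G" using u by (simp add: w_def)
    have weighted: "weighted z y" "successively weighted ys"
      using snoc.prems False by (auto simp: successively_append_iff z_def)
    have IH: "glb (Dpow 1) w = inv z \<otimes> Dpow 1"
      using snoc.IH snoc.prems False weighted by (simp add: w_def z_def)
    have "inv (product (ys @ [y])) \<otimes> Dpow (int (length (ys @ [y]))) = inv y \<otimes> w \<otimes> Dpow 1"
      using u uc yc by (simp add: product_append w_def Dpow_simps add.commute)
    moreover have "glb (Dpow 1) (inv y \<otimes> w \<otimes> Dpow 1) = inv y \<otimes> Dpow 1"
    proof -
      have e: "inv y \<otimes> w \<otimes> Dpow 1 = (inv y \<otimes> Dpow 1) \<otimes> (Dpow (- 1) \<otimes> w \<otimes> Dpow 1)"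
        using yc w by (simp add: Dpow_simps)
      have t: "glb (Dpow 1) (Dpow (- 1) \<otimes> w \<otimes> Dpow 1) = Dpow (- 1) \<otimes> (inv z \<otimes> Dpow 1) \<otimes> Dpow 1"
      proof -
        have "glb (Dpow 1) (Dpow (- 1) \<otimes> w \<otimes> Dpow 1) = glb (Dpow (- 1) \<otimes> Dpow 1 \<otimes> Dpow 1) (Dpow (- 1) \<otimes> w \<otimes> Dpow 1)"
          by (simp add: Dpow_add)
        also have "\<dots> = Dpow (- 1) \<otimes> glb (Dpow 1) w \<otimes> Dpow 1"
          using w by (subst glb_Dpow) (simp_all add: glb_left)
        finally show ?thesis by (simp add: IH)
      qed
      have "glb (Dpow 1) (inv y \<otimes> w \<otimes> Dpow 1) = glb (Dpow 1) (inv y \<otimes> Dpow 1 \<otimes> (Dpow (- 1) \<otimes> (inv z \<otimes> Dpow 1) \<otimes> Dpow 1))"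
        unfolding e using glb_D_mult[OF complement_P[OF y], of "Dpow (- 1) \<otimes> w \<otimes> Dpow 1"] w t by simp
      also have "\<dots> = glb (inv y \<otimes> y \<otimes> Dpow 1) (inv y \<otimes> (inv z \<otimes> Dpow 1) \<otimes> Dpow 1)"
        using yc zc by (simp add: Dpow_simps)
      also have "\<dots> = inv y \<otimes> glb y (inv z \<otimes> Dpow 1) \<otimes> Dpow 1"
        using yc zc by (subst glb_Dpow) (simp_all only: glb_left m_closed inv_closed Dpow_carrier)
      also have "glb y (inv z \<otimes> Dpow 1) = \<one>"
        using weighted(1) yc zc by (subst glb_commute) (simp_all add: weighted_def)
      finally show ?thesis using yc by simp
    qed
    ultimately show ?thesis by simp
  qed
qed simp

lemma normal_form_carrier: "normal_form x p xs \<Longrightarrow> set xs \<subseteq> P \<and> product xs \<in> P \<and> x \<in> carrier G"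
proof -
  assume normal_form: "normal_form x p xs"
  then have s: "set xs \<subseteq> P" by (auto simp: normal_form_def simpleD)
  then have "product xs \<in> P" by (rule product_P)
  then show ?thesis using s normal_form by (auto simp: normal_form_def P_carrier)
qed

lemma normal_form_infimum:
  assumes "normal_form x p xs"
  shows "infimum x = p"
proof -
  have c: "product xs \<in> P" "product xs \<in> carrier G" "x \<in> carrier G"
    using normal_form_carrier[OF assms] P_carrier by auto
  have x: "x = Dpow p \<otimes> product xs" using assms by (simp add: normal_form_def)
  have "Dpow p \<preceq> x" unfolding x using c by (simp add: pre_mult_right)
  moreover have "\<not> Dpow (p + 1) \<preceq> x"
  proof
    assume "Dpow (p + 1) \<preceq> x"
    then have "Dpow p \<otimes> Dpow 1 \<preceq> Dpow p \<otimes> product xs" unfolding x by (simp add: Dpow_add)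
    then have D: "Dpow 1 \<preceq> product xs" using c by simp
    show False
    proof (cases xs)
      case Nil
      then show ?thesis using D Dpow_pre_iff[of 1 0] by simp
    next
      case (Cons y ys)
      have "glb (Dpow 1) (product xs) = y" using assms normal_form_head[of y ys] Cons by (auto simp: normal_form_def)
      moreover have "glb (Dpow 1) (product xs) = Dpow 1" using D c by (simp add: glb_absorb)
      ultimately show ?thesis using assms Cons by (auto simp: normal_form_def)
    qed
  qed
  ultimately show ?thesis using c by (simp add: Dpow_pre_infimum)
qed

lemma normal_form_supremum:
  assumes "normal_form x p xs"
  shows "supremum x = p + int (length xs)"
proof -
  have c: "product xs \<in> P" "product xs \<in> carrier G" "x \<in> carrier G" "set xs \<subseteq> {s. simple s}" "successively weighted xs"
    using normal_form_carrier[OF assms] P_carrier assms by (auto simp: normal_form_def)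
  have x: "x = Dpow p \<otimes> product xs" using assms by (simp add: normal_form_def)
  have e: "inv x \<otimes> Dpow (p + int (length xs)) = inv (product xs) \<otimes> Dpow (int (length xs))"
    unfolding x using c by (simp add: Dpow_simps)
  have "\<one> \<preceq> inv (product xs) \<otimes> Dpow (int (length xs)) \<and> \<not> Dpow 1 \<preceq> inv (product xs) \<otimes> Dpow (int (length xs))"
  proof (cases "xs = []")
    case True
    then show ?thesis using Dpow_pre_iff[of 1 0] by simp
  next
    case False
    have l: "simple (last xs)" "last xs \<noteq> \<one>" using assms last_in_set[OF False] by (auto simp: normal_form_def)
    have g: "glb (Dpow 1) (inv (product xs) \<otimes> Dpow (int (length xs))) = inv (last xs) \<otimes> Dpow 1"
      using normal_form_last False c by simp
    have "inv (last xs) \<otimes> Dpow 1 \<preceq> inv (product xs) \<otimes> Dpow (int (length xs))"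
      using c glb_pre(2)[of "Dpow 1" "inv (product xs) \<otimes> Dpow (int (length xs))"] by (simp add: g)
    moreover have "\<one> \<preceq> inv (last xs) \<otimes> Dpow 1" using complement_P[OF l(1)] l simpleD by (simp add: P_iff_pre)
    moreover have "inv (last xs) \<otimes> Dpow 1 \<noteq> Dpow 1"
      using l simpleD(1)[OF l(1)] by (simp add: inv_eq_1_iff)
    ultimately show ?thesis
      using c simpleD[OF l(1)] g pre_trans[of \<one> "inv (last xs) \<otimes> Dpow 1"] by (auto simp: glb_absorb)
  qed
  then have "infimum (inv x) = - (p + int (length xs))"
    using c by (intro infimum_eqI) (simp_all only: e minus_minus inv_closed not_False_eq_True)
  then show ?thesis by (simp add: supremum_def)
qed

lemma normal_form_initial:
  assumes "normal_form x p (y # ys)"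
  shows "initial x = Dpow p \<otimes> y \<otimes> Dpow (- p)"
proof -
  have c: "product (y # ys) \<in> carrier G" "y \<in> carrier G"
    using normal_form_carrier[OF assms] P_carrier by auto
  have "initial x = glb (Dpow p \<otimes> Dpow 1 \<otimes> Dpow (- p)) (Dpow p \<otimes> product (y # ys) \<otimes> Dpow (- p))"
    using assms normal_form_infimum[OF assms] by (simp add: initial_def Dpow_add normal_form_def)
  also have "\<dots> = Dpow p \<otimes> glb (Dpow 1) (product (y # ys)) \<otimes> Dpow (- p)"
    using c by (subst glb_Dpow) (simp_all only: glb_left m_closed Dpow_carrier)
  also have "glb (Dpow 1) (product (y # ys)) = y"
    using assms by (intro normal_form_head) (auto simp: normal_form_def)
  finally show ?thesis .
qed

lemma normal_form_initial_inv:
  assumes "normal_form x p ys" "ys \<noteq> []"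
  shows "initial (inv x) = inv (last ys) \<otimes> Dpow 1"
proof -
  have c: "product ys \<in> carrier G" using normal_form_carrier[OF assms(1)] P_carrier by auto
  have "inv x \<otimes> Dpow (supremum x) = inv (product ys) \<otimes> Dpow (int (length ys))"
    using assms(1) c normal_form_supremum[OF assms(1)] by (simp add: normal_form_def Dpow_simps)
  then show ?thesis using normal_form_last[of ys] assms by (auto simp: initial_inv normal_form_def)
qed

lemma normal_form_unique_list:
  "set xs \<subseteq> {s. simple s} \<Longrightarrow> set ys \<subseteq> {s. simple s} \<Longrightarrow> successively weighted xs \<Longrightarrow> successively weighted ys \<Longrightarrow>
    length xs = length ys \<Longrightarrow> product xs = product ys \<Longrightarrow> xs = ys"
proof (induction xs arbitrary: ys)
  case (Cons x xs)
  then obtain y zs where ys: "ys = y # zs" by (cases ys) auto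
  have xy: "x = y" using normal_form_head[of x xs] normal_form_head[of y zs] Cons.prems ys by simp
  have c: "product xs \<in> carrier G" "product zs \<in> carrier G" "y \<in> carrier G"
    using Cons.prems ys by (auto intro!: product_carrier simp: simpleD)
  have "product xs = product zs" using Cons.prems(6) xy ys c by simp
  moreover have "successively weighted xs" "successively weighted zs"
    using Cons.prems(3,4) ys by (auto simp: successively_Cons)
  ultimately show ?case using Cons.IH[of zs] Cons.prems ys xy by auto
qed simp

lemma normal_form_unique:
  assumes "normal_form x p xs" "normal_form x q ys"
  shows "p = q \<and> xs = ys"
proof -
  have pq: "p = q" using normal_form_infimum[OF assms(1)] normal_form_infimum[OF assms(2)] by simp
  have "length xs = length ys" using normal_form_supremum[OF assms(1)] normal_form_supremum[OF assms(2)] pq by simp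
  moreover have "product xs = product ys"
    using assms pq normal_form_carrier[OF assms(1)] normal_form_carrier[OF assms(2)] by (auto simp: normal_form_def P_carrier)
  ultimately show ?thesis using normal_form_unique_list[of xs ys] assms pq by (auto simp: normal_form_def)
qed

text \<open>
  Split off the maximal simple prefix \<open>h\<close> and continue with the rest. The next factor is left-weighted
  with respect to \<open>h\<close> because a common prefix with the complement of \<open>h\<close> would enlarge \<open>h\<close>.
\<close>
lemma greedy_exists:
  "a \<in> P \<Longrightarrow> \<exists>ys. a = product ys \<and> set ys \<subseteq> {s. simple s} - {\<one>} \<and> successively weighted ys"
proof (induction "nat (len a)" arbitrary: a rule: less_induct)
  case less
  have c: "a \<in> carrier G" using less.prems by (rule P_carrier)
  show ?case
  proof (cases "a = \<one>")
    case True
    then show ?thesis by (intro exI[of _ "[]"]) simp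
  next
    case False
    define h where "h = glb (Dpow 1) a"
    define b where "b = inv h \<otimes> a"
    have h: "h \<noteq> \<one>" "h \<in> carrier G" "\<one> \<preceq> h" "h \<preceq> Dpow 1" "h \<preceq> a"
      using less.prems glb_D_nontrivial False c Dpow_pre_iff[of 0 1]
      by (auto simp: h_def pre_glb_iff P_iff_pre simp del: Dpow_pre_iff)
    have hs: "simple h" using h by (simp add: simple_def)
    have b: "b \<in> P" "b \<in> carrier G" "a = h \<otimes> b" using h c by (auto simp: b_def pre_def)
    have "0 < len h" using h by (intro len_pos) (auto simp: P_iff_pre)
    then have "len b < len a" using b h by (simp add: len_mult)
    then obtain ys where ys: "b = product ys" "set ys \<subseteq> {s. simple s} - {\<one>}" "successively weighted ys"
      using less.hyps[of b] b len_pos[OF less.prems False] by auto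
    have "weighted h (hd ys)" if ne: "ys \<noteq> []"
    proof -
      have "hd ys = glb (Dpow 1) b"
        using normal_form_head[of "hd ys" "tl ys"] ne ys by (simp add: subset_iff)
      then have "glb (inv h \<otimes> Dpow 1) (hd ys) \<preceq> glb (inv h \<otimes> Dpow 1) b"
        using h b by (intro glb_mono) auto
      also have "b = inv h \<otimes> a" by (simp add: b_def)
      also have "glb (inv h \<otimes> Dpow 1) (inv h \<otimes> a) = \<one>"
        using h c by (simp add: glb_left flip: h_def)
      finally have "glb (inv h \<otimes> Dpow 1) (hd ys) \<preceq> \<one>" using h b \<open>hd ys = _\<close> by simp
      moreover have s: "simple (hd ys)" using ne ys hd_in_set[OF ne] by blast
      moreover have "glb (inv h \<otimes> Dpow 1) (hd ys) \<in> P"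
        using complement_P[OF hs] simpleD[OF s] by (intro glb_P)
      ultimately show ?thesis
        using hs h simpleD[OF s] unfolding weighted_def by (auto intro!: pre_antisym simp: P_iff_pre)
    qed
    then have "successively weighted (h # ys)" using ys by (auto simp: successively_Cons)
    then show ?thesis using ys b h hs by (intro exI[of _ "h # ys"]) auto
  qed
qed

lemma weighted_D: "weighted s (Dpow 1) \<Longrightarrow> s = Dpow 1"
proof -
  assume a: "weighted s (Dpow 1)"
  then have s: "simple s" by (simp add: weighted_def)
  have "inv s \<otimes> Dpow 1 = \<one>"
    using a complement_pre_D[OF s] simpleD[OF s] by (simp add: weighted_def glb_absorb)
  then show ?thesis using simpleD(1)[OF s] inv_solve_left'[of "\<one>" s "Dpow 1"] by simp
qed

text \<open>
  A factor \<open>D\<close> moves to the front of a left-weighted sequence. So in a sequence whose product does not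
  have \<open>D\<close> as a prefix there is none.
\<close>
lemma successively_weighted_D: "successively weighted ys \<Longrightarrow> Dpow 1 \<in> set ys \<Longrightarrow> hd ys = Dpow 1"
proof (induction ys)
  case (Cons y ys)
  show ?case
  proof (cases "Dpow 1 \<in> set ys")
    case True
    then have "hd ys = Dpow 1" using Cons by (auto simp: successively_Cons)
    then have "weighted y (Dpow 1)" using Cons.prems True by (cases ys) auto
    then show ?thesis using weighted_D by simp
  qed (use Cons.prems in auto)
qed simp

lemma normal_form_exists:
  assumes x: "x \<in> carrier G"
  shows "\<exists>p xs. normal_form x p xs"
proof -
  define a where "a = Dpow (- infimum x) \<otimes> x"
  have ax: "x = Dpow (infimum x) \<otimes> a" "a \<in> carrier G" using x by (simp_all add: a_def Dpow_add_left)
  have aP: "a \<in> P" using x Dpow_pre_infimum[of x "infimum x"] by (simp add: a_def pre_def inv_Dpow)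
  obtain ys where ys: "a = product ys" "set ys \<subseteq> {s. simple s} - {\<one>}" "successively weighted ys"
    using greedy_exists[OF aP] by blast
  have "Dpow 1 \<notin> set ys"
  proof
    assume D: "Dpow 1 \<in> set ys"
    then have "hd ys = Dpow 1" using ys successively_weighted_D by blast
    moreover have "glb (Dpow 1) a = hd ys"
      using normal_form_head[of "hd ys" "tl ys"] D ys by (cases ys) auto
    ultimately have "Dpow 1 \<preceq> a" using glb_pre(2)[of "Dpow 1" a] ax(2) by simp
    then have "Dpow (infimum x) \<otimes> Dpow 1 \<preceq> x" using ax by (metis Dpow_carrier pre_left_iff)
    then show False using x by (simp add: Dpow_add Dpow_pre_infimum)
  qed
  then show ?thesis using ys ax(1) unfolding normal_form_def by blast
qed

end

section \<open>Conjugation and rigid elements\<close>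

context garside_group begin

definition conj_by :: "'a \<Rightarrow> 'a \<Rightarrow> 'a" where
  "conj_by x a = inv a \<otimes> x \<otimes> a"

lemma conj_by_carrier [simp]: "x \<in> carrier G \<Longrightarrow> a \<in> carrier G \<Longrightarrow> conj_by x a \<in> carrier G"
  by (simp add: conj_by_def)

lemma conj_by_mult: "x \<in> carrier G \<Longrightarrow> a \<in> carrier G \<Longrightarrow> b \<in> carrier G \<Longrightarrow> conj_by x (a \<otimes> b) = conj_by (conj_by x a) b"
  by (simp add: conj_by_def m_assoc inv_mult_group)

lemma conj_by_one [simp]: "x \<in> carrier G \<Longrightarrow> conj_by x \<one> = x"
  by (simp add: conj_by_def)

lemma conj_by_inv: "x \<in> carrier G \<Longrightarrow> a \<in> carrier G \<Longrightarrow> inv (conj_by x a) = conj_by (inv x) a"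
  by (simp add: conj_by_def m_assoc inv_mult_group)

lemma mult_conj_by: "x \<in> carrier G \<Longrightarrow> a \<in> carrier G \<Longrightarrow> a \<otimes> conj_by x a = x \<otimes> a"
  by (simp add: conj_by_def m_assoc)

lemma conj_by_eq_iff: "x \<in> carrier G \<Longrightarrow> y \<in> carrier G \<Longrightarrow> a \<in> carrier G \<Longrightarrow> conj_by x a = y \<longleftrightarrow> x \<otimes> a = a \<otimes> y"
  by (auto simp: mult_conj_by) (simp add: conj_by_def m_assoc)

lemma infimum_conj_by_iff:
  assumes "x \<in> carrier G" "a \<in> carrier G"
  shows "q \<le> infimum (conj_by x a) \<longleftrightarrow> a \<otimes> Dpow q \<preceq> x \<otimes> a"
  using pre_left_iff[of a "Dpow q" "conj_by x a"] assms by (simp add: mult_conj_by Dpow_pre_infimum)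

lemma supremum_conj_by_iff:
  assumes "x \<in> carrier G" "a \<in> carrier G"
  shows "supremum (conj_by x a) \<le> q \<longleftrightarrow> x \<otimes> a \<preceq> a \<otimes> Dpow q"
  using pre_left_iff[of a "conj_by x a" "Dpow q"] assms by (simp add: mult_conj_by pre_Dpow_supremum)

text \<open>
  The assumption on \<open>t\<close> is a left-weightedness for \<open>y\<close> as a whole: multiplied by \<open>y\<close> it says that \<open>y\<close> is
  the meet of \<open>y t\<close> with \<open>D\<^sup>s\<close>, where \<open>s\<close> is the supremum of \<open>y\<close>. As \<open>y\<close> has positive length, the meet of
  \<open>D\<close> with \<open>y t D\<^sup>-\<^sup>p\<close>, where \<open>p\<close> is the infimum of \<open>y\<close>, only depends on that meet.
\<close>
lemma initial_extend:
  assumes y: "y \<in> carrier G" and t: "t \<in> carrier G" and l: "infimum y < supremum y"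
    and w: "glb t (inv y \<otimes> Dpow (supremum y)) = \<one>"
  shows "glb (Dpow 1) (y \<otimes> t \<otimes> Dpow (- infimum y)) = initial y"
proof -
  have "glb (y \<otimes> t) (y \<otimes> (inv y \<otimes> Dpow (supremum y))) = y \<otimes> glb t (inv y \<otimes> Dpow (supremum y))"
    using y t by (intro glb_left) auto
  then have "glb (y \<otimes> t) (Dpow (supremum y)) = y" using y t w by simp
  then have e: "glb (y \<otimes> t \<otimes> Dpow (- infimum y)) (Dpow (supremum y) \<otimes> Dpow (- infimum y)) = y \<otimes> Dpow (- infimum y)"
    using y t by (subst glb_Dpow) auto
  have "glb (Dpow 1) (y \<otimes> t \<otimes> Dpow (- infimum y)) = glb (glb (Dpow 1) (Dpow (supremum y) \<otimes> Dpow (- infimum y))) (y \<otimes> t \<otimes> Dpow (- infimum y))"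
    using l by (simp add: Dpow_add glb_absorb)
  also have "\<dots> = glb (Dpow 1) (glb (y \<otimes> t \<otimes> Dpow (- infimum y)) (Dpow (supremum y) \<otimes> Dpow (- infimum y)))"
    using y t by (simp only: glb_assoc glb_commute[of "Dpow (supremum y) \<otimes> Dpow (- infimum y)"] m_closed Dpow_carrier)
  finally show ?thesis by (simp add: e initial_def)
qed

lemma glb_initial_inv:
  assumes "y \<in> carrier G" "t \<in> carrier G" "t \<preceq> Dpow 1"
  shows "glb t (inv y \<otimes> Dpow (supremum y)) = glb t (initial (inv y))"
proof -
  have "glb t (initial (inv y)) = glb (glb t (Dpow 1)) (inv y \<otimes> Dpow (supremum y))"
    using assms by (simp add: initial_inv glb_assoc)
  then show ?thesis using assms by (simp add: glb_absorb)
qed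

text \<open>
  Rigidity in the form \<open>\<iota>(y) \<and> \<iota>(y\<^sup>-\<^sup>1) = 1\<close>, which is visibly invariant under inversion.
\<close>
definition rigid_el :: "'a \<Rightarrow> bool" where
  "rigid_el y \<longleftrightarrow> y \<in> carrier G \<and> infimum y < supremum y \<and> glb (initial y) (initial (inv y)) = \<one>"

lemma rigid_el_inv: "rigid_el y \<Longrightarrow> rigid_el (inv y)"
  by (auto simp: rigid_el_def supremum_inv infimum_inv glb_commute)

lemma rigid_initial_extend:
  assumes "rigid_el y"
  shows "glb (Dpow 1) (y \<otimes> initial y \<otimes> Dpow (- infimum y)) = initial y"
  using assms initial_extend[of y "initial y"] glb_initial_inv[of y "initial y"] by (simp add: rigid_el_def initial_pre_D)

lemma glb_D_twist:
  assumes x: "x \<in> carrier G" and v: "v \<in> carrier G" and q: "Dpow q \<preceq> x"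
  shows "glb (Dpow 1) (x \<otimes> v \<otimes> Dpow (- q)) = glb (Dpow 1) (x \<otimes> glb (Dpow 1) v \<otimes> Dpow (- q))"
proof -
  have "Dpow 1 \<preceq> x \<otimes> Dpow 1 \<otimes> Dpow (- q)"
  proof -
    have "\<one> \<otimes> Dpow 1 \<preceq> x \<otimes> Dpow (- q) \<otimes> Dpow 1"
      using q x by (subst pre_Dpow_iff) (simp_all add: one_pre_iff)
    then show ?thesis using x by (simp add: Dpow_simps add.commute)
  qed
  then have "glb (Dpow 1) (x \<otimes> v \<otimes> Dpow (- q)) = glb (glb (Dpow 1) (x \<otimes> Dpow 1 \<otimes> Dpow (- q))) (x \<otimes> v \<otimes> Dpow (- q))"
    using x by (simp add: glb_absorb)
  also have "\<dots> = glb (Dpow 1) (glb (x \<otimes> Dpow 1 \<otimes> Dpow (- q)) (x \<otimes> v \<otimes> Dpow (- q)))"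
    using x v by (simp add: glb_assoc)
  also have "glb (x \<otimes> Dpow 1 \<otimes> Dpow (- q)) (x \<otimes> v \<otimes> Dpow (- q)) = x \<otimes> glb (Dpow 1) v \<otimes> Dpow (- q)"
    using x v by (subst glb_Dpow) (simp_all add: glb_left)
  finally show ?thesis .
qed

lemma rigid_power:
  assumes r: "rigid_el x"
  shows "glb (Dpow 1) (x [^] Suc m \<otimes> Dpow (- (infimum x * int (Suc m)))) = initial x"
proof (induction m)
  case 0
  then show ?case using r by (simp add: rigid_el_def initial_def)
next
  case (Suc m)
  have x: "x \<in> carrier G" using r by (simp add: rigid_el_def)
  define v where "v = x [^] Suc m \<otimes> Dpow (- (infimum x * int (Suc m)))"
  have v: "v \<in> carrier G" using x by (simp add: v_def)
  have "x [^] Suc (Suc m) \<otimes> Dpow (- (infimum x * int (Suc (Suc m)))) = x \<otimes> v \<otimes> Dpow (- infimum x)"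
    unfolding v_def nat_pow_Suc2[OF x, of "Suc m"] using x
    by (simp add: m_assoc Dpow_add del: nat_pow_Suc) (simp add: algebra_simps)
  then show ?case
    using glb_D_twist[OF x v] Dpow_pre_infimum[OF x] Suc rigid_initial_extend[OF r] by (simp add: v_def)
qed

text \<open>
  Suppose that the conjugate by \<open>g\<close> has infimum at least \<open>q = p + 1\<close>, where \<open>p\<close> is the infimum of \<open>x\<close>.
  Then its \<open>m\<close>-th power has infimum at least \<open>q m\<close>, and the infimum of \<open>x\<^sup>m\<close> differs from that by at
  most a constant depending on \<open>g\<close>. For large \<open>m\<close> it exceeds \<open>p m\<close>, but the powers of a rigid element
  begin with the initial factor of \<open>x\<close> right after \<open>D\<^sup>p\<^sup>m\<close>, and this factor is not \<open>D\<close>.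
\<close>
lemma rigid_infimum_maximal:
  assumes r: "rigid_el x" and g: "g \<in> carrier G"
  shows "infimum (conj_by x g) \<le> infimum x"
proof (rule ccontr)
  assume "\<not> infimum (conj_by x g) \<le> infimum x"
  define q where "q = infimum x + 1"
  have x: "x \<in> carrier G" using r by (simp add: rigid_el_def)
  have gq: "g \<otimes> Dpow q \<preceq> x \<otimes> g"
    using \<open>\<not> infimum (conj_by x g) \<le> infimum x\<close> x g by (simp add: q_def flip: infimum_conj_by_iff)
  have pow: "g \<otimes> Dpow (q * int m) \<preceq> x [^] m \<otimes> g" for m
  proof (induction m)
    case (Suc m)
    have "g \<otimes> Dpow (q * int (Suc m)) = g \<otimes> Dpow (q * int m) \<otimes> Dpow q"
      using g by (simp add: m_assoc Dpow_add algebra_simps)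
    also have "\<dots> \<preceq> x [^] m \<otimes> g \<otimes> Dpow q" using Suc x g by (subst pre_Dpow_iff) auto
    also have "x [^] m \<otimes> g \<otimes> Dpow q \<preceq> x [^] m \<otimes> (x \<otimes> g)"
      using gq x g by (simp add: m_assoc)
    also have "x [^] m \<otimes> (x \<otimes> g) = x [^] Suc m \<otimes> g" using x g by (simp add: m_assoc)
    finally show ?case using x g by simp
  qed (use g in simp)
  obtain i j where ij: "Dpow i \<preceq> g" "g \<preceq> Dpow j" using Dpow_lower_bound Dpow_upper_bound g by blast
  have "i \<le> j" using pre_trans[OF ij] g by simp
  \<comment> \<open>The conjugator lies between \<open>D\<^sup>i\<close> and \<open>D\<^sup>j\<close>, so the loss is \<open>j - i\<close> and the power \<open>m + 1\<close> suffices.\<close>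
  define m where "m = nat (j - i)"
  have "Dpow (i + q * int (Suc m)) = Dpow i \<otimes> Dpow (q * int (Suc m))" by (simp add: Dpow_add)
  also have "\<dots> \<preceq> g \<otimes> Dpow (q * int (Suc m))" using ij g by (subst pre_Dpow_iff) auto
  also have "\<dots> \<preceq> x [^] Suc m \<otimes> g" by (rule pow)
  also have "x [^] Suc m \<otimes> g \<preceq> x [^] Suc m \<otimes> Dpow j" using ij x g by (subst pre_left_iff) auto
  finally have "Dpow (i + q * int (Suc m)) \<preceq> x [^] Suc m \<otimes> Dpow j" using x g by simp
  then have "Dpow (i + q * int (Suc m)) \<otimes> Dpow (- j) \<preceq> x [^] Suc m"
    using pre_Dpow_move[of "Dpow (i + q * int (Suc m))" "x [^] Suc m" "- j"] x by simp
  moreover have "i + q * int (Suc m) + - j = infimum x * int (Suc m) + 1"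
    using \<open>i \<le> j\<close> by (simp add: m_def q_def algebra_simps)
  ultimately have "Dpow (infimum x * int (Suc m) + 1) \<preceq> x [^] Suc m" by (simp only: Dpow_add)
  then have "Dpow 1 \<preceq> x [^] Suc m \<otimes> Dpow (- (infimum x * int (Suc m)))"
    using x by (subst Dpow1_pre_iff) auto
  then have "initial x = Dpow 1"
    using rigid_power[OF r, of m] x glb_absorb[of "Dpow 1" "x [^] Suc m \<otimes> Dpow (- (infimum x * int (Suc m)))"]
    by simp
  then show False using initial_ne_D[OF x] by simp
qed

lemma rigid_supremum_minimal:
  assumes "rigid_el x" "g \<in> carrier G"
  shows "supremum x \<le> supremum (conj_by x g)"
  using rigid_infimum_maximal[OF rigid_el_inv[OF assms(1)] assms(2)] assms
  by (simp add: rigid_el_def conj_by_inv[symmetric] infimum_inv)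

definition cyc :: "'a \<Rightarrow> 'a" where
  "cyc y = conj_by y (initial y)"

lemma cyc_carrier [simp]: "y \<in> carrier G \<Longrightarrow> cyc y \<in> carrier G"
  by (simp add: cyc_def)

lemma cyc_pow_carrier [simp]: "y \<in> carrier G \<Longrightarrow> (cyc ^^ k) y \<in> carrier G"
  by (induction k) auto

fun cycling_prod :: "'a \<Rightarrow> nat \<Rightarrow> 'a" where
  "cycling_prod y 0 = \<one>"
| "cycling_prod y (Suc k) = cycling_prod y k \<otimes> initial ((cyc ^^ k) y)"

lemma cycling_prod_carrier [simp]: "y \<in> carrier G \<Longrightarrow> cycling_prod y k \<in> carrier G"
  by (induction k) auto

lemma conj_by_cycling_prod: "y \<in> carrier G \<Longrightarrow> conj_by y (cycling_prod y k) = (cyc ^^ k) y"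
  by (induction k) (simp_all add: conj_by_mult flip: cyc_def)

lemma funpow_shift: "(f ^^ (i + j)) x = (f ^^ j) ((f ^^ i) x)"
  by (simp add: funpow_add add.commute[of i])

lemma cycling_prod_add: "y \<in> carrier G \<Longrightarrow> cycling_prod y (i + j) = cycling_prod y i \<otimes> cycling_prod ((cyc ^^ i) y) j"
  by (induction j) (simp_all add: m_assoc funpow_shift)

end

section \<open>Transport along cycling\<close>

text \<open>
  Meant for the conjugacy class \<open>C\<close> of a rigid element: the bounds \<open>p\<close> and \<open>s\<close> are its infimum and supremum, which
  are optimal in the class by \<open>rigid_infimum_maximal\<close> and \<open>rigid_supremum_minimal\<close>. The elements that attain
  both are those of minimal canonical length.
\<close>
locale summit_class = garside_group +
  fixes C :: "'a set" and p s :: int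
  assumes C_carrier: "y \<in> C \<Longrightarrow> y \<in> carrier G"
    and C_conj_by: "y \<in> C \<Longrightarrow> a \<in> carrier G \<Longrightarrow> conj_by y a \<in> C"
    and C_infimum: "y \<in> C \<Longrightarrow> infimum y \<le> p"
    and C_supremum: "y \<in> C \<Longrightarrow> s \<le> supremum y"
    and p_less_s: "p < s"
begin

definition SSS :: "'a set" where
  "SSS = {y \<in> C. infimum y = p \<and> supremum y = s}"

definition USS :: "'a set" where
  "USS = {y \<in> SSS. \<exists>m>0. (cyc ^^ m) y = y}"

lemma SSS_carrier: "y \<in> SSS \<Longrightarrow> y \<in> carrier G"
  by (simp add: SSS_def C_carrier)

lemma SSS_C: "y \<in> SSS \<Longrightarrow> y \<in> C"
  by (simp add: SSS_def)

lemma USS_SSS: "y \<in> USS \<Longrightarrow> y \<in> SSS"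
  by (simp add: USS_def)

lemma SSS_infimum: "y \<in> SSS \<Longrightarrow> infimum y = p" "y \<in> SSS \<Longrightarrow> supremum y = s"
  by (simp_all add: SSS_def)

lemma conj_by_SSS_iff:
  assumes "y \<in> C" "a \<in> carrier G"
  shows "conj_by y a \<in> SSS \<longleftrightarrow> a \<otimes> Dpow p \<preceq> y \<otimes> a \<and> y \<otimes> a \<preceq> a \<otimes> Dpow s"
  using C_conj_by[OF assms] C_infimum[OF C_conj_by[OF assms]] C_supremum[OF C_conj_by[OF assms]] C_carrier[OF assms(1)] assms(2)
  by (auto simp: SSS_def simp flip: infimum_conj_by_iff supremum_conj_by_iff)

lemma finite_SSS: "finite SSS"
  by (rule finite_subset[OF _ finite_interval[of p s]])
     (auto simp: SSS_def C_carrier Dpow_pre_infimum pre_Dpow_supremum)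

text \<open>
  By \<open>conj_by_SSS_iff\<close> the conjugators into the super summit set are cut out by inequalities between
  automorphisms of the order applied to \<open>g\<close>, so they are closed under meets.
\<close>
lemma SSS_convex:
  assumes y: "y \<in> C" and g: "conj_by y g \<in> SSS" "g \<in> carrier G" and h: "conj_by y h \<in> SSS" "h \<in> carrier G"
  shows "conj_by y (glb g h) \<in> SSS"
proof -
  have yc: "y \<in> carrier G" using y by (rule C_carrier)
  have "glb (g \<otimes> Dpow p) (h \<otimes> Dpow p) \<preceq> glb (y \<otimes> g) (y \<otimes> h)"
    using g h y yc by (intro glb_mono) (auto simp: conj_by_SSS_iff)
  then have "glb g h \<otimes> Dpow p \<preceq> y \<otimes> glb g h" using g h yc by (simp add: glb_Dpow glb_left)
  moreover have "glb (y \<otimes> g) (y \<otimes> h) \<preceq> glb (g \<otimes> Dpow s) (h \<otimes> Dpow s)"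
    using g h y yc by (intro glb_mono) (auto simp: conj_by_SSS_iff)
  then have "y \<otimes> glb g h \<preceq> glb g h \<otimes> Dpow s" using g h yc by (simp add: glb_Dpow glb_left)
  ultimately show ?thesis using g h y by (simp add: conj_by_SSS_iff)
qed

lemma cyc_SSS: "y \<in> SSS \<Longrightarrow> cyc y \<in> SSS"
proof -
  assume y: "y \<in> SSS"
  note yc = SSS_carrier[OF y] and yp = SSS_infimum[OF y]
  let ?i = "initial y"
  have "?i \<otimes> Dpow p \<preceq> y" using initial_pre[OF yc] yc by (simp add: yp pre_Dpow_move)
  also have "y \<preceq> y \<otimes> ?i" using yc by (simp add: pre_mult_right initial_P)
  finally have 1: "?i \<otimes> Dpow p \<preceq> y \<otimes> ?i" using yc by simp
  have "inv y \<otimes> ?i = glb (inv y \<otimes> Dpow 1) (inv y \<otimes> (y \<otimes> Dpow (- p)))"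
    unfolding initial_def yp using yc by (subst glb_left) auto
  then have e: "inv y \<otimes> ?i = glb (inv y \<otimes> Dpow 1) (Dpow (- p))" using yc by simp
  have "?i \<otimes> Dpow (- s) \<preceq> Dpow 1 \<otimes> Dpow (- s)" using initial_pre_D[OF yc] yc by (subst pre_Dpow_iff) auto
  then have a: "?i \<otimes> Dpow (- s) \<preceq> Dpow (1 - s)" by (simp add: Dpow_add)
  have "Dpow (- s) \<otimes> Dpow 1 \<preceq> inv y \<otimes> Dpow 1"
    using yc yp pre_inv[of y s] pre_Dpow_supremum[OF yc, of s] by (subst pre_Dpow_iff) auto
  then have "Dpow (1 - s) \<preceq> inv y \<otimes> Dpow 1" by (simp add: Dpow_add)
  then have "?i \<otimes> Dpow (- s) \<preceq> inv y \<otimes> Dpow 1" using pre_trans[OF a] yc by simp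
  moreover have "?i \<otimes> Dpow (- s) \<preceq> Dpow (- p)" using pre_trans[OF a, of "Dpow (- p)"] yc p_less_s by simp
  ultimately have "?i \<otimes> Dpow (- s) \<preceq> inv y \<otimes> ?i" using yc by (simp add: e pre_glb_iff)
  then have "y \<otimes> (?i \<otimes> Dpow (- s)) \<preceq> y \<otimes> (inv y \<otimes> ?i)" using yc by (subst pre_left_iff) auto
  then have "y \<otimes> ?i \<otimes> Dpow (- s) \<preceq> ?i" using yc by (simp add: m_assoc)
  then have "y \<otimes> ?i \<preceq> ?i \<otimes> Dpow s" using yc by (subst (asm) pre_Dpow_move) auto
  with 1 show ?thesis using y yc by (simp add: cyc_def conj_by_SSS_iff SSS_C)
qed

lemma cyc_pow_SSS: "y \<in> SSS \<Longrightarrow> (cyc ^^ k) y \<in> SSS"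
  by (induction k) (auto intro: cyc_SSS)

text \<open>
  If \<open>y\<close> and \<open>y\<^sup>g\<close> are in the super summit set, this is \<open>\<iota>(y)\<^sup>-\<^sup>1 g \<iota>(y\<^sup>g)\<close>, which conjugates \<open>c(y)\<close> to
  \<open>c(y\<^sup>g)\<close>. The formula with a meet makes sense for every \<open>g\<close>, and from it the compatibility with
  meets is immediate.
\<close>
definition transport :: "'a \<Rightarrow> 'a \<Rightarrow> 'a" where
  "transport y g = inv (initial y) \<otimes> glb (g \<otimes> Dpow 1) (y \<otimes> g \<otimes> Dpow (- p))"

lemma transport_carrier [simp]: "y \<in> carrier G \<Longrightarrow> g \<in> carrier G \<Longrightarrow> transport y g \<in> carrier G"
  by (simp add: transport_def)

lemma transport_glb:
  assumes "y \<in> carrier G" "g \<in> carrier G" "h \<in> carrier G"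
  shows "transport y (glb g h) = glb (transport y g) (transport y h)"
proof -
  have AC: "glb (glb a b) (glb c d) = glb (glb a c) (glb b d)"
    if "a \<in> carrier G" "b \<in> carrier G" "c \<in> carrier G" "d \<in> carrier G" for a b c d
    using that by (simp add: glb_assoc) (metis glb_assoc glb_carrier glb_commute)
  have "glb (glb g h \<otimes> Dpow 1) (y \<otimes> glb g h \<otimes> Dpow (- p)) =
      glb (glb (g \<otimes> Dpow 1) (h \<otimes> Dpow 1)) (glb (y \<otimes> g \<otimes> Dpow (- p)) (y \<otimes> h \<otimes> Dpow (- p)))"
    using assms by (simp add: glb_Dpow glb_left)
  also have "\<dots> = glb (glb (g \<otimes> Dpow 1) (y \<otimes> g \<otimes> Dpow (- p))) (glb (h \<otimes> Dpow 1) (y \<otimes> h \<otimes> Dpow (- p)))"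
    using assms by (intro AC) auto
  finally show ?thesis using assms by (simp add: transport_def glb_left)
qed

lemma transport_mono:
  assumes "g \<preceq> h" "y \<in> carrier G" "g \<in> carrier G" "h \<in> carrier G"
  shows "transport y g \<preceq> transport y h"
proof -
  have "transport y g = glb (transport y g) (transport y h)" using transport_glb[of y g h] assms by (simp add: glb_absorb)
  then show ?thesis using glb_pre(2)[of "transport y g" "transport y h"] assms by simp
qed

lemma transport_Dpow:
  assumes "y \<in> SSS"
  shows "transport y (Dpow k) = Dpow k"
proof -
  note yc = SSS_carrier[OF assms]
  have "glb (Dpow k \<otimes> Dpow 1) (y \<otimes> Dpow k \<otimes> Dpow (- p)) = glb (Dpow 1 \<otimes> Dpow k) (y \<otimes> Dpow (- p) \<otimes> Dpow k)"
    using yc by (simp add: Dpow_simps add.commute)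
  also have "\<dots> = initial y \<otimes> Dpow k" using yc by (subst glb_Dpow) (auto simp: initial_def SSS_infimum[OF assms])
  finally show ?thesis using yc by (simp add: transport_def)
qed

lemma transport_conj_by:
  assumes y: "y \<in> SSS" and g: "g \<in> carrier G" and z: "conj_by y g \<in> SSS"
  shows "transport y g = inv (initial y) \<otimes> g \<otimes> initial (conj_by y g)"
proof -
  note yc = SSS_carrier[OF y]
  have "g \<otimes> initial (conj_by y g) = glb (g \<otimes> Dpow 1) (g \<otimes> (conj_by y g \<otimes> Dpow (- p)))"
    using yc g by (simp add: initial_def SSS_infimum[OF z] glb_left)
  also have "g \<otimes> (conj_by y g \<otimes> Dpow (- p)) = y \<otimes> g \<otimes> Dpow (- p)"
    using yc g mult_conj_by[of y g] by (simp flip: m_assoc)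
  finally show ?thesis using yc g by (simp add: transport_def m_assoc)
qed

lemma conj_by_transport:
  assumes y: "y \<in> SSS" and g: "g \<in> carrier G" and z: "conj_by y g \<in> SSS"
  shows "conj_by (cyc y) (transport y g) = cyc (conj_by y g)"
proof -
  note yc = SSS_carrier[OF y]
  have "conj_by (cyc y) (transport y g) = conj_by y (initial y \<otimes> transport y g)"
    using yc g by (simp add: cyc_def conj_by_mult)
  also have "initial y \<otimes> transport y g = g \<otimes> initial (conj_by y g)" using yc g z by (simp add: transport_conj_by[OF y g z] m_assoc)
  finally show ?thesis using yc g by (simp add: conj_by_mult flip: cyc_def)
qed

fun transports :: "'a \<Rightarrow> nat \<Rightarrow> 'a \<Rightarrow> 'a" where
  "transports y 0 g = g"
| "transports y (Suc k) g = transport ((cyc ^^ k) y) (transports y k g)"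

lemma transports_carrier [simp]: "y \<in> carrier G \<Longrightarrow> g \<in> carrier G \<Longrightarrow> transports y k g \<in> carrier G"
  by (induction k) auto

lemma transports_add: "transports y (i + j) g = transports ((cyc ^^ i) y) j (transports y i g)"
  by (induction j) (simp_all add: funpow_shift)

lemma transports_glb: "y \<in> carrier G \<Longrightarrow> g \<in> carrier G \<Longrightarrow> h \<in> carrier G \<Longrightarrow> transports y k (glb g h) = glb (transports y k g) (transports y k h)"
  by (induction k) (simp_all add: transport_glb)

lemma transports_mono:
  "g \<preceq> h \<Longrightarrow> y \<in> carrier G \<Longrightarrow> g \<in> carrier G \<Longrightarrow> h \<in> carrier G \<Longrightarrow> transports y k g \<preceq> transports y k h"
  by (induction k) (simp_all add: transport_mono)

lemma transports_Dpow: "y \<in> SSS \<Longrightarrow> transports y k (Dpow i) = Dpow i"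
  by (induction k) (simp_all add: transport_Dpow cyc_pow_SSS)

lemma conj_by_transports: "y \<in> SSS \<Longrightarrow> g \<in> carrier G \<Longrightarrow> conj_by y g \<in> SSS \<Longrightarrow> conj_by ((cyc ^^ k) y) (transports y k g) = (cyc ^^ k) (conj_by y g)"
proof (induction k)
  case (Suc k)
  then have "conj_by ((cyc ^^ k) y) (transports y k g) \<in> SSS" by (simp add: cyc_pow_SSS)
  then show ?case
    using Suc conj_by_transport[of "(cyc ^^ k) y" "transports y k g"] by (simp add: cyc_pow_SSS SSS_carrier)
qed simp

lemma transports_conj_by:
  "y \<in> SSS \<Longrightarrow> g \<in> carrier G \<Longrightarrow> conj_by y g \<in> SSS \<Longrightarrow> transports y k g = inv (cycling_prod y k) \<otimes> g \<otimes> cycling_prod (conj_by y g) k"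
proof (induction k)
  case (Suc k)
  note yc = SSS_carrier[OF Suc.prems(1)]
  have z: "conj_by ((cyc ^^ k) y) (transports y k g) = (cyc ^^ k) (conj_by y g)" using Suc.prems by (rule conj_by_transports)
  have "conj_by ((cyc ^^ k) y) (transports y k g) \<in> SSS" unfolding z by (rule cyc_pow_SSS[OF Suc.prems(3)])
  then have "transport ((cyc ^^ k) y) (transports y k g) =
      inv (initial ((cyc ^^ k) y)) \<otimes> transports y k g \<otimes> initial ((cyc ^^ k) (conj_by y g))"
    using transport_conj_by[OF cyc_pow_SSS[OF Suc.prems(1)], of "transports y k g" k] yc Suc.prems(2) by (simp add: z)
  then show ?case
    using Suc.IH[OF Suc.prems] yc Suc.prems(2) by (simp add: m_assoc inv_mult_group)
qed simp

lemma periodic_mult: "(cyc ^^ M) y = y \<Longrightarrow> (cyc ^^ (M * j)) y = y"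
  by (induction j) (simp_all add: funpow_shift)

lemma transports_periodic_mult: "(cyc ^^ M) y = y \<Longrightarrow> transports y M g = g \<Longrightarrow> transports y (M * j) g = g"
  by (induction j) (simp_all add: transports_add)

text \<open>
  Over a common cycling period of \<open>y\<close> and \<open>y\<^sup>g\<close>, transport is the bijection \<open>g \<mapsto> A\<^sup>-\<^sup>1 g B\<close>, where \<open>A\<close> and \<open>B\<close>
  are the products of initial factors over the period. It keeps an interval between powers of \<open>D\<close>, and
  intervals are finite, so it returns to \<open>g\<close>.
\<close>
lemma transports_periodic:
  assumes y: "y \<in> USS" and g: "g \<in> carrier G" and z: "conj_by y g \<in> USS"
  shows "\<exists>M>0. (cyc ^^ M) y = y \<and> transports y M g = g"
proof -
  note yS = USS_SSS[OF y] and zS = USS_SSS[OF z]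
  note yc = SSS_carrier[OF yS] and zc = SSS_carrier[OF zS]
  obtain m1 m2 where m: "m1 > 0" "(cyc ^^ m1) y = y" "m2 > 0" "(cyc ^^ m2) (conj_by y g) = conj_by y g"
    using y z by (auto simp: USS_def)
  define M where "M = m1 * m2"
  have M: "M > 0" "(cyc ^^ M) y = y" "(cyc ^^ M) (conj_by y g) = conj_by y g"
    using m periodic_mult[of m1 y m2] periodic_mult[of m2 "conj_by y g" m1] by (simp_all add: M_def mult.commute)
  obtain i j where ij: "Dpow i \<preceq> g" "g \<preceq> Dpow j" using Dpow_lower_bound Dpow_upper_bound g by blast
  have "transports y (M * k) g \<in> {a \<in> carrier G. Dpow i \<preceq> a \<and> a \<preceq> Dpow j}" for k
    using transports_mono[OF ij(1) yc] transports_mono[OF ij(2) yc] g yc transports_Dpow[OF yS] by (metis (mono_tags, lifting) CollectI Dpow_carrier transports_carrier)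
  then have "finite (range (\<lambda>k. transports y (M * k) g))"
    by (intro finite_subset[OF _ finite_interval[of i j]]) auto
  then obtain a b where ab: "a < b" "transports y (M * a) g = transports y (M * b) g"
    by (metis (mono_tags, lifting) finite_imageD infinite_UNIV_nat injI linorder_neqE_nat)
  define c where "c = b - a"
  have b: "M * b = M * c + M * a" using ab(1) by (simp add: c_def flip: distrib_left)
  have per: "(cyc ^^ (M * k)) y = y" "(cyc ^^ (M * k)) (conj_by y g) = conj_by y g" for k
    using M periodic_mult by auto
  define A B h where "A = cycling_prod y (M * a)" and "B = cycling_prod (conj_by y g) (M * a)"
    and "h = inv (cycling_prod y (M * c)) \<otimes> g \<otimes> cycling_prod (conj_by y g) (M * c)"
  have AB: "A \<in> carrier G" "B \<in> carrier G" "h \<in> carrier G"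
    using yc zc g by (simp_all add: A_def B_def h_def)
  have "inv A \<otimes> g \<otimes> B = inv A \<otimes> h \<otimes> B"
    using ab(2) yS zS g yc zc unfolding b transports_conj_by[OF yS g zS] A_def B_def h_def
    by (simp add: cycling_prod_add per m_assoc inv_mult_group)
  then have "A \<otimes> (inv A \<otimes> g \<otimes> B) \<otimes> inv B = A \<otimes> (inv A \<otimes> h \<otimes> B) \<otimes> inv B" by simp
  then have "g = inv (cycling_prod y (M * c)) \<otimes> g \<otimes> cycling_prod (conj_by y g) (M * c)"
    using AB g unfolding h_def[symmetric] by (simp add: m_assoc)
  then have "transports y (M * c) g = g" using transports_conj_by[OF yS g zS] by simp
  moreover have "M * c > 0" using M ab by (simp add: c_def)
  ultimately show ?thesis using per by blast
qed

text \<open>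
  A common period of the transports of \<open>g\<close> and \<open>h\<close> is a period for the transport of their meet, and hence
  for \<open>y\<close> conjugated by the meet.
\<close>
theorem USS_meet:
  assumes y: "y \<in> USS" and g: "g \<in> carrier G" "conj_by y g \<in> USS" and h: "h \<in> carrier G" "conj_by y h \<in> USS"
  shows "conj_by y (glb g h) \<in> USS"
proof -
  note yS = USS_SSS[OF y]
  note yc = SSS_carrier[OF yS]
  have SSS: "conj_by y (glb g h) \<in> SSS" using g h by (intro SSS_convex SSS_C[OF yS] USS_SSS)
  obtain M1 where M1: "M1 > 0" "(cyc ^^ M1) y = y" "transports y M1 g = g" using transports_periodic[OF y g] by blast
  obtain M2 where M2: "M2 > 0" "(cyc ^^ M2) y = y" "transports y M2 h = h" using transports_periodic[OF y h] by blast
  define M where "M = M1 * M2"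
  have M: "M > 0" "(cyc ^^ M) y = y" "transports y M g = g" "transports y M h = h"
    using M1 M2 periodic_mult[of M1 y M2] transports_periodic_mult[of M1 y g M2] transports_periodic_mult[of M2 y h M1]
    by (simp_all add: M_def mult.commute)
  have "(cyc ^^ M) (conj_by y (glb g h)) = conj_by ((cyc ^^ M) y) (transports y M (glb g h))"
    using yS SSS g h by (simp add: conj_by_transports)
  also have "\<dots> = conj_by y (glb g h)" using M yc g h by (simp add: transports_glb)
  finally show ?thesis using SSS M(1) by (auto simp: USS_def)
qed

end

section \<open>Rigid elements under cycling\<close>

context garside_group begin

lemma initial_ne_one: "y \<in> carrier G \<Longrightarrow> infimum y < supremum y \<Longrightarrow> initial y \<noteq> \<one>"
proof
  assume y: "y \<in> carrier G" and l: "infimum y < supremum y" and i: "initial y = \<one>"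
  have "y \<otimes> Dpow (- infimum y) \<in> P" using y by (simp add: P_iff_pre one_pre_iff Dpow_pre_infimum)
  then have "y \<otimes> Dpow (- infimum y) = \<one>" by (rule glb_D_nontrivial) (use i in \<open>simp add: initial_def\<close>)
  then have "y \<preceq> Dpow (infimum y)" using y pre_Dpow_move[of y \<one> "- infimum y"] by simp
  then show False using l y by (simp add: pre_Dpow_supremum)
qed

lemma Dpow_even_central: "a \<in> carrier G \<Longrightarrow> a \<otimes> Dpow (2 * k) = Dpow (2 * k) \<otimes> a"
proof -
  assume a: "a \<in> carrier G"
  have nat: "a \<otimes> Dpow (2 * int n) = Dpow (2 * int n) \<otimes> a" for n
  proof (induction n)
    case (Suc n)
    have "Dpow (2 * int (Suc n)) = Dpow 1 \<otimes> Dpow 1 \<otimes> Dpow (2 * int n)" by (simp add: Dpow_add)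
    moreover have "a \<otimes> (Dpow 1 \<otimes> Dpow 1 \<otimes> Dpow (2 * int n)) = Dpow 1 \<otimes> Dpow 1 \<otimes> Dpow (2 * int n) \<otimes> a"
    proof -
      have "a \<otimes> (Dpow 1 \<otimes> Dpow 1 \<otimes> Dpow (2 * int n)) = a \<otimes> (D \<otimes> D) \<otimes> Dpow (2 * int n)"
        using a by (simp only: Dpow_1 m_assoc m_closed Dpow_carrier D_carrier)
      also have "\<dots> = D \<otimes> D \<otimes> (a \<otimes> Dpow (2 * int n))"
        unfolding D_square_central[OF a, symmetric] using a by (simp only: m_assoc m_closed Dpow_carrier D_carrier)
      finally show ?thesis
        unfolding Suc using a by (simp only: Dpow_1 m_assoc m_closed Dpow_carrier D_carrier)
    qed
    ultimately show ?case by simp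
  qed (use a in simp)
  show ?thesis
  proof (cases "0 \<le> k")
    case True
    then show ?thesis using nat[of "nat k"] by simp
  next
    case False
    then have c: "a \<otimes> Dpow (- (2 * k)) = Dpow (- (2 * k)) \<otimes> a" using nat[of "nat (- k)"] by simp
    have "a \<otimes> Dpow (2 * k) = Dpow (2 * k) \<otimes> (Dpow (- (2 * k)) \<otimes> a) \<otimes> Dpow (2 * k)"
      using a by (simp add: Dpow_add_left)
    also have "\<dots> = Dpow (2 * k) \<otimes> a" unfolding c[symmetric] using a by (simp add: Dpow_simps)
    finally show ?thesis .
  qed
qed

lemma conj_by_Dpow_even: "a \<in> carrier G \<Longrightarrow> conj_by a (Dpow (2 * k)) = a"
  using conj_by_eq_iff[of a a "Dpow (2 * k)"] by (simp add: Dpow_even_central)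

lemma conj_by_Dpow_odd: "a \<in> carrier G \<Longrightarrow> odd k \<Longrightarrow> conj_by a (Dpow k) = conj_by a (Dpow 1)"
  using conj_by_mult[of a "Dpow (2 * (k div 2))" "Dpow 1"] by (auto simp: conj_by_Dpow_even Dpow_add elim!: oddE)

lemma infimum_conj_by_Dpow: "y \<in> carrier G \<Longrightarrow> infimum (conj_by y (Dpow k)) = infimum y"
proof -
  assume y: "y \<in> carrier G"
  have "q \<le> infimum (conj_by y (Dpow k)) \<longleftrightarrow> q \<le> infimum y" for q
    using y pre_Dpow_iff[of "Dpow q" y k] by (simp add: infimum_conj_by_iff Dpow_add add.commute Dpow_pre_infimum)
  then show ?thesis by (meson order_antisym order_refl)
qed

lemma initial_conj_by_Dpow: "y \<in> carrier G \<Longrightarrow> initial (conj_by y (Dpow k)) = conj_by (initial y) (Dpow k)"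
proof -
  assume y: "y \<in> carrier G"
  have "initial (conj_by y (Dpow k)) = glb (Dpow (- k) \<otimes> Dpow 1 \<otimes> Dpow k) (Dpow (- k) \<otimes> (y \<otimes> Dpow (- infimum y)) \<otimes> Dpow k)"
    using y by (simp add: initial_def infimum_conj_by_Dpow) (simp add: conj_by_def Dpow_simps)
  also have "\<dots> = Dpow (- k) \<otimes> initial y \<otimes> Dpow k"
    using y by (subst glb_Dpow) (simp_all add: glb_left initial_def)
  finally show ?thesis by (simp add: conj_by_def inv_Dpow)
qed

lemma cyc_conj_by_Dpow: "y \<in> carrier G \<Longrightarrow> cyc (conj_by y (Dpow k)) = conj_by (cyc y) (Dpow k)"
proof -
  assume y: "y \<in> carrier G"
  have "cyc (conj_by y (Dpow k)) = conj_by y (Dpow k \<otimes> conj_by (initial y) (Dpow k))"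
    using y by (simp add: cyc_def initial_conj_by_Dpow conj_by_mult)
  also have "Dpow k \<otimes> conj_by (initial y) (Dpow k) = initial y \<otimes> Dpow k" using y by (simp add: mult_conj_by)
  finally show ?thesis using y by (simp add: cyc_def conj_by_mult)
qed

lemma cyc_pow_conj_by_Dpow: "y \<in> carrier G \<Longrightarrow> (cyc ^^ m) (conj_by y (Dpow k)) = conj_by ((cyc ^^ m) y) (Dpow k)"
  by (induction m) (simp_all add: cyc_conj_by_Dpow)

lemma cycling_prod_conj_by_Dpow: "y \<in> carrier G \<Longrightarrow> cycling_prod (conj_by y (Dpow k)) m = conj_by (cycling_prod y m) (Dpow k)"
proof (induction m)
  case (Suc m)
  then show ?case
    by (simp add: cyc_pow_conj_by_Dpow initial_conj_by_Dpow) (simp add: conj_by_def Dpow_simps inv_Dpow)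
qed (simp add: conj_by_def)

lemma cycling_prod_Suc_left: "y \<in> carrier G \<Longrightarrow> cycling_prod y (Suc m) = initial y \<otimes> cycling_prod (cyc y) m"
  using cycling_prod_add[of y 1 m] by simp

end

context summit_class begin

text \<open>
  In the normal form of a rigid \<open>y\<close>, cycling moves the first factor to the end. So the final factor of
  \<open>c(y)\<close> is \<open>\<iota>(y)\<close>, and \<open>\<iota>(c(y)\<^sup>-\<^sup>1)\<close> is its complement.
\<close>
lemma rigid_initial_inv_cyc:
  assumes y: "y \<in> SSS" and r: "rigid_el y"
  shows "initial (inv (cyc y)) = inv (initial y) \<otimes> Dpow 1"
proof -
  note yc = SSS_carrier[OF y] and yp = SSS_infimum[OF y] and cp = SSS_infimum[OF cyc_SSS[OF y]]
  let ?i = "initial y"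
  let ?B = "inv y \<otimes> ?i \<otimes> Dpow s"
  have "\<one> \<otimes> Dpow 1 \<preceq> ?i \<otimes> Dpow 1" using yc by (subst pre_Dpow_iff) (auto simp: one_pre_initial)
  then have a: "Dpow 1 \<preceq> ?i \<otimes> Dpow 1" by simp
  have "y \<otimes> Dpow (1 - s) \<preceq> ?i"
  proof -
    have "y \<otimes> Dpow (1 - s) \<preceq> Dpow s \<otimes> Dpow (1 - s)" using yc yp pre_Dpow_supremum[OF yc, of s] by (subst pre_Dpow_iff) auto
    moreover have "y \<otimes> Dpow (1 - s) \<preceq> y \<otimes> Dpow (- p)" using yc p_less_s by simp
    ultimately show ?thesis using yc yp by (simp add: initial_def pre_glb_iff Dpow_add)
  qed
  then have "inv y \<otimes> (y \<otimes> Dpow (1 - s)) \<otimes> Dpow s \<preceq> inv y \<otimes> ?i \<otimes> Dpow s"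
    using yc by (subst pre_Dpow_iff, simp, simp) (subst pre_left_iff, auto)
  then have b: "Dpow 1 \<preceq> ?B" using yc by (simp add: Dpow_add)
  have d: "glb ?i (inv y \<otimes> ?i \<otimes> Dpow (s - 1)) \<preceq> \<one>"
  proof -
    have "?i \<otimes> Dpow (s - 1) \<preceq> Dpow 1 \<otimes> Dpow (s - 1)" using yc initial_pre_D by (subst pre_Dpow_iff) auto
    then have "inv y \<otimes> (?i \<otimes> Dpow (s - 1)) \<preceq> inv y \<otimes> Dpow s" using yc by (subst pre_left_iff) (auto simp: Dpow_add)
    then have "glb ?i (inv y \<otimes> ?i \<otimes> Dpow (s - 1)) \<preceq> glb ?i (inv y \<otimes> Dpow s)"
      using yc by (intro glb_mono) (auto simp: m_assoc)
    also have "glb ?i (inv y \<otimes> Dpow s) = \<one>"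
      using glb_initial_inv[OF yc, of ?i] r yc yp by (simp add: initial_pre_D rigid_el_def)
    finally show ?thesis using yc by simp
  qed
  have "glb (?i \<otimes> Dpow 1) ?B = glb ?i (inv y \<otimes> ?i \<otimes> Dpow (s - 1)) \<otimes> Dpow 1"
  proof -
    have "?B = inv y \<otimes> ?i \<otimes> Dpow (s - 1) \<otimes> Dpow 1" using yc by (simp add: m_assoc Dpow_add)
    then show ?thesis using yc by (simp add: glb_Dpow)
  qed
  also have "\<dots> \<preceq> \<one> \<otimes> Dpow 1" using d yc by (subst pre_Dpow_iff) auto
  finally have "glb (?i \<otimes> Dpow 1) ?B = Dpow 1"
    using a b yc by (intro pre_antisym) (auto simp: pre_glb_iff)
  moreover have "initial (inv (cyc y)) = inv ?i \<otimes> glb (?i \<otimes> Dpow 1) ?B"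
  proof -
    have "initial (inv (cyc y)) = glb (inv ?i \<otimes> (?i \<otimes> Dpow 1)) (inv ?i \<otimes> ?B)"
      using yc by (simp add: initial_inv cp) (simp add: cyc_def conj_by_def m_assoc inv_mult_group)
    also have "\<dots> = inv ?i \<otimes> glb (?i \<otimes> Dpow 1) ?B" using yc by (intro glb_left) auto
    finally show ?thesis .
  qed
  ultimately show ?thesis by simp
qed

lemma rigid_cyc:
  assumes y: "y \<in> SSS" and r: "rigid_el y"
  shows "rigid_el (cyc y)"
proof -
  note yc = SSS_carrier[OF y] and yp = SSS_infimum[OF y] and cS = cyc_SSS[OF y]
  let ?i = "initial y"
  have "\<one> \<otimes> Dpow 1 \<preceq> ?i \<otimes> Dpow 1" using yc by (subst pre_Dpow_iff) (auto simp: one_pre_initial)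
  then have a: "Dpow 1 \<preceq> ?i \<otimes> Dpow 1" by simp
  have e: "?i \<otimes> initial (cyc y) = glb (?i \<otimes> Dpow 1) (y \<otimes> ?i \<otimes> Dpow (- p))"
  proof -
    have "transport y ?i = inv ?i \<otimes> ?i \<otimes> initial (cyc y)"
      using transport_conj_by[of y ?i] y yc cS by (simp add: cyc_def)
    then have t: "inv ?i \<otimes> glb (?i \<otimes> Dpow 1) (y \<otimes> ?i \<otimes> Dpow (- p)) = initial (cyc y)"
      using yc by (simp add: transport_def)
    show ?thesis unfolding t[symmetric] using yc by simp
  qed
  have "?i \<otimes> glb (initial (cyc y)) (initial (inv (cyc y))) = glb (?i \<otimes> initial (cyc y)) (Dpow 1)"
    using yc by (simp add: rigid_initial_inv_cyc[OF y r] flip: glb_left)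
  also have "\<dots> = glb (glb (?i \<otimes> Dpow 1) (Dpow 1)) (y \<otimes> ?i \<otimes> Dpow (- p))"
    unfolding e using yc by (simp add: glb_assoc glb_commute[of "Dpow 1"])
  also have "glb (?i \<otimes> Dpow 1) (Dpow 1) = Dpow 1" using a yc by (simp add: glb_commute[of _ "Dpow 1"] glb_absorb)
  also have "glb (Dpow 1) (y \<otimes> ?i \<otimes> Dpow (- p)) = ?i" using rigid_initial_extend[OF r] yp by simp
  finally have "glb (initial (cyc y)) (initial (inv (cyc y))) = \<one>" using yc by simp
  then show ?thesis using SSS_infimum[OF cS] p_less_s yc by (simp add: rigid_el_def)
qed

lemma rigid_cyc_inj:
  assumes "y \<in> SSS" "rigid_el y" "z \<in> SSS" "rigid_el z" "cyc y = cyc z"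
  shows "y = z"
proof -
  note yc = SSS_carrier[OF assms(1)] and zc = SSS_carrier[OF assms(3)]
  have "inv (initial y) \<otimes> Dpow 1 = inv (initial z) \<otimes> Dpow 1"
    using rigid_initial_inv_cyc assms by metis
  then have "inv (inv (initial y)) = inv (inv (initial z))" using yc zc by simp
  then have i: "initial y = initial z" using yc zc by simp
  have "y \<otimes> initial y = initial y \<otimes> cyc y" "z \<otimes> initial y = initial y \<otimes> cyc z"
    using mult_conj_by[of y "initial y"] mult_conj_by[of z "initial z"] yc zc i by (simp_all add: cyc_def)
  then have "y \<otimes> initial y = z \<otimes> initial y" using assms(5) by simp
  then show ?thesis using yc zc by simp
qed

text \<open>
  On the finite set of rigid elements with optimal infimum and supremum, cycling is injective because
  \<open>\<iota>(y)\<close> can be read off \<open>c(y)\<close>. An injective self-map of a finite set has only periodic points.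
\<close>
lemma rigid_USS:
  assumes x: "x \<in> SSS" and r: "rigid_el x"
  shows "x \<in> USS"
proof -
  have R: "(cyc ^^ k) x \<in> SSS \<and> rigid_el ((cyc ^^ k) x)" for k
    by (induction k) (use x r in \<open>auto intro: cyc_SSS rigid_cyc\<close>)
  have "finite (range (\<lambda>k. (cyc ^^ k) x))"
    by (rule finite_subset[OF _ finite_SSS]) (use R in auto)
  then obtain a b where ab: "a < b" "(cyc ^^ a) x = (cyc ^^ b) x"
    by (metis (mono_tags, lifting) finite_imageD infinite_UNIV_nat injI linorder_neqE_nat)
  have "(cyc ^^ a) x = (cyc ^^ (a + d)) x \<Longrightarrow> x = (cyc ^^ d) x" for a d
  proof (induction a)
    case (Suc a)
    have "(cyc ^^ a) x = (cyc ^^ (a + d)) x"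
      by (rule rigid_cyc_inj) (use R[of a] R[of "a + d"] Suc.prems in auto)
    then show ?case by (rule Suc.IH)
  qed simp
  from this[of a "b - a"] ab have "(cyc ^^ (b - a)) x = x" by simp
  then show ?thesis using x ab(1) by (auto simp: USS_def intro!: exI[of _ "b - a"])
qed

lemma USS_carrier: "y \<in> USS \<Longrightarrow> y \<in> carrier G"
  by (simp add: USS_SSS SSS_carrier)

lemma USS_cyc: "y \<in> USS \<Longrightarrow> cyc y \<in> USS"
proof -
  assume y: "y \<in> USS"
  then obtain m where m: "m > 0" "(cyc ^^ m) y = y" by (auto simp: USS_def)
  have "(cyc ^^ m) (cyc y) = cyc ((cyc ^^ m) y)" by (rule funpow_swap1[symmetric])
  then show ?thesis using m cyc_SSS[OF USS_SSS[OF y]] by (auto simp: USS_def)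
qed

lemma USS_cyc_pow: "y \<in> USS \<Longrightarrow> (cyc ^^ k) y \<in> USS"
  by (induction k) (auto intro: USS_cyc)

lemma USS_cyc_pred: "y \<in> USS \<Longrightarrow> \<exists>z\<in>USS. cyc z = y"
proof -
  assume y: "y \<in> USS"
  then obtain m where m: "m > 0" "(cyc ^^ m) y = y" by (auto simp: USS_def)
  then have "cyc ((cyc ^^ (m - 1)) y) = y" by (cases m) auto
  then show ?thesis using USS_cyc_pow[OF y] by blast
qed

lemma USS_conj_by_Dpow: "y \<in> USS \<Longrightarrow> conj_by y (Dpow k) \<in> USS"
proof -
  assume y: "y \<in> USS"
  note yS = USS_SSS[OF y]
  note yc = SSS_carrier[OF yS]
  obtain m where m: "m > 0" "(cyc ^^ m) y = y" using y by (auto simp: USS_def)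
  have "supremum (conj_by y (Dpow k)) = supremum y"
    using infimum_conj_by_Dpow[of "inv y" k] yc by (simp add: supremum_def conj_by_inv)
  then have "conj_by y (Dpow k) \<in> SSS"
    using yS C_conj_by[of y "Dpow k"] yc by (simp add: SSS_def infimum_conj_by_Dpow)
  then show ?thesis using m yc by (auto simp: USS_def cyc_pow_conj_by_Dpow)
qed

text \<open>
  Cycling is a bijection of the ultra summit set, so an iterate can be cancelled; a multiple of the period
  serves as the inverse iterate.
\<close>
lemma USS_cyc_cancel:
  assumes y: "y \<in> USS" and e: "(cyc ^^ (d + a)) y = (cyc ^^ a) y"
  shows "(cyc ^^ d) y = y"
proof -
  obtain M where M: "M > 0" "(cyc ^^ M) y = y" using y by (auto simp: USS_def)
  have pa: "(cyc ^^ (M * a)) y = y" using M periodic_mult by simp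
  define e where "e = M * a - a"
  have ea: "a + e = M * a" using M by (simp add: e_def)
  have "(cyc ^^ d) y = (cyc ^^ d) ((cyc ^^ (a + e)) y)" by (simp add: ea pa)
  also have "\<dots> = (cyc ^^ (d + a + e)) y" by (simp add: funpow_add)
  also have "\<dots> = (cyc ^^ e) ((cyc ^^ a) y)" using assms(2) by (simp add: funpow_shift[of "d + a"])
  also have "\<dots> = y" by (simp add: ea pa flip: funpow_shift)
  finally show ?thesis .
qed

definition minimal_conj :: "'a \<Rightarrow> 'a \<Rightarrow> bool" where
  "minimal_conj y t \<longleftrightarrow> simple t \<and> t \<noteq> \<one> \<and> conj_by y t \<in> USS \<and>
    (\<forall>u. simple u \<and> u \<noteq> \<one> \<and> u \<preceq> t \<and> u \<noteq> t \<longrightarrow> conj_by y u \<notin> USS)"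

lemma minimal_conj_below:
  "simple t \<Longrightarrow> t \<noteq> \<one> \<Longrightarrow> conj_by y t \<in> USS \<Longrightarrow> \<exists>u. minimal_conj y u \<and> u \<preceq> t"
proof (induction "nat (len t)" arbitrary: t rule: less_induct)
  case less
  show ?case
  proof (cases "minimal_conj y t")
    case True
    then show ?thesis using less.prems simpleD by auto
  next
    case False
    then obtain u where u: "simple u" "u \<noteq> \<one>" "u \<preceq> t" "u \<noteq> t" "conj_by y u \<in> USS"
      using less.prems by (auto simp: minimal_conj_def)
    note c = simpleD[OF u(1)] simpleD[OF less.prems(1)]
    have "len u < len t" using pre_len[OF u(3)] u(4) c by fastforce
    then have "nat (len u) < nat (len t)" using len_nonneg[of u] c by simp
    then obtain v where "minimal_conj y v" "v \<preceq> u" using less.hyps u by blast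
    moreover have "v \<in> carrier G" using \<open>minimal_conj y v\<close> simpleD by (simp add: minimal_conj_def)
    ultimately show ?thesis using pre_trans[OF _ u(3)] c by blast
  qed
qed

end

section \<open>Minimal ultra summit sets\<close>

locale minimal_summit_class = summit_class +
  assumes long: "p + 1 < s"
    and grey_USS: "y \<in> USS \<Longrightarrow> conj_by y (initial (inv y)) \<in> USS"
    and black_unique: "y \<in> USS \<Longrightarrow> minimal_conj y t \<Longrightarrow> t \<preceq> initial y \<Longrightarrow> t = initial y"
    and grey_unique: "y \<in> USS \<Longrightarrow> minimal_conj y t \<Longrightarrow> t \<preceq> initial (inv y) \<Longrightarrow> t = initial (inv y)"
begin

lemma simple_initial: "y \<in> carrier G \<Longrightarrow> simple (initial y)"
  by (simp add: simple_def one_pre_initial initial_pre_D)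

lemma below_black:
  assumes "y \<in> USS" "simple t" "t \<noteq> \<one>" "conj_by y t \<in> USS" "t \<preceq> initial y"
  shows "t = initial y"
proof -
  obtain u where u: "minimal_conj y u" "u \<preceq> t" using minimal_conj_below assms by blast
  have c: "u \<in> carrier G" "t \<in> carrier G" "initial y \<in> carrier G"
    using u assms simpleD USS_carrier by (auto simp: minimal_conj_def)
  have "u = initial y" using black_unique[OF assms(1) u(1)] pre_trans[OF u(2) assms(5)] c by simp
  then show ?thesis using u assms c pre_antisym by blast
qed

lemma below_grey:
  assumes "y \<in> USS" "simple t" "t \<noteq> \<one>" "conj_by y t \<in> USS" "t \<preceq> initial (inv y)"
  shows "t = initial (inv y)"
proof -
  obtain u where u: "minimal_conj y u" "u \<preceq> t" using minimal_conj_below assms by blast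
  have c: "u \<in> carrier G" "t \<in> carrier G" "initial (inv y) \<in> carrier G"
    using u assms simpleD USS_carrier by (auto simp: minimal_conj_def)
  have "u = initial (inv y)" using grey_unique[OF assms(1) u(1)] pre_trans[OF u(2) assms(5)] c by simp
  then show ?thesis using u assms c pre_antisym by blast
qed

lemma simple_glb: "simple a \<Longrightarrow> simple b \<Longrightarrow> simple (glb a b)"
  unfolding simple_def by (auto simp: pre_glb_iff intro: pre_trans[OF glb_pre(1)])

text \<open>
  The meet \<open>r\<close> of \<open>\<iota>(y)\<close> and \<open>\<iota>(y\<^sup>-\<^sup>1)\<close> conjugates \<open>y\<close> into the ultra summit set. If it is not \<open>1\<close>,
  minimality makes it equal to both. Then the first and the last factor of \<open>y\<close> merge to \<open>D\<close> under
  cycling, and since there are at least two factors, the infimum increases.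
\<close>
theorem USS_rigid:
  assumes y: "y \<in> USS"
  shows "rigid_el y"
proof -
  note yc = USS_carrier[OF y] and yp = SSS_infimum[OF USS_SSS[OF y]]
  define r where "r = glb (initial y) (initial (inv y))"
  have "r = \<one>"
  proof (rule ccontr)
    assume ne: "r \<noteq> \<one>"
    have "conj_by y r \<in> USS"
      unfolding r_def using y yc USS_cyc[OF y] grey_USS[OF y] by (intro USS_meet) (auto simp: cyc_def)
    moreover have "simple r" unfolding r_def using yc by (intro simple_glb simple_initial) auto
    ultimately have r: "r = initial y" "r = initial (inv y)"
      using below_black[OF y, of r] below_grey[OF y, of r] ne yc by (auto simp: r_def)
    let ?i = "initial y"
    have i: "?i \<preceq> Dpow 1" "?i \<preceq> y \<otimes> Dpow (- p)" "?i = glb (Dpow 1) (inv y \<otimes> Dpow s)"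
      using initial_pre_D[OF yc] initial_pre[OF yc] r yp by (simp_all add: initial_inv)
    have "?i \<otimes> Dpow p \<otimes> Dpow 1 \<preceq> y \<otimes> Dpow 1" using i(2) yc by (subst pre_Dpow_iff) (simp_all add: pre_Dpow_move)
    moreover have "?i \<otimes> Dpow (p + 1) \<preceq> Dpow 1 \<otimes> Dpow (p + 1)" using i(1) yc by (subst pre_Dpow_iff) auto
    then have "?i \<otimes> Dpow (p + 1) \<preceq> Dpow s"
      using pre_trans[of "?i \<otimes> Dpow (p + 1)" "Dpow (p + 2)" "Dpow s"] yc long by (simp add: Dpow_add add.commute)
    ultimately have "?i \<otimes> Dpow (p + 1) \<preceq> glb (y \<otimes> Dpow 1) (y \<otimes> (inv y \<otimes> Dpow s))"
      using yc by (simp add: pre_glb_iff m_assoc Dpow_add)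
    also have "glb (y \<otimes> Dpow 1) (y \<otimes> (inv y \<otimes> Dpow s)) = y \<otimes> ?i"
      unfolding i(3) using yc by (intro glb_left) auto
    finally have "p + 1 \<le> infimum (cyc y)" using yc by (simp add: cyc_def infimum_conj_by_iff)
    then show False using SSS_infimum(1)[OF USS_SSS[OF USS_cyc[OF y]]] by simp
  qed
  then show ?thesis using yc yp p_less_s by (simp add: rigid_el_def r_def)
qed

text \<open>
  Let \<open>t\<close> be the maximal simple prefix of \<open>g\<close>. If \<open>t\<close> meets \<open>\<iota>(y\<^sup>-\<^sup>1)\<close>, the meet conjugates into the ultra summit
  set and is all of \<open>\<iota>(y\<^sup>-\<^sup>1)\<close> by minimality. Otherwise \<open>y t\<close> has the same initial factor as \<open>y\<close>; as \<open>t\<close> is a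
  prefix of \<open>y t D\<^sup>-\<^sup>p\<close> with \<open>p\<close> the infimum of \<open>y\<close>, it is a prefix of \<open>\<iota>(y)\<close> and by minimality all of it.
\<close>
lemma black_or_grey:
  assumes y: "y \<in> USS" and g: "g \<in> P" "g \<noteq> \<one>" and z: "conj_by y g \<in> USS"
  shows "initial y \<preceq> g \<or> initial (inv y) \<preceq> g"
proof -
  note yc = USS_carrier[OF y] and yp = SSS_infimum[OF USS_SSS[OF y]] and gc = P_carrier[OF g(1)]
  define t where "t = glb (Dpow 1) g"
  have tc: "t \<in> carrier G" using gc by (simp add: t_def)
  have t: "simple t" "t \<noteq> \<one>" "t \<preceq> g"
    using g gc glb_D_nontrivial[OF g(1)] Dpow_pre_iff[of 0 1]
    by (auto simp: t_def simple_def pre_glb_iff P_iff_pre simp del: Dpow_pre_iff)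
  have tU: "conj_by y t \<in> USS" unfolding t_def using y gc z USS_conj_by_Dpow[OF y] by (intro USS_meet) auto
  show ?thesis
  proof (cases "glb t (initial (inv y)) = \<one>")
    case False
    have "conj_by y (glb t (initial (inv y))) \<in> USS" using y tU tc yc grey_USS[OF y] by (intro USS_meet) auto
    moreover have "simple (glb t (initial (inv y)))" using t yc by (intro simple_glb simple_initial) auto
    ultimately have "glb t (initial (inv y)) = initial (inv y)"
      using below_grey[OF y] False tc yc by simp
    then have "initial (inv y) \<preceq> t" using glb_pre(1)[of t "initial (inv y)"] tc yc by simp
    then show ?thesis using pre_trans[OF _ t(3)] tc gc yc by simp
  next
    case True
    then have "glb t (inv y \<otimes> Dpow (supremum y)) = \<one>"
      using glb_initial_inv[OF yc tc] t by (simp add: simple_def)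
    then have e: "glb (Dpow 1) (y \<otimes> t \<otimes> Dpow (- p)) = initial y"
      using initial_extend[OF yc tc] yp p_less_s by simp
    have "t \<otimes> Dpow p \<preceq> y \<otimes> t" using USS_SSS[OF tU] conj_by_SSS_iff[OF SSS_C[OF USS_SSS[OF y]] tc] by simp
    then have "t \<preceq> y \<otimes> t \<otimes> Dpow (- p)" using tc yc by (subst (asm) pre_Dpow_move) auto
    then have "t \<preceq> initial y" using t tc yc unfolding e[symmetric] by (simp add: pre_glb_iff simple_def)
    then have "t = initial y" using below_black[OF y t(1,2) tU] by simp
    then show ?thesis using t by simp
  qed
qed

text \<open>
  Cycling products on both sides avoid negative exponents. A black prefix lengthens the product on the right
  hand side. A grey prefix \<open>\<iota>(y\<^sup>-\<^sup>1) = \<iota>(w)\<^sup>-\<^sup>1 D\<close> with \<open>c(w) = y\<close> cancels the first factor of that product.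
\<close>
theorem conj_by_decomposition:
  assumes "y \<in> USS" "g \<in> P" "conj_by y g \<in> USS"
  shows "\<exists>a b k. g \<otimes> cycling_prod (conj_by y g) b = cycling_prod y a \<otimes> Dpow k"
  using assms
proof (induction "nat (len g)" arbitrary: y g rule: less_induct)
  case less
  note y = less.prems(1) and g = less.prems(2) and zU = less.prems(3)
  note yc = USS_carrier[OF y] and gc = P_carrier[OF g] and yp = SSS_infimum[OF USS_SSS[OF y]]
  have shorter: "\<exists>a b k. h \<otimes> cycling_prod (conj_by y g) b = cycling_prod (conj_by y t) a \<otimes> Dpow k"
    if t: "simple t" "t \<noteq> \<one>" "t \<preceq> g" "conj_by y t \<in> USS" and h: "h = inv t \<otimes> g" for t h
  proof -
    note tc = simpleD[OF t(1)]
    have hP: "h \<in> P" using t(3) h by (simp add: pre_def)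
    have "len h = len g - len t" using tc gc by (simp add: h len_mult len_inv)
    then have "nat (len h) < nat (len g)" using len_pos[OF tc(2) t(2)] len_nonneg[OF hP] by simp
    moreover have "conj_by (conj_by y t) h = conj_by y g" using tc yc gc by (simp add: h flip: conj_by_mult)
    ultimately show ?thesis using less.hyps[of h "conj_by y t"] hP t(4) zU by simp
  qed
  show ?case
  proof (cases "g = \<one>")
    case True
    then show ?thesis by (intro exI[of _ 0]) simp
  next
    case False
    let ?z = "conj_by y g"
    have zc: "?z \<in> carrier G" using yc gc by simp
    consider "initial y \<preceq> g" | "initial (inv y) \<preceq> g" using black_or_grey[OF y g False zU] by blast
    then show ?thesis
    proof cases
      case 1
      define h where "h = inv (initial y) \<otimes> g"
      have hc: "h \<in> carrier G" using yc gc by (simp add: h_def)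
      obtain a b k where e: "h \<otimes> cycling_prod ?z b = cycling_prod (cyc y) a \<otimes> Dpow k"
        using shorter[of "initial y" h] 1 simple_initial[OF yc] initial_ne_one[OF yc] yp p_less_s USS_cyc[OF y]
        by (auto simp: h_def cyc_def)
      have "g \<otimes> cycling_prod ?z b = initial y \<otimes> (h \<otimes> cycling_prod ?z b)" using yc gc zc by (simp add: h_def m_assoc)
      also have "\<dots> = cycling_prod y (Suc a) \<otimes> Dpow k"
        unfolding e cycling_prod_Suc_left[OF yc] using yc by (simp add: m_assoc)
      finally show ?thesis by blast
    next
      case 2
      obtain w where w: "w \<in> USS" "cyc w = y" using USS_cyc_pred[OF y] by blast
      note wc = USS_carrier[OF w(1)]
      have j: "initial (inv y) = inv (initial w) \<otimes> Dpow 1"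
        using rigid_initial_inv_cyc[OF USS_SSS[OF w(1)] USS_rigid[OF w(1)]] w(2) by simp
      have cjw: "conj_by y (inv (initial w)) = w"
        using w(2) wc by (auto simp: cyc_def simp flip: conj_by_mult)
      have cjj: "conj_by y (initial (inv y)) = conj_by w (Dpow 1)"
        using conj_by_mult[of y "inv (initial w)" "Dpow 1"] yc wc by (simp add: j cjw)
      define h where "h = inv (initial (inv y)) \<otimes> g"
      have hc: "h \<in> carrier G" using yc gc by (simp add: h_def)
      have "initial (inv y) \<noteq> \<one>" using initial_ne_one[of "inv y"] yc yp p_less_s by (simp add: infimum_inv supremum_inv)
      then obtain a b k where e: "h \<otimes> cycling_prod ?z b = cycling_prod (conj_by w (Dpow 1)) a \<otimes> Dpow k"
        using shorter[of "initial (inv y)" h] 2 simple_initial[of "inv y"] yc grey_USS[OF y]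
        by (auto simp: h_def cjj)
      have "g \<otimes> cycling_prod ?z b = initial (inv y) \<otimes> (h \<otimes> cycling_prod ?z b)" using yc gc zc by (simp add: h_def m_assoc)
      also have "\<dots> = inv (initial w) \<otimes> cycling_prod w a \<otimes> Dpow (k + 1)"
        unfolding e cycling_prod_conj_by_Dpow[OF wc] j using wc by (simp add: conj_by_def Dpow_simps add.commute)
      finally have E: "g \<otimes> cycling_prod ?z b = inv (initial w) \<otimes> cycling_prod w a \<otimes> Dpow (k + 1)" .
      show ?thesis
      proof (cases a)
        case (Suc a')
        have "g \<otimes> cycling_prod ?z b = cycling_prod y a' \<otimes> Dpow (k + 1)"
          unfolding E Suc cycling_prod_Suc_left[OF wc] using wc yc w(2) by (simp add: m_assoc)
        then show ?thesis by blast
      next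
        case 0
        \<comment> \<open>With nothing to cancel, the product on the left hand side is lengthened instead: after \<open>b\<close> cyclings \<open>?z\<close> has become \<open>w\<close> conjugated by a power of \<open>D\<close>, so its next factor is a twisted \<open>\<iota>(w)\<close>.\<close>
        have "(cyc ^^ b) ?z = conj_by ?z (cycling_prod ?z b)" using zc by (simp add: conj_by_cycling_prod)
        also have "\<dots> = conj_by y (g \<otimes> cycling_prod ?z b)" using yc gc zc by (simp add: conj_by_mult)
        also have "\<dots> = conj_by (conj_by y (inv (initial w))) (Dpow (k + 1))"
          unfolding E 0 using yc wc by (simp add: conj_by_mult)
        finally have "(cyc ^^ b) ?z = conj_by w (Dpow (k + 1))" by (simp add: cjw)
        then have "cycling_prod ?z (Suc b) = cycling_prod ?z b \<otimes> conj_by (initial w) (Dpow (k + 1))" using wc by (simp add: initial_conj_by_Dpow)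
        then have "g \<otimes> cycling_prod ?z (Suc b) = (g \<otimes> cycling_prod ?z b) \<otimes> conj_by (initial w) (Dpow (k + 1))"
          using gc zc wc by (simp add: m_assoc)
        also have "\<dots> = cycling_prod y 0 \<otimes> Dpow (k + 1)"
          unfolding E 0 using wc by (simp add: conj_by_def Dpow_simps)
        finally show ?thesis by blast
      qed
    qed
  qed
qed

end

section \<open>The centralizer of an element with two cycling orbits\<close>

context minimal_summit_class begin

lemma USS_orbit: "y \<in> USS \<Longrightarrow> orbit cyc y = range (\<lambda>k. (cyc ^^ k) y)"
proof -
  assume "y \<in> USS"
  then obtain m where m: "m > 0" "(cyc ^^ m) y = y" by (auto simp: USS_def)
  have "(cyc ^^ k) y \<in> orbit cyc y" for k
  proof -
    have "(cyc ^^ k) y = (cyc ^^ (m + k)) y" using m by (simp add: funpow_shift)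
    then show ?thesis using m(1) by (auto simp: orbit_altdef)
  qed
  then show ?thesis by (auto simp: orbit_altdef)
qed

lemma USS_orbit_eq: "y \<in> USS \<Longrightarrow> orbit cyc ((cyc ^^ b) y) = orbit cyc y"
proof -
  assume y: "y \<in> USS"
  obtain m where m: "m > 0" "(cyc ^^ m) y = y" using y by (auto simp: USS_def)
  have 1: "(cyc ^^ k) y \<in> range (\<lambda>k. (cyc ^^ k) ((cyc ^^ b) y))" for k
  proof -
    define e where "e = m * b - b"
    have e: "b + e = m * b" using m(1) by (simp add: e_def)
    have "(cyc ^^ k) y = (cyc ^^ (m * b + k)) y" using periodic_mult[OF m(2), of b] by (simp add: funpow_shift)
    also have "\<dots> = (cyc ^^ (e + k)) ((cyc ^^ b) y)" by (simp add: e[symmetric] add.assoc flip: funpow_shift)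
    finally show ?thesis by blast
  qed
  have 2: "(cyc ^^ k) ((cyc ^^ b) y) \<in> range (\<lambda>k. (cyc ^^ k) y)" for k
    by (simp flip: funpow_shift)
  show ?thesis
    unfolding USS_orbit[OF y] USS_orbit[OF USS_cyc_pow[OF y]] by (intro equalityI image_subsetI 1 2)
qed

lemma cycling_prod_periodic_mult:
  assumes y: "y \<in> carrier G" and t: "(cyc ^^ t) y = y"
  shows "cycling_prod y (t * q + b) = cycling_prod y t [^] q \<otimes> cycling_prod y b"
proof -
  have "cycling_prod y (t * q) = cycling_prod y t [^] q"
  proof (induction q)
    case (Suc q)
    then show ?case using y periodic_mult[OF t, of q] cycling_prod_add[of y "t * q" t] by (simp add: add.commute)
  qed simp
  then show ?thesis using y periodic_mult[OF t, of q] by (simp add: cycling_prod_add)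
qed

lemma positive_shift: "g \<in> carrier G \<Longrightarrow> \<exists>k. Dpow (2 * k) \<otimes> g \<in> P"
proof -
  assume g: "g \<in> carrier G"
  obtain i where i: "Dpow i \<preceq> g" using Dpow_lower_bound g by blast
  have "Dpow (2 * (- \<bar>i\<bar>)) \<preceq> g" using pre_trans[OF _ i, of "Dpow (2 * (- \<bar>i\<bar>))"] g by simp
  then have "Dpow (2 * \<bar>i\<bar>) \<otimes> g \<in> P" by (simp add: pre_def inv_Dpow)
  then show ?thesis by blast
qed

context
  fixes x :: 'a
  assumes x: "x \<in> USS" and conj: "y \<in> C \<Longrightarrow> \<exists>g\<in>carrier G. y = conj_by x g"
begin

lemma conj_positive: 
  assumes "y \<in> C"
  shows "\<exists>g\<in>P. y = conj_by x g"
proof -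
  obtain g where g: "g \<in> carrier G" "y = conj_by x g" using conj assms by blast
  obtain k where k: "Dpow (2 * k) \<otimes> g \<in> P" using positive_shift[OF g(1)] by blast
  have "conj_by x (Dpow (2 * k) \<otimes> g) = y"
    using g USS_carrier[OF x] by (simp add: conj_by_mult conj_by_Dpow_even)
  then show ?thesis using k by blast
qed

lemma decomposition_cyc:
  assumes g: "g \<in> P" and y: "conj_by x g \<in> USS" and e: "g \<otimes> cycling_prod (conj_by x g) b = cycling_prod x a \<otimes> Dpow k"
  shows "(cyc ^^ b) (conj_by x g) = (cyc ^^ a) (conj_by x (Dpow k))"
proof -
  note xc = USS_carrier[OF x] and gc = P_carrier[OF g]
  have "(cyc ^^ b) (conj_by x g) = conj_by x (g \<otimes> cycling_prod (conj_by x g) b)" using xc gc by (simp add: conj_by_mult conj_by_cycling_prod)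
  also have "\<dots> = conj_by ((cyc ^^ a) x) (Dpow k)" unfolding e using xc by (simp add: conj_by_mult conj_by_cycling_prod)
  finally show ?thesis using xc by (simp add: cyc_pow_conj_by_Dpow)
qed

text \<open>
  If \<open>D\<close> conjugates \<open>x\<close> into its own cycling orbit, so does every power of \<open>D\<close>. Then the decomposition of
  positive conjugators puts the whole ultra summit set into this orbit.
\<close>
lemma twist_not_in_orbit:
  assumes two: "card (orbit cyc ` USS) = 2"
  shows "conj_by x (Dpow 1) \<noteq> (cyc ^^ m) x"
proof
  assume tw: "conj_by x (Dpow 1) = (cyc ^^ m) x"
  have "orbit cyc y = orbit cyc x" if y: "y \<in> USS" for y
  proof -
    obtain g where g: "g \<in> P" "y = conj_by x g" using conj_positive[of y] SSS_C[OF USS_SSS[OF y]] by blast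
    obtain a b k where "g \<otimes> cycling_prod (conj_by x g) b = cycling_prod x a \<otimes> Dpow k"
      using conj_by_decomposition[OF x g(1)] y g(2) by blast
    then have e: "(cyc ^^ b) y = (cyc ^^ a) (conj_by x (Dpow k))"
      using decomposition_cyc g y by blast
    obtain c where "conj_by x (Dpow k) = (cyc ^^ c) x"
    proof (cases "even k")
      case True
      then show ?thesis using that[of 0] conj_by_Dpow_even[OF USS_carrier[OF x]] by (auto elim!: evenE)
    next
      case False
      then show ?thesis using that[of m] tw conj_by_Dpow_odd[OF USS_carrier[OF x] False] by simp
    qed
    then have "(cyc ^^ b) y = (cyc ^^ (c + a)) x" using e by (simp add: funpow_shift)
    then show ?thesis using USS_orbit_eq[OF y, of b] USS_orbit_eq[OF x, of "c + a"] by simp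
  qed
  then have "orbit cyc ` USS = {orbit cyc x}" using x by blast
  then show False using two by simp
qed

text \<open>
  The decomposition of a positive element of the centralizer compares two points of one orbit. With two
  orbits the exponent of \<open>D\<close> is even, so these points are iterates of \<open>x\<close> under cycling, and they agree
  exactly when the numbers of cyclings differ by a multiple of the period \<open>t\<close>.
\<close>
theorem centralizer_form:
  assumes two: "card (orbit cyc ` USS) = 2"
    and g: "g \<in> carrier G" "g \<otimes> x = x \<otimes> g"
    and t: "0 < t" "(cyc ^^ t) x = x" "\<And>d. 0 < d \<Longrightarrow> d < t \<Longrightarrow> (cyc ^^ d) x \<noteq> x"
  shows "\<exists>(q::int) (j::int). g = cycling_prod x t [^] q \<otimes> Dpow (2 * j)"
proof -
  note xc = USS_carrier[OF x]
  let ?c = "cycling_prod x t"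
  obtain K where K: "Dpow (2 * K) \<otimes> g \<in> P" using positive_shift[OF g(1)] by blast
  define h where "h = Dpow (2 * K) \<otimes> g"
  have h: "h \<in> P" "h \<in> carrier G" using K P_carrier by (simp_all add: h_def)
  have hx: "conj_by x h = x"
    using g xc conj_by_eq_iff[of x x g] by (simp add: h_def conj_by_mult conj_by_Dpow_even)
  obtain a b k where e: "h \<otimes> cycling_prod x b = cycling_prod x a \<otimes> Dpow k"
    using conj_by_decomposition[OF x h(1)] hx x by auto
  have ab: "(cyc ^^ b) x = (cyc ^^ a) (conj_by x (Dpow k))"
    using decomposition_cyc[OF h(1), of b a k] hx x e by simp
  have "even k"
  proof (rule ccontr)
    assume "odd k"
    then have tw: "conj_by x (Dpow k) = conj_by x (Dpow 1)" using xc by (rule conj_by_Dpow_odd[rotated])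
    \<comment> \<open>After \<open>a\<close> cyclings, \<open>r\<close> more complete a multiple of the period.\<close>
    define r where "r = t * a - a"
    have r: "a + r = t * a" using t(1) by (simp add: r_def)
    have "(cyc ^^ (t * a)) (conj_by x (Dpow 1)) = conj_by x (Dpow 1)"
      using xc periodic_mult[OF t(2), of a] by (simp add: cyc_pow_conj_by_Dpow)
    then have "conj_by x (Dpow 1) = (cyc ^^ r) ((cyc ^^ a) (conj_by x (Dpow 1)))" by (simp flip: funpow_shift add: r)
    also have "\<dots> = (cyc ^^ (b + r)) x" using ab tw by (simp add: funpow_shift)
    finally show False using twist_not_in_orbit[OF two] by blast
  qed
  then obtain j where j: "k = 2 * j" by (elim evenE)
  have eq: "(cyc ^^ b) x = (cyc ^^ a) x" using ab xc by (simp add: j conj_by_Dpow_even)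
  have t_dvd: "t dvd d" if d: "(cyc ^^ d) x = x" for d
  proof -
    have "(cyc ^^ (d mod t)) x = x" using d t(2) by (simp add: funpow_mod_eq)
    then have "d mod t = 0" using t(3)[of "d mod t"] t(1) by (cases "d mod t = 0") auto
    then show ?thesis by (rule mod_0_imp_dvd)
  qed
  have cc: "?c \<in> carrier G" using xc by simp
  have "\<exists>q::int. h = ?c [^] q \<otimes> Dpow k"
  proof (cases "b \<le> a")
    case True
    then have "t dvd a - b" using USS_cyc_cancel[OF x, of "a - b" b] eq by (intro t_dvd) simp
    then obtain q where q: "a = t * q + b" using True by (auto elim!: dvdE) (metis le_add_diff_inverse2)
    have "h \<otimes> cycling_prod x b = ?c [^] q \<otimes> cycling_prod x b \<otimes> Dpow k"
      using e cycling_prod_periodic_mult[OF xc t(2), of q b] by (simp add: q)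
    also have "\<dots> = ?c [^] q \<otimes> Dpow k \<otimes> cycling_prod x b" using xc by (simp add: m_assoc j Dpow_even_central)
    finally have "h = ?c [^] q \<otimes> Dpow k" using xc h by simp
    then have "h = ?c [^] int q \<otimes> Dpow k" by (simp add: int_pow_int)
    then show ?thesis by blast
  next
    case False
    then have "t dvd b - a" using USS_cyc_cancel[OF x, of "b - a" a] eq by (intro t_dvd) simp
    then obtain q where q: "b = t * q + a" using False by (auto elim!: dvdE) (metis le_add_diff_inverse2 nat_le_linear)
    have "h \<otimes> ?c [^] q \<otimes> cycling_prod x a = Dpow k \<otimes> cycling_prod x a"
      using e cycling_prod_periodic_mult[OF xc t(2), of q a] xc h by (simp add: q m_assoc j Dpow_even_central)
    then have "h \<otimes> ?c [^] q = Dpow k" using xc h by simp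
    then have "h = Dpow k \<otimes> inv (?c [^] q)" using xc h by (simp add: inv_solve_right)
    also have "\<dots> = ?c [^] (- int q) \<otimes> Dpow k" using xc by (simp add: int_pow_neg_int j Dpow_even_central)
    finally show ?thesis by blast
  qed
  then obtain q :: int where q: "h = ?c [^] q \<otimes> Dpow k" by blast
  have "g = Dpow (2 * (- K)) \<otimes> h" using g by (simp add: h_def Dpow_add_left)
  also have "\<dots> = (?c [^] q \<otimes> Dpow (2 * (- K))) \<otimes> Dpow k"
    unfolding q using cc Dpow_even_central[of "?c [^] q" "- K"] by (simp flip: m_assoc)
  also have "\<dots> = ?c [^] q \<otimes> Dpow (2 * (j - K))"
    using cc by (simp add: m_assoc Dpow_add j algebra_simps)
  finally show ?thesis by (intro exI)
qed

end

end

section \<open>Braid groups are Garside groups\<close>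

definition braid_of_word :: "nat \<Rightarrow> braid_word \<Rightarrow> braid" where
  "braid_of_word n w = braid_rel n `` {w}"

text \<open>
  For letters in \<open>{1..<n}\<close> the chosen word does not matter (\<open>braid_of_eq\<close>), and on these classes the map is
  an injective homomorphism by \<open>positive_words_embed\<close>.
\<close>
definition braid_of :: "nat \<Rightarrow> pbraid \<Rightarrow> braid" where
  "braid_of n a = braid_of_word n (pos_word (SOME w. word w = a))"

definition exponent_sum :: "braid_word \<Rightarrow> int" where
  "exponent_sum w = (\<Sum>(i, b)\<leftarrow>w. if b then 1 else - 1)"

definition braid_exponent :: "nat \<Rightarrow> braid \<Rightarrow> int" where
  "braid_exponent n a = exponent_sum (SOME w. w \<in> a)"

lemma exponent_sum_cong: "braid_cong n u v \<Longrightarrow> exponent_sum u = exponent_sum v"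
  by (induction rule: braid_cong.induct) (auto simp: exponent_sum_def)

context
  fixes n :: nat
begin

abbreviation (input) B where "B \<equiv> braid_group n"

abbreviation (input) braid_times (infixl "\<cdot>" 70) where "a \<cdot> b \<equiv> a \<otimes>\<^bsub>B\<^esub> b"

interpretation B: group B by (rule braid_group_is_group)

abbreviation (input) "positive_letters \<equiv> {a. letters a \<subseteq> {1..<n}}"

lemma braid_of_word_eq_iff:
  "u \<in> braid_words n \<Longrightarrow> v \<in> braid_words n \<Longrightarrow> braid_of_word n u = braid_of_word n v \<longleftrightarrow> braid_cong n u v"
  unfolding braid_of_word_def
  by (subst eq_equiv_class_iff[OF equiv_braid_rel]) (auto simp: braid_rel_def)

lemma carrier_braid_group: "carrier B = braid_of_word n ` braid_words n"
  by (auto simp: braid_group_def quotient_def braid_of_word_def)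

lemma braid_of_word_carrier: "w \<in> braid_words n \<Longrightarrow> braid_of_word n w \<in> carrier B"
  by (simp add: carrier_braid_group)

lemma braid_of_word_append:
  "u \<in> braid_words n \<Longrightarrow> v \<in> braid_words n \<Longrightarrow>
    braid_of_word n u \<cdot> braid_of_word n v = braid_of_word n (u @ v)"
  by (simp add: braid_of_word_def braid_mult_class)

lemma braid_of_word_Nil: "braid_of_word n [] = \<one>\<^bsub>B\<^esub>"
  by (simp add: braid_of_word_def braid_group_def)

lemma braid_exponent_word: "w \<in> braid_words n \<Longrightarrow> braid_exponent n (braid_of_word n w) = exponent_sum w"
proof -
  assume w: "w \<in> braid_words n"
  have "w \<in> braid_of_word n w" using w by (auto simp: braid_of_word_def braid_rel_def intro: braid_cong.refl)
  then have "(SOME v. v \<in> braid_of_word n w) \<in> braid_of_word n w" by (rule someI)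
  then have "braid_cong n w (SOME v. v \<in> braid_of_word n w)" by (simp add: braid_of_word_def braid_rel_def)
  then show ?thesis by (simp add: braid_exponent_def exponent_sum_cong)
qed

lemma braid_of_eq:
  assumes "set w \<subseteq> {1..<n}"
  shows "braid_of n (word w) = braid_of_word n (pos_word w)"
proof -
  define v where "v = (SOME v. word v = word w)"
  have v: "word v = word w" unfolding v_def by (rule someI[of _ w]) simp
  then have "letters (word v) = letters (word w)" by simp
  then have "set v \<subseteq> {1..<n}" using assms by simp
  then have "braid_cong n (pos_word v) (pos_word w)" using v by (intro word_eq_braid_cong)
  then show ?thesis using assms \<open>set v \<subseteq> _\<close> by (simp add: braid_of_def braid_of_word_eq_iff flip: v_def)
qed

lemma positive_word: "a \<in> positive_letters \<Longrightarrow> \<exists>w. set w \<subseteq> {1..<n} \<and> a = word w"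
  by (metis (mono_tags, lifting) letters_word mem_Collect_eq word_surj)

lemma braid_of_carrier: "a \<in> positive_letters \<Longrightarrow> braid_of n a \<in> carrier B"
  using positive_word braid_of_eq braid_of_word_carrier by (metis pos_word_in_braid_words)

lemma braid_of_mult:
  assumes "a \<in> positive_letters" "b \<in> positive_letters"
  shows "braid_of n a \<cdot> braid_of n b = braid_of n (a * b)"
proof -
  obtain u v where u: "set u \<subseteq> {1..<n}" "a = word u" and v: "set v \<subseteq> {1..<n}" "b = word v"
    using positive_word assms by meson
  have "braid_of n (word (u @ v)) = braid_of_word n (pos_word (u @ v))" using u v by (intro braid_of_eq) simp
  then show ?thesis using u v by (simp add: braid_of_eq braid_of_word_append)
qed

lemma braid_of_one: "braid_of n 1 = \<one>\<^bsub>B\<^esub>"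
  using braid_of_eq[of "[]"] by (simp add: braid_of_word_Nil)

lemma braid_of_inj: "a \<in> positive_letters \<Longrightarrow> b \<in> positive_letters \<Longrightarrow> braid_of n a = braid_of n b \<longleftrightarrow> a = b"
proof
  assume ab: "a \<in> positive_letters" "b \<in> positive_letters" "braid_of n a = braid_of n b"
  obtain u v where u: "set u \<subseteq> {1..<n}" "a = word u" and v: "set v \<subseteq> {1..<n}" "b = word v"
    using positive_word ab by meson
  have "braid_cong n (pos_word u) (pos_word v)"
    using ab(3) u v by (simp add: braid_of_eq braid_of_word_eq_iff)
  then show "a = b" using u v by (simp add: positive_words_embed)
qed simp

lemma braid_gen_eq: "i \<in> {1..<n} \<Longrightarrow> braid_gen n i = braid_of n (gen i)"
  using braid_of_eq[of "[i]"] by (simp add: braid_gen_def braid_of_word_def)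

lemma braid_prod_gens: "set w \<subseteq> {1..<n} \<Longrightarrow> braid_prod n (map (braid_gen n) w) = braid_of n (word w)"
  by (induction w) (auto simp: braid_prod_def braid_of_one braid_gen_eq braid_of_mult)

lemma braid_pos_eq: "braid_pos n = braid_of n ` positive_letters"
proof -
  have "braid_pos n = {braid_of n (word w) | w. set w \<subseteq> {1..<n}}"
    unfolding braid_pos_def using braid_prod_gens by blast
  also have "\<dots> = braid_of n ` positive_letters"
    using positive_word by auto
  finally show ?thesis .
qed

lemma delta_positive: "delta n \<in> positive_letters"
  using letters_delta by simp

lemma braid_Delta_eq: "braid_Delta n = braid_of n (delta n)"
  unfolding braid_Delta_def delta_word
  using letters_delta[of n] by (intro braid_prod_gens) (simp add: delta_word)

lemma braid_exponent_of: "a \<in> positive_letters \<Longrightarrow> braid_exponent n (braid_of n a) = int (len a)"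
proof -
  assume "a \<in> positive_letters"
  then obtain w where w: "set w \<subseteq> {1..<n}" "a = word w" using positive_word by blast
  have "exponent_sum (pos_word w) = int (length w)" by (induction w) (simp_all add: exponent_sum_def)
  then show ?thesis using w by (simp add: braid_of_eq braid_exponent_word)
qed

lemma Delta_carrier: "braid_Delta n \<in> carrier B"
  using braid_of_carrier delta_positive by (simp add: braid_Delta_eq)

lemma braid_of_word_letter:
  assumes i: "i \<in> {1..<n}"
  shows "braid_of_word n [(i, b)] = (if b then braid_of n (gen i) else inv\<^bsub>B\<^esub> braid_of n (gen i))"
proof -
  have T: "braid_of_word n [(i, True)] = braid_of n (gen i)"
    using braid_of_eq[of "[i]"] i by simp
  have w: "[(i, b)] \<in> braid_words n" for b using i by (simp add: braid_words_def)
  have "braid_of_word n [(i, False)] \<cdot> braid_of_word n [(i, True)] = \<one>\<^bsub>B\<^esub>"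
    using w[of True] w[of False] braid_cong.cancel[OF i, of False]
    by (simp add: braid_of_word_append braid_of_word_eq_iff braid_words_def flip: braid_of_word_Nil)
  then have "inv\<^bsub>B\<^esub> braid_of_word n [(i, True)] = braid_of_word n [(i, False)]"
    using w braid_of_word_carrier by (intro B.inv_equality) auto
  with T show ?thesis by simp
qed

lemma Delta_square_central:
  assumes "a \<in> carrier B"
  shows "braid_Delta n \<cdot> braid_Delta n \<cdot> a = a \<cdot> (braid_Delta n \<cdot> braid_Delta n)"
proof -
  let ?Z = "braid_Delta n \<cdot> braid_Delta n"
  have Z: "?Z \<in> carrier B" using Delta_carrier by simp
  have gen: "?Z \<cdot> braid_of n (gen i) = braid_of n (gen i) \<cdot> ?Z" if i: "i \<in> {1..<n}" for i
  proof -
    have "delta n * delta n * gen i = delta n * (gen (n - i) * delta n)"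
      using gen_delta[of "n - i" n] i by (auto simp: mult.assoc)
    also have "\<dots> = gen i * (delta n * delta n)"
      using gen_delta[of i n] i by (simp flip: mult.assoc)
    finally show ?thesis using i delta_positive by (simp add: braid_Delta_eq braid_of_mult)
  qed
  have letter: "?Z \<cdot> braid_of_word n [(i, b)] = braid_of_word n [(i, b)] \<cdot> ?Z" if i: "i \<in> {1..<n}" for i b
  proof -
    let ?g = "braid_of n (gen i)"
    have g: "?g \<in> carrier B" using i by (intro braid_of_carrier) simp
    have "?Z \<cdot> inv\<^bsub>B\<^esub> ?g = inv\<^bsub>B\<^esub> ?g \<cdot> (?g \<cdot> ?Z) \<cdot> inv\<^bsub>B\<^esub> ?g"
      using g Z by (simp flip: B.m_assoc)
    also have "\<dots> = inv\<^bsub>B\<^esub> ?g \<cdot> ?Z"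
      unfolding gen[OF i, symmetric] using g Z by (simp add: B.m_assoc)
    finally show ?thesis using gen[OF i] i by (simp add: braid_of_word_letter)
  qed
  have "w \<in> braid_words n \<Longrightarrow> ?Z \<cdot> braid_of_word n w = braid_of_word n w \<cdot> ?Z" for w
  proof (induction w)
    case Nil
    then show ?case using Z by (simp add: braid_of_word_Nil)
  next
    case (Cons x w)
    obtain i b where x: "x = (i, b)" by (cases x)
    have i: "i \<in> {1..<n}" and w: "w \<in> braid_words n" and l: "[(i, b)] \<in> braid_words n"
      using Cons.prems x by (auto simp: braid_words_def)
    have e: "braid_of_word n (x # w) = braid_of_word n [(i, b)] \<cdot> braid_of_word n w"
      using braid_of_word_append[OF l w] x by simp
    let ?l = "braid_of_word n [(i, b)]" and ?w = "braid_of_word n w"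
    have c: "?l \<in> carrier B" "?w \<in> carrier B" using l w by (simp_all add: braid_of_word_carrier)
    have "?Z \<cdot> (?l \<cdot> ?w) = ?l \<cdot> (?Z \<cdot> ?w)"
      using letter[OF i, of b] Z c by (metis B.m_assoc)
    also have "\<dots> = ?l \<cdot> ?w \<cdot> ?Z" using Cons.IH[OF w] Z c by (simp only: B.m_assoc)
    finally show ?case by (simp only: e)
  qed
  then show ?thesis using assms by (auto simp: carrier_braid_group)
qed

lemma Delta_flip:
  assumes "a \<in> braid_pos n"
  shows "\<exists>b\<in>braid_pos n. a \<cdot> braid_Delta n = braid_Delta n \<cdot> b"
proof -
  obtain m where m: "m \<in> positive_letters" "a = braid_of n m" using assms by (auto simp: braid_pos_eq)
  obtain m' where m': "m * delta n = delta n * m'" using delta_flip[of m n] m by auto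
  have "letters (delta n * m') \<subseteq> {1..<n}" unfolding m'[symmetric] using m letters_delta by simp
  then have "m' \<in> positive_letters" by simp
  then show ?thesis
    using m m' delta_positive by (auto simp: braid_pos_eq braid_Delta_eq braid_of_mult)
qed

lemma braid_pos_carrier: "a \<in> braid_pos n \<Longrightarrow> a \<in> carrier B"
  using braid_of_carrier by (auto simp: braid_pos_eq)

lemma braid_pos_mult: "a \<in> braid_pos n \<Longrightarrow> b \<in> braid_pos n \<Longrightarrow> a \<cdot> b \<in> braid_pos n"
  by (auto simp: braid_pos_eq braid_of_mult)

lemma Delta_conj: "a \<in> braid_pos n \<Longrightarrow> inv\<^bsub>B\<^esub> braid_Delta n \<cdot> a \<cdot> braid_Delta n \<in> braid_pos n"
proof -
  assume a: "a \<in> braid_pos n"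
  obtain b where b: "b \<in> braid_pos n" "a \<cdot> braid_Delta n = braid_Delta n \<cdot> b"
    using Delta_flip[OF a] by blast
  have "inv\<^bsub>B\<^esub> braid_Delta n \<cdot> (a \<cdot> braid_Delta n) = b"
    unfolding b(2) using braid_pos_carrier[OF b(1)] Delta_carrier by (simp flip: B.m_assoc)
  then show ?thesis using b(1) braid_pos_carrier[OF a] Delta_carrier by (simp add: B.m_assoc)
qed

lemma Delta_conj_inv: "a \<in> braid_pos n \<Longrightarrow> braid_Delta n \<cdot> a \<cdot> inv\<^bsub>B\<^esub> braid_Delta n \<in> braid_pos n"
proof -
  assume a: "a \<in> braid_pos n"
  let ?D = "braid_Delta n"
  have c: "a \<in> carrier B" "?D \<in> carrier B" using a braid_pos_carrier Delta_carrier by auto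
  have "?D \<cdot> a \<cdot> inv\<^bsub>B\<^esub> ?D = inv\<^bsub>B\<^esub> ?D \<cdot> (?D \<cdot> ?D \<cdot> a) \<cdot> inv\<^bsub>B\<^esub> ?D"
    using c by (simp flip: B.m_assoc)
  also have "\<dots> = inv\<^bsub>B\<^esub> ?D \<cdot> a \<cdot> ?D"
    unfolding Delta_square_central[OF c(1)] using c by (simp add: B.m_assoc)
  finally show ?thesis using Delta_conj[OF a] by simp
qed

text \<open>
  Each inverse letter costs one factor \<open>\<Delta>\<close>: for \<open>q\<close> positive, \<open>\<Delta> q \<sigma>\<^sub>i\<^sup>-\<^sup>1\<close> is the product of the positive
  elements \<open>\<Delta> q \<Delta>\<^sup>-\<^sup>1\<close> and \<open>\<Delta> \<sigma>\<^sub>i\<^sup>-\<^sup>1\<close>.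
\<close>
lemma Delta_bound:
  assumes "a \<in> carrier B"
  shows "\<exists>k::nat. braid_Delta n [^]\<^bsub>B\<^esub> k \<cdot> a \<in> braid_pos n"
proof -
  let ?D = "braid_Delta n"
  note D = Delta_carrier
  have "w \<in> braid_words n \<Longrightarrow> \<exists>k::nat. ?D [^]\<^bsub>B\<^esub> k \<cdot> braid_of_word n w \<in> braid_pos n" for w
  proof (induction w rule: rev_induct)
    case Nil
    have "\<one>\<^bsub>B\<^esub> \<in> braid_pos n" using braid_of_one by (force simp: braid_pos_eq)
    then show ?case by (intro exI[of _ 0]) (simp add: braid_of_word_Nil)
  next
    case (snoc x w)
    obtain i b where x: "x = (i, b)" by (cases x)
    have i: "i \<in> {1..<n}" and w: "w \<in> braid_words n" and l: "[(i, b)] \<in> braid_words n"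
      using snoc.prems x by (auto simp: braid_words_def)
    obtain k :: nat where k: "?D [^]\<^bsub>B\<^esub> k \<cdot> braid_of_word n w \<in> braid_pos n"
      using snoc.IH[OF w] by blast
    define q where "q = ?D [^]\<^bsub>B\<^esub> k \<cdot> braid_of_word n w"
    have wc: "braid_of_word n w \<in> carrier B" using w by (rule braid_of_word_carrier)
    have q: "q \<in> braid_pos n" "q \<in> carrier B" using k braid_pos_carrier by (auto simp: q_def)
    let ?g = "braid_of n (gen i)"
    have g: "?g \<in> braid_pos n" "?g \<in> carrier B" using i braid_of_carrier by (auto simp: braid_pos_eq)
    have e: "braid_of_word n (w @ [x]) = braid_of_word n w \<cdot> braid_of_word n [(i, b)]"
      using braid_of_word_append[OF w l] x by simp
    show ?case
    proof (cases b)
      case True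
      have "?D [^]\<^bsub>B\<^esub> k \<cdot> braid_of_word n (w @ [x]) = q \<cdot> ?g"
        unfolding e q_def using True wc g D by (simp add: braid_of_word_letter[OF i] B.m_assoc)
      then show ?thesis using braid_pos_mult[OF q(1) g(1)] by metis
    next
      case False
      define r where "r = braid_of n (cofactor n i)"
      have "letters (cofactor n i * gen i) \<subseteq> {1..<n}" using cofactor_gen[OF i] letters_delta by simp
      then have rp: "cofactor n i \<in> positive_letters" by simp
      then have r: "r \<in> braid_pos n" "r \<in> carrier B" using braid_of_carrier by (auto simp: braid_pos_eq r_def)
      have D_rg: "?D = r \<cdot> ?g"
        using cofactor_gen[OF i] rp i by (simp add: r_def braid_of_mult braid_Delta_eq)
      have rg: "?D \<cdot> inv\<^bsub>B\<^esub> ?g = r" unfolding D_rg using r g by (simp add: B.m_assoc)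
      have "?D [^]\<^bsub>B\<^esub> Suc k \<cdot> braid_of_word n (w @ [x]) = ?D \<cdot> q \<cdot> inv\<^bsub>B\<^esub> ?g"
        unfolding e q_def B.nat_pow_Suc2[OF D] using False wc g D
        by (simp add: braid_of_word_letter[OF i] B.m_assoc)
      also have "\<dots> = (?D \<cdot> q \<cdot> inv\<^bsub>B\<^esub> ?D) \<cdot> (?D \<cdot> inv\<^bsub>B\<^esub> ?g)"
      proof -
        have "inv\<^bsub>B\<^esub> ?D \<cdot> (?D \<cdot> inv\<^bsub>B\<^esub> ?g) = inv\<^bsub>B\<^esub> ?g" using g D by (simp flip: B.m_assoc)
        then show ?thesis using q g D by (simp add: B.m_assoc)
      qed
      finally have "?D [^]\<^bsub>B\<^esub> Suc k \<cdot> braid_of_word n (w @ [x]) \<in> braid_pos n"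
        using braid_pos_mult[OF Delta_conj_inv[OF q(1)] r(1)] rg by simp
      then show ?thesis by blast
    qed
  qed
  then show ?thesis using assms by (auto simp: carrier_braid_group)
qed

lemma braid_exponent_mult:
  assumes "a \<in> carrier B" "b \<in> carrier B"
  shows "braid_exponent n (a \<cdot> b) = braid_exponent n a + braid_exponent n b"
proof -
  obtain u v where u: "u \<in> braid_words n" "a = braid_of_word n u" and v: "v \<in> braid_words n" "b = braid_of_word n v"
    using assms by (auto simp: carrier_braid_group)
  have "u @ v \<in> braid_words n" using u v by (simp add: braid_words_def)
  then show ?thesis using u v by (simp add: braid_of_word_append braid_exponent_word exponent_sum_def)
qed

lemma finite_braid_pos: "finite {a \<in> braid_pos n. braid_exponent n a \<le> m}"
proof (rule finite_subset)
  show "finite ((\<lambda>w. braid_of n (word w)) ` {w. set w \<subseteq> {1..<n} \<and> length w \<le> nat m})"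
    by (intro finite_imageI finite_lists_length_le) simp
  show "{a \<in> braid_pos n. braid_exponent n a \<le> m} \<subseteq>
      (\<lambda>w. braid_of n (word w)) ` {w. set w \<subseteq> {1..<n} \<and> length w \<le> nat m}"
  proof
    fix a assume a: "a \<in> {a \<in> braid_pos n. braid_exponent n a \<le> m}"
    then obtain p where p: "p \<in> positive_letters" "a = braid_of n p" by (auto simp: braid_pos_eq)
    obtain w where w: "set w \<subseteq> {1..<n}" "p = word w" using positive_word[OF p(1)] by blast
    have "int (length w) \<le> m" using a p w braid_exponent_of[OF p(1)] by simp
    then show "a \<in> (\<lambda>w. braid_of n (word w)) ` {w. set w \<subseteq> {1..<n} \<and> length w \<le> nat m}"
      using p w by auto
  qed
qed

end

lemma quasi_garside_braids:
  assumes n: "2 \<le> n"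
  shows "quasi_garside (braid_group n) (braid_pos n) (braid_Delta n) (braid_exponent n)"
proof -
  interpret group "braid_group n" by (rule braid_group_is_group)
  show ?thesis
  proof
    show "\<one>\<^bsub>braid_group n\<^esub> \<in> braid_pos n" using braid_of_one by (force simp: braid_pos_eq)
    show "0 < braid_exponent n a" if a: "a \<in> braid_pos n" "a \<noteq> \<one>\<^bsub>braid_group n\<^esub>" for a
    proof -
      obtain p where p: "letters p \<subseteq> {1..<n}" "a = braid_of n p" using a by (auto simp: braid_pos_eq)
      obtain w where w: "p = word w" by (rule word_surj)
      have "w \<noteq> []" using a(2) p w by (auto simp: braid_of_one)
      then show ?thesis using p w braid_exponent_of[of p n] by simp
    qed
    show D: "braid_Delta n \<in> braid_pos n" using delta_positive[of n] by (auto simp: braid_pos_eq braid_Delta_eq)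
    show "braid_Delta n \<noteq> \<one>\<^bsub>braid_group n\<^esub>"
    proof
      assume "braid_Delta n = \<one>\<^bsub>braid_group n\<^esub>"
      then have "delta n = 1"
        using braid_of_inj[of "delta n" n 1] delta_positive[of n] by (simp add: braid_Delta_eq braid_of_one)
      moreover obtain r where "delta n = gen 1 * r" using gen_dvd_delta[of 1 n] n by auto
      ultimately have "len (gen 1 * r) = 0" by simp
      then show False by simp
    qed
  qed (simp_all add: braid_pos_carrier braid_pos_mult braid_exponent_mult finite_braid_pos
      Delta_conj Delta_square_central Delta_bound)
qed

text \<open>
  The least upper bound of two generators is their least common multiple in the positive monoid. That it is a
  prefix of every common upper bound is Garside's lemma.
\<close>
theorem garside_braids:
  assumes n: "2 \<le> n"
  shows "garside_group (braid_group n) (braid_pos n) (braid_Delta n) (braid_exponent n)"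
proof -
  interpret quasi_garside "braid_group n" "braid_pos n" "braid_Delta n" "braid_exponent n"
    using n by (rule quasi_garside_braids)
  let ?le = "quasi_garside.pre (braid_group n) (braid_pos n)"
  let ?lub = "quasi_garside.is_lub (braid_group n) (braid_pos n)"
  let ?A = "(\<lambda>i. braid_of n (gen i)) ` {1..<n}"
  let ?M = "{a. letters a \<subseteq> {1..<n}}"
  have pre: "?le (braid_of n a) d \<longleftrightarrow> (\<exists>c\<in>?M. d = braid_of n (a * c))"
    if a: "a \<in> ?M" and d: "d \<in> carrier (braid_group n)" for a d
  proof
    assume "?le (braid_of n a) d"
    then have "inv\<^bsub>braid_group n\<^esub> braid_of n a \<otimes>\<^bsub>braid_group n\<^esub> d \<in> braid_pos n" by (simp only: pre_def)
    then obtain c where c: "c \<in> ?M" "inv\<^bsub>braid_group n\<^esub> braid_of n a \<otimes>\<^bsub>braid_group n\<^esub> d = braid_of n c"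
      unfolding braid_pos_eq by blast
    then have "d = braid_of n a \<otimes>\<^bsub>braid_group n\<^esub> braid_of n c"
      using d braid_of_carrier[OF a] by (simp flip: c(2))
    then show "\<exists>c\<in>?M. d = braid_of n (a * c)" using a c(1) by (auto simp: braid_of_mult)
  next
    assume "\<exists>c\<in>?M. d = braid_of n (a * c)"
    then obtain c where c: "c \<in> ?M" "d = braid_of n a \<otimes>\<^bsub>braid_group n\<^esub> braid_of n c"
      using a by (auto simp: braid_of_mult)
    then show "?le (braid_of n a) d"
      using braid_of_carrier[OF a] braid_of_carrier[OF c(1)] unfolding pre_def by (simp add: braid_pos_eq)
  qed
  have letters_complement: "complement i j \<in> ?M" if "i \<in> {1..<n}" "j \<in> {1..<n}" for i j
    using that by (auto simp: complement_def)
  show ?thesis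
  proof (unfold_locales, rule glb_exists_from_atoms[of ?A])
    show "s \<in> braid_pos n" if "s \<in> ?A" for s using that by (auto simp: braid_pos_eq)
    show "s \<noteq> \<one>\<^bsub>braid_group n\<^esub>" if s: "s \<in> ?A" for s
    proof -
      obtain i where i: "i \<in> {1..<n}" "s = braid_of n (gen i)" using s by blast
      then have "braid_exponent n s = 1" using braid_exponent_of[of "gen i" n] by simp
      then show ?thesis using len_one by auto
    qed
    show "\<exists>s\<in>?A. ?le s a" if a: "a \<in> braid_pos n" "a \<noteq> \<one>\<^bsub>braid_group n\<^esub>" for a
    proof -
      obtain p where p: "p \<in> ?M" "a = braid_of n p" using a by (auto simp: braid_pos_eq)
      obtain w where w: "p = word w" by (rule word_surj)
      have "w \<noteq> []" using a(2) p w by (auto simp: braid_of_one)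
      then obtain i v where v: "w = i # v" by (cases w) auto
      have "?le (braid_of n (gen i)) a"
        using p w v P_carrier[OF a(1)] by (subst pre) (auto intro!: exI[of _ "word v"])
      then show ?thesis using p w v by auto
    qed
    show "\<exists>m. ?lub s t m" if st: "s \<in> ?A" "t \<in> ?A" for s t
    proof -
      obtain i j where ij: "i \<in> {1..<n}" "s = braid_of n (gen i)" "j \<in> {1..<n}" "t = braid_of n (gen j)"
        using st by blast
      let ?m = "gen i * complement i j"
      have m: "?m \<in> ?M" using ij letters_complement[of i j] by auto
      then have mc: "braid_of n ?m \<in> carrier (braid_group n)" by (rule braid_of_carrier)
      have "?lub s t (braid_of n ?m)"
        unfolding is_lub_def
      proof (intro conjI ballI impI)
        show "?le s (braid_of n ?m)" using ij letters_complement[of i j] mc by (auto simp: pre)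
        show "?le t (braid_of n ?m)" using ij letters_complement[of j i] mc by (auto simp: pre gen_complement[of i j])
        fix d assume d: "d \<in> carrier (braid_group n)" "?le s d \<and> ?le t d"
        obtain a where a: "a \<in> ?M" "d = braid_of n (gen i * a)" using d pre[of "gen i" d] ij by auto
        obtain b where b: "b \<in> ?M" "d = braid_of n (gen j * b)" using d pre[of "gen j" d] ij by auto
        have "gen i * a = gen j * b"
          using a b ij braid_of_inj[of "gen i * a" n "gen j * b"] by simp
        then obtain c where c: "a = complement i j * c" using common_lcm unfolding common_lcm_def by blast
        then have "c \<in> ?M" using a by simp
        then show "?le (braid_of n ?m) d" using m d a c by (auto simp: pre mult.assoc)
      qed (rule mc)
      then show ?thesis ..
    qed
  qed
qed

section \<open>The invariants of braids in the lattice of prefixes\<close>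

locale braids =
  fixes n :: nat
  assumes strands: "2 \<le> n"
begin

sublocale garside_group "braid_group n" "braid_pos n" "braid_Delta n" "braid_exponent n"
  using strands by (rule garside_braids)

notation pre (infix "\<preceq>" 50)

lemma prefix_order_eq: "prefix_order n = prefix_gorder"
  by (simp add: prefix_order_def prefix_gorder_def)

lemma prefix_order_le: "a \<sqsubseteq>\<^bsub>prefix_order n\<^esub> b \<longleftrightarrow> a \<preceq> b"
  by (simp add: prefix_order_eq prefix_gorder_le)

lemma simple_braids_eq: "simple_braids n = {s. simple s}"
  by (simp add: simple_braids_def simple_def prefix_order_le Dpow_1)

lemma braid_conj_eq: "braid_conj n = conj_by"
  by (simp add: braid_conj_def conj_by_def fun_eq_iff)

lemma braid_prod_eq: "braid_prod n = product"
  by (simp add: braid_prod_def product_def fun_eq_iff)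

lemma left_weighted_eq: "left_weighted n = weighted"
  by (simp add: left_weighted_def weighted_def simple_braids_eq braid_compl_def prefix_order_eq glb_def Dpow_1 fun_eq_iff)

lemma left_normal_form_eq: "left_normal_form n = normal_form"
  by (simp add: left_normal_form_def normal_form_def simple_braids_eq braid_prod_eq left_weighted_eq Dpow_1 fun_eq_iff
      flip: Dpow_def)

lemma lnf_data:
  assumes "x \<in> carrier (braid_group n)"
  shows "normal_form x (infimum x) (lnf_factors n x)" "lnf_exponent n x = infimum x"
proof -
  obtain p xs where normal_form: "normal_form x p xs" using normal_form_exists assms by blast
  have p: "p = infimum x" using normal_form_infimum[OF normal_form] by simp
  have "lnf_factors n x = xs"
    unfolding lnf_factors_def left_normal_form_eq using normal_form normal_form_unique by (intro the_equality) blast+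
  then show "normal_form x (infimum x) (lnf_factors n x)" using normal_form p by simp
  show "lnf_exponent n x = infimum x"
    unfolding lnf_exponent_def left_normal_form_eq using normal_form normal_form_unique p by (intro the_equality) blast+
qed

lemma canonical_length_eq:
  "x \<in> carrier (braid_group n) \<Longrightarrow> int (canonical_length n x) = supremum x - infimum x"
  using normal_form_supremum[OF lnf_data(1)] by (simp add: canonical_length_def)

lemma initial_factor_eq:
  assumes x: "x \<in> carrier (braid_group n)"
  shows "initial_factor n x = initial x"
proof (cases "lnf_factors n x")
  case Nil
  then have "x = Dpow (infimum x)" using lnf_data(1)[OF x] by (simp add: normal_form_def)
  then have "x \<otimes>\<^bsub>braid_group n\<^esub> Dpow (- infimum x) = \<one>\<^bsub>braid_group n\<^esub>" by (metis Dpow_add Dpow_0 add.right_inverse)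
  then have "initial x = \<one>\<^bsub>braid_group n\<^esub>"
    using Dpow_pre_iff[of 0 1] by (simp add: initial_def glb_commute[of "Dpow 1"] glb_absorb)
  then show ?thesis using Nil by (simp add: initial_factor_def canonical_length_def)
next
  case (Cons y ys)
  then have "normal_form x (infimum x) (y # ys)" using lnf_data(1)[OF x] by simp
  then show ?thesis
    using Cons lnf_data(2)[OF x] normal_form_initial
    by (simp add: initial_factor_def canonical_length_def braid_tau_power_def braid_conj_eq conj_by_def inv_Dpow flip: Dpow_def)
qed

lemma rigid_imp_rigid_el:
  assumes x: "x \<in> carrier (braid_group n)" and r: "rigid n x"
  shows "rigid_el x"
proof -
  have l: "lnf_factors n x \<noteq> []" using r by (auto simp: rigid_def canonical_length_def)
  have "infimum x < supremum x" using canonical_length_eq[OF x] r by (simp add: rigid_def)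
  moreover have "weighted (last (lnf_factors n x)) (initial x)"
    using r x l by (simp add: rigid_def left_weighted_eq initial_factor_eq final_factor_def canonical_length_def)
  then have "glb (initial (inv\<^bsub>braid_group n\<^esub> x)) (initial x) = \<one>\<^bsub>braid_group n\<^esub>"
    using normal_form_initial_inv[OF lnf_data(1)[OF x] l] by (simp add: weighted_def)
  then have "glb (initial x) (initial (inv\<^bsub>braid_group n\<^esub> x)) = \<one>\<^bsub>braid_group n\<^esub>"
    using x glb_commute[of "initial x" "initial (inv\<^bsub>braid_group n\<^esub> x)"] by simp
  ultimately show ?thesis using x by (simp add: rigid_el_def)
qed

lemma cycling_eq: "x \<in> carrier (braid_group n) \<Longrightarrow> cycling n x = cyc x"
  by (simp add: cycling_def cyc_def braid_conj_eq initial_factor_eq)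

lemma cycling_pow_eq: "x \<in> carrier (braid_group n) \<Longrightarrow> (cycling n ^^ k) x = (cyc ^^ k) x"
  by (induction k) (simp_all add: cycling_eq)

end

locale rigid_braid = braids +
  fixes x :: braid
  assumes x_carrier: "x \<in> carrier (braid_group n)" and x_rigid: "rigid n x"
begin

lemma x_rigid_el: "rigid_el x"
  using x_carrier x_rigid by (rule rigid_imp_rigid_el)

sublocale summit_class "braid_group n" "braid_pos n" "braid_Delta n" "braid_exponent n" "conj_class n x" "infimum x" "supremum x"
proof
  fix y assume "y \<in> conj_class n x"
  then obtain g where g: "g \<in> carrier (braid_group n)" "y = conj_by x g" by (auto simp: conj_class_def braid_conj_eq)
  show "y \<in> carrier (braid_group n)" using g x_carrier by simp
  show "conj_by y a \<in> conj_class n x" if "a \<in> carrier (braid_group n)" for a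
    using g x_carrier that by (auto simp: conj_class_def braid_conj_eq simp flip: conj_by_mult)
  show "infimum y \<le> infimum x" unfolding g(2) using x_rigid_el g(1) by (rule rigid_infimum_maximal)
  show "supremum x \<le> supremum y" unfolding g(2) using x_rigid_el g(1) by (rule rigid_supremum_minimal)
next
  show "infimum x < supremum x" using x_rigid_el by (simp add: rigid_el_def)
qed

lemma x_conj_class: "x \<in> conj_class n x"
proof -
  have "conj_by x \<one>\<^bsub>braid_group n\<^esub> \<in> conj_class n x"
    unfolding conj_class_def braid_conj_eq by (intro imageI) simp
  then show ?thesis using x_carrier by simp
qed

lemma summit_length_eq: "summit_length n x = canonical_length n x"
  unfolding summit_length_def
proof (rule Least_equality)
  show "\<exists>y\<in>conj_class n x. canonical_length n y = canonical_length n x" using x_conj_class by blast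
  fix l assume "\<exists>y\<in>conj_class n x. canonical_length n y = l"
  then obtain y where y: "y \<in> conj_class n x" "canonical_length n y = l" by blast
  then have "int (canonical_length n x) \<le> int (canonical_length n y)"
    using canonical_length_eq[OF C_carrier[OF y(1)]] canonical_length_eq[OF x_carrier] C_infimum[OF y(1)] C_supremum[OF y(1)]
    by linarith
  then show "canonical_length n x \<le> l" using y by simp
qed

lemma super_summit_set_eq: "super_summit_set n x = SSS"
proof -
  have "canonical_length n y = canonical_length n x \<longleftrightarrow> infimum y = infimum x \<and> supremum y = supremum x" if y: "y \<in> conj_class n x" for y
  proof -
    have "canonical_length n y = canonical_length n x \<longleftrightarrow> supremum y - infimum y = supremum x - infimum x"
      using canonical_length_eq[OF C_carrier[OF y]] canonical_length_eq[OF x_carrier] by linarith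
    then show ?thesis using C_infimum[OF y] C_supremum[OF y] by linarith
  qed
  then show ?thesis by (auto simp: super_summit_set_def summit_length_eq SSS_def)
qed

lemma ultra_summit_set_eq: "ultra_summit_set n x = USS"
  by (auto simp: ultra_summit_set_def super_summit_set_eq USS_def SSS_carrier cycling_pow_eq)

lemma minimal_simple_eq: "minimal_simple n x y t \<longleftrightarrow> minimal_conj y t"
  by (auto simp: minimal_simple_def minimal_conj_def simple_braids_eq braid_conj_eq ultra_summit_set_eq prefix_order_le)

lemma x_USS: "x \<in> USS"
  using x_conj_class by (intro rigid_USS x_rigid_el) (simp add: SSS_def)

lemma cycling_orbits_eq: "cycling_orbits n x = orbit cyc ` USS"
  unfolding cycling_orbits_def ultra_summit_set_eq
proof (rule image_cong[OF HOL.refl])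
  fix y assume "y \<in> USS"
  then show "orbit (cycling n) y = orbit cyc y"
    unfolding orbit_altdef using cycling_pow_eq[OF USS_carrier] by simp
qed

end

locale minimal_rigid_braid = rigid_braid +
  assumes minimal: "minimal_uss n x"
begin

sublocale minimal_summit_class "braid_group n" "braid_pos n" "braid_Delta n" "braid_exponent n" "conj_class n x" "infimum x" "supremum x"
proof
  show "infimum x + 1 < supremum x"
    using minimal canonical_length_eq[OF x_carrier] by (simp add: minimal_uss_def summit_length_eq)
  fix y assume y: "y \<in> USS"
  note yc = USS_carrier[OF y]
  obtain z where black: "black_arrows n x y = {(y, initial y, z)}"
    using minimal y yc by (auto simp: minimal_uss_def ultra_summit_set_eq initial_factor_eq)
  obtain z' where grey: "grey_arrows n x y = {(y, initial (inv\<^bsub>braid_group n\<^esub> y), z')}"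
    using minimal y yc by (auto simp: minimal_uss_def ultra_summit_set_eq initial_factor_eq)
  have "(y, initial (inv\<^bsub>braid_group n\<^esub> y), z') \<in> grey_arrows n x y" by (simp add: grey)
  then have "minimal_conj y (initial (inv\<^bsub>braid_group n\<^esub> y))"
    by (auto simp: grey_arrows_def uss_arrows_def minimal_simple_eq)
  then show "conj_by y (initial (inv\<^bsub>braid_group n\<^esub> y)) \<in> USS" by (simp add: minimal_conj_def)
  fix t assume t: "minimal_conj y t"
  show "t = initial y" if "t \<preceq> initial y"
  proof -
    have "(y, t, conj_by y t) \<in> black_arrows n x y"
      using t y yc that by (simp add: black_arrows_def uss_arrows_def minimal_simple_eq ultra_summit_set_eq
          braid_conj_eq initial_factor_eq prefix_order_le)
    then show ?thesis by (simp add: black)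
  qed
  show "t = initial (inv\<^bsub>braid_group n\<^esub> y)" if "t \<preceq> initial (inv\<^bsub>braid_group n\<^esub> y)"
  proof -
    have "(y, t, conj_by y t) \<in> grey_arrows n x y"
      using t y yc that by (simp add: grey_arrows_def uss_arrows_def minimal_simple_eq ultra_summit_set_eq
          braid_conj_eq initial_factor_eq prefix_order_le)
    then show ?thesis by (simp add: grey)
  qed
qed

text \<open>
  An element of the ultra summit set is periodic from the start, so the first repetition among its iterates
  is a return to the element itself.
\<close>
lemma cycling_period:
  shows "0 < cycling_period n x" "(cyc ^^ cycling_period n x) x = x"
    "0 < d \<Longrightarrow> d < cycling_period n x \<Longrightarrow> (cyc ^^ d) x \<noteq> x"
proof -
  let ?Q = "\<lambda>t. 0 < t \<and> (\<exists>i<t. (cyc ^^ t) x = (cyc ^^ i) x)"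
  let ?t = "cycling_period n x"
  have t_def: "?t = (LEAST t. ?Q t)"
    by (simp add: cycling_period_def cycling_pow_eq x_carrier)
  have Q: "?Q d" if "0 < d" "(cyc ^^ d) x = x" for d
    using that by (auto intro: exI[of _ 0])
  obtain M where "M > 0" "(cyc ^^ M) x = x" using x_USS by (auto simp: USS_def)
  then have t: "?Q ?t" unfolding t_def using Q by (intro LeastI[of ?Q M]) blast
  have least: "?t \<le> d" if "0 < d" "(cyc ^^ d) x = x" for d
    unfolding t_def using Q[OF that] by (rule Least_le)
  show pos: "0 < ?t" using t by simp
  obtain i where i: "i < ?t" "(cyc ^^ ?t) x = (cyc ^^ i) x" using t by blast
  have e: "(cyc ^^ (?t - i)) x = x" using USS_cyc_cancel[OF x_USS, of "?t - i" i] i by simp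
  then have "?t \<le> ?t - i" using i by (intro least) auto
  then have "i = 0" using pos by simp
  then show "(cyc ^^ ?t) x = x" using e by simp
  show "0 < d \<Longrightarrow> d < ?t \<Longrightarrow> (cyc ^^ d) x \<noteq> x" using least[of d] by auto
qed

lemma preferred_cycling_conjugator_eq:
  "preferred_cycling_conjugator n x = cycling_prod x (cycling_period n x)"
proof -
  have "product (map (\<lambda>k. initial ((cyc ^^ k) x)) [0..<m]) = cycling_prod x m" for m
  proof (induction m)
    case (Suc m)
    have "set (map (\<lambda>k. initial ((cyc ^^ k) x)) [0..<m]) \<subseteq> carrier (braid_group n)"
      using x_carrier by (auto intro!: initial_carrier cyc_pow_carrier)
    then show ?case using Suc x_carrier by (simp add: product_append)
  qed simp
  then show ?thesis
    by (simp add: preferred_cycling_conjugator_def braid_prod_eq cycling_pow_eq x_carrier initial_factor_eq)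
qed

lemma subgroup_centralizer: "subgroup (braid_centralizer n x) (braid_group n)"
proof (rule subgroupI)
  show "braid_centralizer n x \<subseteq> carrier (braid_group n)" by (auto simp: braid_centralizer_def)
  show "braid_centralizer n x \<noteq> {}" using x_carrier by (auto simp: braid_centralizer_def)
  fix a assume a: "a \<in> braid_centralizer n x"
  have iff: "g \<in> braid_centralizer n x \<longleftrightarrow> g \<in> carrier (braid_group n) \<and> conj_by x g = x" for g
    using x_carrier conj_by_eq_iff[of x x g] by (simp add: braid_centralizer_def eq_commute cong: conj_cong)
  have ac: "a \<in> carrier (braid_group n)" "conj_by x a = x" using a iff by auto
  have "conj_by (conj_by x a) (inv\<^bsub>braid_group n\<^esub> a) = x" using ac(1) x_carrier by (simp flip: conj_by_mult)
  then have "conj_by x (inv\<^bsub>braid_group n\<^esub> a) = x" by (simp only: ac(2))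
  then show "inv\<^bsub>braid_group n\<^esub> a \<in> braid_centralizer n x" using a iff by simp
  fix b assume "b \<in> braid_centralizer n x"
  then show "a \<otimes>\<^bsub>braid_group n\<^esub> b \<in> braid_centralizer n x" using a x_carrier by (simp add: iff conj_by_mult)
qed

theorem centralizer_eq:
  assumes two: "card (cycling_orbits n x) = 2"
  shows "braid_centralizer n x = generate (braid_group n)
    {preferred_cycling_conjugator n x, braid_Delta n [^]\<^bsub>braid_group n\<^esub> (2::nat)}"
proof
  let ?c = "preferred_cycling_conjugator n x" and ?d = "braid_Delta n [^]\<^bsub>braid_group n\<^esub> (2::nat)"
  have c: "?c \<in> carrier (braid_group n)" using x_carrier by (simp add: preferred_cycling_conjugator_eq)
  have d: "?d = Dpow 2" by (simp add: Dpow_def flip: int_pow_int)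
  have gens: "{?c, ?d} \<subseteq> carrier (braid_group n)" using c by simp
  note gen_subgroup = generate_is_subgroup[OF gens]
  show "braid_centralizer n x \<subseteq> generate (braid_group n) {?c, ?d}"
  proof
    fix g assume g: "g \<in> braid_centralizer n x"
    have conj: "\<exists>g\<in>carrier (braid_group n). y = conj_by x g" if "y \<in> conj_class n x" for y
      using that by (auto simp: conj_class_def braid_conj_eq)
    obtain q j :: int where g_eq: "g = ?c [^]\<^bsub>braid_group n\<^esub> q \<otimes>\<^bsub>braid_group n\<^esub> Dpow (2 * j)"
      using centralizer_form[OF x_USS conj, of g "cycling_period n x"] g two cycling_period
      by (auto simp: braid_centralizer_def cycling_orbits_eq preferred_cycling_conjugator_eq)
    have "Dpow (2 * j) = ?d [^]\<^bsub>braid_group n\<^esub> j"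
      unfolding d by (simp add: Dpow_def int_pow_pow)
    then show "g \<in> generate (braid_group n) {?c, ?d}"
      unfolding g_eq
      by (simp only:) (intro subgroup.m_closed[OF gen_subgroup] subgroup_int_pow_closed[OF gen_subgroup] generate.incl insertI1 insertI2)
  qed
  have "{?c, ?d} \<subseteq> braid_centralizer n x"
  proof -
    have "conj_by x ?c = x" using conj_by_cycling_prod[OF x_carrier] cycling_period(2) by (simp add: preferred_cycling_conjugator_eq)
    moreover have "conj_by x ?d = x" using conj_by_Dpow_even[OF x_carrier, of 1] by (simp add: d)
    ultimately show ?thesis
      using c x_carrier gens by (auto simp: braid_centralizer_def conj_by_eq_iff)
  qed
  then show "generate (braid_group n) {?c, ?d} \<subseteq> braid_centralizer n x"
    using subgroup_centralizer by (rule generate_subgroup_incl)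
qed

end

text \<open>
  On fewer than two strands \<open>\<Delta> = 1\<close> is not a Garside element in the above sense; but then the group is trivial and no
  braid has positive canonical length.
\<close>
lemma rigid_imp_two_strands:
  assumes x: "x \<in> carrier (braid_group n)" and r: "rigid n x"
  shows "2 \<le> n"
proof (rule ccontr)
  assume "\<not> 2 \<le> n"
  then have "braid_words n = {[]}" by (auto simp: braid_words_def)
  then have triv: "carrier (braid_group n) = {\<one>\<^bsub>braid_group n\<^esub>}"
    by (simp add: carrier_braid_group braid_of_word_Nil)
  interpret group "braid_group n" by (rule braid_group_is_group)
  have one: "x = \<one>\<^bsub>braid_group n\<^esub>" using x triv by simp
  have "xs = []" if "left_normal_form n x p xs" for p xs
  proof -
    have "set xs \<subseteq> carrier (braid_group n) - {\<one>\<^bsub>braid_group n\<^esub>}"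
      using that by (auto simp: left_normal_form_def simple_braids_def)
    then show ?thesis by (simp add: triv)
  qed
  moreover have "left_normal_form n x 0 []"
    by (simp add: left_normal_form_def braid_prod_def one)
  ultimately have "lnf_factors n x = []" unfolding lnf_factors_def by (intro the_equality) blast+
  then show False using r by (simp add: rigid_def canonical_length_def)
qed

theorem theorem5p3:
  fixes n :: nat and x :: braid
  assumes "x \<in> carrier (braid_group n)"
    and "rigid n x"
    and "minimal_uss n x"
    and "card (cycling_orbits n x) = 2"
  shows "braid_centralizer n x =
    generate (braid_group n)
      {preferred_cycling_conjugator n x, braid_Delta n [^]\<^bsub>braid_group n\<^esub> (2::nat)}"
proof -
  interpret minimal_rigid_braid n x
    by unfold_locales (use assms rigid_imp_two_strands in auto)
  show ?thesis using assms(4) by (rule centralizer_eq)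
qed

end
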